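(* Let $h$ be a real-valued function on $[0,+\infty)$ satisfying the following two conditions. (1) The function $\lambda(x)=\frac{1-h(x)}{x}$ is convex on $(0,+\infty)$. (2) For some $\alpha\in(0,1]$ and $\delta>0$ the series $\sum_{k\in\mathbb{Z}}h(|k|^\alpha\delta)e^{ikt}$ is the Fourier series of some function $g_{\alpha,\delta}\in L_1$. Let $G_{\alpha,\delta}$ be the operator $G_{\alpha,\delta}(f)(x)=\frac1{2\pi}\int_{-\pi}^{\pi}f(x-t)g_{\alpha,\delta}(t)\,dt$, and let $p=1$ or $p=\infty$. Then: 1. If $\beta$ is an odd integer, then for all $n\in\mathbb{N}$ and $r\ge\alpha$ $$E(\mathbf{W}^{r,\beta}_{p,n};G_{\alpha,\delta})_p=\frac{4}{\pi n^r}\sum_{k=0}^{\infty}\frac{1-h((2k+1)^\alpha n^\alpha\delta)}{(2k+1)^{r+1}} .$$ 2. If $\beta$ is an even integer, then for $n=1$ and all $r\ge\alpha+1$ $$E(\mathbf{W}^{r,\beta}_{p,n};G_{\alpha,\delta})_p=\frac{4}{\pi n^r}\sum_{k=0}^{\infty}\frac{1-h((2k+1)^\alpha n^\alpha\delta)}{(2k+1)^{r+1}}(-1)^k .\qquad( * )$$ If in addition $\lambda\in C^1(0,+\infty)$ and the function $-\lambda'(x)$ is convex on $(0,+\infty)$, then (still for $\beta$ even) equality $( * )$ holds for all $n\in\mathbb{N}$ and $r\ge\alpha$.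
   Context: $\mathbb{N}=\{1,2,\dots\}$. $L_p$, $1\le p\le\infty$, is the space of $2\pi$-periodic real-valued measurable functions with finite norm $\|f\|_p=(\int_{-\pi}^{\pi}|f(t)|^p\,dt)^{1/p}$ for $p<\infty$ and $\|f\|_\infty=\operatorname{ess\,sup}_{[-\pi,\pi]}|f|$. Fourier coefficients: $\widehat{\varphi}(k)=\frac1{2\pi}\int_{-\pi}^{\pi}\varphi(t)e^{-ikt}\,dt$; the Fourier series of $\varphi$ is $\sum_{k\in\mathbb{Z}}\widehat\varphi(k)e^{ikt}$. For $n\in\mathbb{N}$, $H_p^n=\{\varphi\in L_p:\|\varphi\|_p\le1,\ \widehat\varphi(k)=0\text{ for all }k\in\mathbb{Z},\ |k|\le n-1\}$. For $r>0$ and $\beta\in\mathbb{R}$ put $$\psi_{r,\beta}(t)=\sum_{k\ne0}\frac{e^{-i\beta\pi\operatorname{sign}(k)/2}}{|k|^r}e^{ikt}=\sum_{k=1}^\infty\frac{2\cos(kt-\beta\pi/2)}{k^r};$$ this function belongs to $L_1$ and the series is its Fourier series. $\mathbf{W}^{r,\beta}_{p,n}$ is the class of all functions $f(x)=\frac1{2\pi}\int_{-\pi}^{\pi}\varphi(x-t)\psi_{r,\beta}(t)\,dt$ with $\varphi\in H_p^n$. For an operator $G$, $E(\mathbf{W}^{r,\beta}_{p,n};G)_p=\sup\{\|f-G(f)\|_p: f\in\mathbf{W}^{r,\beta}_{p,n}\}$. *)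

theory Defs
  imports "HOL-Probability.Essential_Supremum"
begin

abbreviation period :: "real measure" where
  "period \<equiv> lebesgue_on {-pi..pi}"

text \<open>The norm for \<open>1 \<le> p \<le> \<infinity>\<close>, with value \<open>\<infinity>\<close> when it is not finite.\<close>

definition Lp_norm :: "ereal \<Rightarrow> (real \<Rightarrow> real) \<Rightarrow> ereal" where
  "Lp_norm p f =
     (if p = \<infinity> then esssup period (\<lambda>t. ereal \<bar>f t\<bar>)
      else let I = (\<integral>\<^sup>+ t. ennreal (\<bar>f t\<bar> powr real_of_ereal p) \<partial>period)
           in if I = \<infinity> then \<infinity> else ereal (enn2real I powr (1 / real_of_ereal p)))"

definition Lp_space :: "ereal \<Rightarrow> (real \<Rightarrow> real) set" where
  "Lp_space p = {f. f \<in> borel_measurable lebesgue \<and> (\<forall>t. f (t + 2 * pi) = f t) \<and> Lp_norm p f < \<infinity>}"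

definition fourier_coeff :: "(real \<Rightarrow> real) \<Rightarrow> int \<Rightarrow> complex" where
  "fourier_coeff f k =
     1 / (2 * pi) * (\<integral>t. complex_of_real (f t) * exp (- \<i> * of_int k * of_real t) \<partial>period)"

definition convolution :: "(real \<Rightarrow> real) \<Rightarrow> (real \<Rightarrow> real) \<Rightarrow> real \<Rightarrow> real" where
  "convolution f g x = 1 / (2 * pi) * (\<integral>t. f (x - t) * g t \<partial>period)"

definition Hclass :: "ereal \<Rightarrow> nat \<Rightarrow> (real \<Rightarrow> real) set" where
  "Hclass p n = {\<phi> \<in> Lp_space p. Lp_norm p \<phi> \<le> 1 \<and>
                   (\<forall>k::int. \<bar>k\<bar> \<le> int n - 1 \<longrightarrow> fourier_coeff \<phi> k = 0)}"

text \<open>The series converges for every \<open>t\<close> outside \<open>2\<pi>\<int>\<close>. On that null set it may diverge,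
  and the value is then irrelevant because the function is only used under the integral.\<close>

definition psi :: "real \<Rightarrow> real \<Rightarrow> real \<Rightarrow> real" where
  "psi r \<beta> t = (\<Sum>j. 2 * cos (real (Suc j) * t - \<beta> * pi / 2) / real (Suc j) powr r)"

definition Wclass :: "ereal \<Rightarrow> real \<Rightarrow> real \<Rightarrow> nat \<Rightarrow> (real \<Rightarrow> real) set" where
  "Wclass p r \<beta> n = {convolution \<phi> (psi r \<beta>) | \<phi>. \<phi> \<in> Hclass p n}"

definition approx_error ::
    "ereal \<Rightarrow> (real \<Rightarrow> real) set \<Rightarrow> ((real \<Rightarrow> real) \<Rightarrow> real \<Rightarrow> real) \<Rightarrow> ereal" where
  "approx_error p W G = (SUP f\<in>W. Lp_norm p (\<lambda>x. f x - G f x))"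

end

theory Submission
  imports Defs
begin

text \<open>
  The deviation \<open>f - G f\<close> of \<open>f = \<phi> * \<psi>\<close> equals \<open>\<phi> * K\<close>, where the kernel \<open>K\<close> has the
  Fourier coefficients \<open>c k = (1 - h (k\<^sup>\<alpha> \<delta>)) / k\<^sup>r\<close> with phase \<open>\<theta> = \<beta> \<pi> / 2\<close>. Since the numbers
  \<open>h (k\<^sup>\<alpha> \<delta>)\<close> are bounded, \<open>\<lambda>\<close> tends to \<open>0\<close> along a sequence, so the convex function \<open>\<lambda>\<close> is
  decreasing and nonnegative, and \<open>c x = \<delta> \<lambda> (\<delta> x\<^sup>\<alpha>) x\<^sup>\<alpha>\<^sup>-\<^sup>r\<close> is convex and decreasing. By duality the error is
  \<open>1 / (2 \<pi>)\<close> times the integral of \<open>K\<close> against \<open>s t = sgn (cos (n t - \<theta>))\<close> as soon as \<open>K\<close> has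
  approximations by trigonometric polynomials \<open>T\<close> of degree below \<open>n\<close> for which \<open>K - T\<close> has, up to small
  errors in the mean, the sign of \<open>s\<close>; expanding the integral gives the series.

  It suffices to find such \<open>T\<close> for kernels with finitely many coefficients that approximate \<open>K\<close> in the
  mean. Modulo degrees below \<open>n\<close>, the kernel is \<open>cos (n t - \<theta>) (d 0 + 2 \<Sum> d k cos (k t))\<close>, where
  \<open>c m = d (m - n) \<plusminus> d (m + n)\<close>, so \<open>d\<close> is a sum (\<open>\<beta>\<close> odd) or an alternating sum (\<open>\<beta>\<close> even) of \<open>c\<close>
  along a progression of step \<open>2 n\<close>. If \<open>d\<close> is convex, the second factor is nonnegative. For odd \<open>\<beta>\<close>
  convexity of \<open>c\<close> suffices, and \<open>max (c - \<epsilon>) 0\<close> is a convex truncation; for even \<open>\<beta>\<close> the second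
  differences of \<open>c\<close> have to decrease, which is what convexity of \<open>-\<lambda>'\<close> provides, and one truncates \<open>d\<close>
  instead. For \<open>n = 1\<close> and \<open>\<beta>\<close> even, \<open>K\<close> is minus the primitive of a kernel of the odd type, hence
  monotone on \<open>(0, \<pi>)\<close>.
\<close>

section \<open>Cosine series with decreasing coefficients\<close>

text \<open>The square wave changes sign under the shift by pi / n, so it carries only odd multiples
  of the frequency n. Hence it is orthogonal to every T, and the mean of |K - T| equals the integral
  of K against s once the signs agree. The obstacle is that K is merely integrable: r may be below
  1, the series then need not converge absolutely, and K may be unbounded at 0. All limits therefore
  run through one majorant, a multiple of |t| powr (\<rho> - 1) with 0 < \<rho> < 1, shared by all
  cosine series whose coefficients decrease and stay below a common C k powr -\<rho>. A sharp cutoff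
  keeps this monotonicity and serves for partial sums, but it destroys convexity, hence the
  subtraction of \<epsilon> before cutting. The exponents make c a product of nonnegative decreasing
  convex functions: \<alpha> \<le> 1 makes x powr \<alpha> concave, r \<ge> \<alpha> makes the
  remaining power decreasing. If -\<lambda>' is of this kind too, so is -c', a sum of such products.
  The weight k of the primitive lowers r by one, hence r \<ge> \<alpha> + 1 when n = 1.\<close>

lemma convex_cosine_sum_nonneg:
  fixes d :: "nat \<Rightarrow> real"
  assumes supp: "\<And>k. L \<le> k \<Longrightarrow> d k = 0"
    and conv: "\<And>k. 2 * d (Suc k) \<le> d k + d (Suc (Suc k))"
    and t: "cos t \<noteq> 1"
  shows "0 \<le> d 0 + 2 * (\<Sum>k<L. d (Suc k) * cos (real (Suc k) * t))"
proof -
  \<comment> \<open>\<open>w\<close> is the second difference of \<open>d\<close>. Summing by parts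
    twice, after multiplication by 1 - cos t, leaves nonnegative multiples of 1 - cos ((k + 1) t),
    that is of Fejer kernels times 1 - cos t. The boundary terms at N vanish for N = L.\<close>
  define w where "w k = d k - 2 * d (Suc k) + d (Suc (Suc k))" for k
  have eq: "(1 - cos t) * (d 0 + 2 * (\<Sum>k<N. d (Suc k) * cos (real (Suc k) * t)))
     = (\<Sum>k<N. w k * (1 - cos (real (Suc k) * t)))
       + (d N - d (Suc N) + d (Suc N) * cos (real N * t) - d N * cos (real (Suc N) * t))" for N
  proof (induction N)
    case 0
    show ?case by (simp add: algebra_simps)
  next
    case (Suc N)
    have c: "cos (real (Suc (Suc N)) * t) = 2 * cos t * cos (real (Suc N) * t) - cos (real N * t)"
      using cos_add[of "real (Suc N) * t" t] cos_diff[of "real (Suc N) * t" t]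
      by (simp add: algebra_simps)
    show ?case
      unfolding sum.lessThan_Suc distrib_left mult.assoc[symmetric] c
      using Suc.IH by (simp add: w_def algebra_simps)
  qed
  have "0 \<le> (\<Sum>k<L. w k * (1 - cos (real (Suc k) * t)))"
    using conv by (intro sum_nonneg mult_nonneg_nonneg) (simp_all add: w_def algebra_simps)
  also have "\<dots> = (1 - cos t) * (d 0 + 2 * (\<Sum>k<L. d (Suc k) * cos (real (Suc k) * t)))"
    unfolding eq by (simp add: supp)
  finally show ?thesis
    using t cos_le_one[of t] by (simp add: zero_le_mult_iff)
qed

text \<open>Summation by parts: the weights \<open>a N\<close> and \<open>a k - a (Suc k)\<close>
  are nonnegative and add up to \<open>a 0\<close>, while each partial sum of \<open>b\<close> is at
  most \<open>B\<close> in modulus.\<close>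

lemma abel_sum_bound:
  fixes a b :: "nat \<Rightarrow> real"
  assumes dec: "\<And>k. a (Suc k) \<le> a k" and nonneg: "\<And>k. 0 \<le> a k"
    and B: "\<And>N. \<bar>\<Sum>k<N. b k\<bar> \<le> B"
  shows "\<bar>\<Sum>k<N. a k * b k\<bar> \<le> a 0 * B"
proof -
  define s where "s n = (\<Sum>k<n. b k)" for n
  have eq: "(\<Sum>k<N. a k * b k) = a N * s N + (\<Sum>k<N. (a k - a (Suc k)) * s (Suc k))"
    by (induction N) (simp_all add: s_def algebra_simps)
  have "\<bar>a N * s N + (\<Sum>k<N. (a k - a (Suc k)) * s (Suc k))\<bar>
      \<le> \<bar>a N * s N\<bar> + (\<Sum>k<N. \<bar>(a k - a (Suc k)) * s (Suc k)\<bar>)"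
    by (rule order_trans[OF abs_triangle_ineq]) (simp add: sum_abs)
  also have "\<dots> \<le> a N * B + (\<Sum>k<N. (a k - a (Suc k)) * B)"
    using dec nonneg B[folded s_def]
    by (intro add_mono sum_mono) (auto simp: abs_mult intro!: mult_mono)
  also have "\<dots> = a 0 * B"
    using sum_lessThan_telescope'[of a N]
    by (simp only: sum_distrib_right[symmetric] distrib_right[symmetric]) simp
  finally show ?thesis unfolding eq .
qed

text \<open>A weak form of Jordan's inequality, whose best factor is 1 / pi. With y = x / 2 it
  follows from y cos y \<le> sin y, as sin x = 2 sin y cos y \<ge> 2 y (cos y)^2 = x (1 + cos x) /
  2.\<close>

lemma abs_sin_half_ge:
  fixes t :: real
  assumes "\<bar>t\<bar> \<le> pi"
  shows "\<bar>t\<bar> / 4 \<le> \<bar>sin (t / 2)\<bar>"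
proof -
  have key: "x / 2 \<le> sin x" if x: "0 \<le> x" "x \<le> pi / 2" for x :: real
  proof -
    define y where "y = x / 2"
    have y: "0 \<le> y" "y < pi / 2" using x pi_gt_zero unfolding y_def by linarith+
    have "y * cos y \<le> sin y"
    proof -
      have "0 * cos 0 - sin 0 \<ge> y * cos y - sin (y::real)"
      proof (rule DERIV_nonpos_imp_nonincreasing[OF y(1)])
        fix z assume z: "0 \<le> z" "z \<le> y"
        have "((\<lambda>z. z * cos z - sin z) has_real_derivative - (z * sin z)) (at z)"
          by (auto intro!: derivative_eq_intros)
        moreover have "0 \<le> z * sin z"
          using z y by (intro mult_nonneg_nonneg sin_ge_zero) auto
        ultimately show "\<exists>D. ((\<lambda>z. z * cos z - sin z) has_real_derivative D) (at z) \<and> D \<le> 0"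
          by (intro exI[of _ "- (z * sin z)"]) auto
      qed
      then show ?thesis by simp
    qed
    moreover have "0 \<le> cos y" using y by (intro cos_ge_zero) auto
    ultimately have "y * cos y * cos y \<le> sin y * cos y" by (rule mult_right_mono)
    moreover have "sin x = 2 * sin y * cos y" using sin_double[of y] by (simp add: y_def)
    moreover have "2 * (cos y)\<^sup>2 = 1 + cos x" using cos_double_cos[of y] by (simp add: y_def)
    moreover have "0 \<le> cos x" using x by (intro cos_ge_zero) auto
    moreover have "x * (1 + cos x) / 2 = 2 * (y * cos y * cos y)"
      unfolding \<open>2 * (cos y)\<^sup>2 = 1 + cos x\<close>[symmetric] by (simp add: y_def power2_eq_square)
    ultimately have "x * (1 + cos x) / 2 \<le> sin x" by linarith
    moreover have "x / 2 \<le> x * (1 + cos x) / 2" using x \<open>0 \<le> cos x\<close> by (simp add: algebra_simps)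
    ultimately show ?thesis by linarith
  qed
  show ?thesis
  proof (cases "0 \<le> t")
    case True
    then show ?thesis using key[of "t/2"] assms by (simp add: abs_if)
  next
    case False
    then show ?thesis using key[of "-t/2"] assms by (simp add: abs_if)
  qed
qed

text \<open>Multiplication by 2 sin (t / 2) telescopes the sum to a difference of two sines. The
  bound depends neither on the start \<open>m\<close> and the length \<open>N\<close> nor on the
  phase, as Abel summation of tails requires.\<close>

lemma cosine_block_bound:
  fixes t \<theta> :: real
  assumes "t \<noteq> 0" "\<bar>t\<bar> \<le> pi"
  shows "\<bar>\<Sum>k<N. cos (real (m + k) * t - \<theta>)\<bar> \<le> 4 / \<bar>t\<bar>"
proof -
  have eq: "2 * sin (t/2) * (\<Sum>k<N. cos (real (m + k) * t - \<theta>))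
      = sin ((real (m + N) - 1/2) * t - \<theta>) - sin ((real m - 1/2) * t - \<theta>)"
  proof (induction N)
    case (Suc N)
    have "sin ((real (m + Suc N) - 1/2) * t - \<theta>) - sin ((real (m + N) - 1/2) * t - \<theta>)
        = 2 * sin (t/2) * cos (real (m + N) * t - \<theta>)"
      using sin_add[of "real (m + N) * t - \<theta>" "t/2"] sin_diff[of "real (m + N) * t - \<theta>" "t/2"]
      by (simp add: algebra_simps)
    with Suc show ?case by (simp add: algebra_simps)
  qed simp
  have "\<bar>2 * sin (t/2)\<bar> * \<bar>\<Sum>k<N. cos (real (m + k) * t - \<theta>)\<bar> \<le> 2"
    unfolding abs_mult[symmetric] eq
    using sin_le_one[of "(real (m + N) - 1/2) * t - \<theta>"] sin_ge_minus_one[of "(real (m + N) - 1/2) * t - \<theta>"]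
      sin_le_one[of "(real m - 1/2) * t - \<theta>"] sin_ge_minus_one[of "(real m - 1/2) * t - \<theta>"]
    by linarith
  moreover have "\<bar>t\<bar>/4 * \<bar>\<Sum>k<N. cos (real (m + k) * t - \<theta>)\<bar>
      \<le> \<bar>sin (t/2)\<bar> * \<bar>\<Sum>k<N. cos (real (m + k) * t - \<theta>)\<bar>"
    by (intro mult_right_mono abs_sin_half_ge assms) auto
  ultimately show ?thesis
    using assms by (simp add: abs_mult field_simps)
qed

text \<open>Comparison with the integral of x powr -\<rho>, one step at a time by the mean value
  theorem.\<close>

lemma sum_powr_neg_le:
  fixes \<rho> :: real
  assumes "0 < \<rho>" "\<rho> < 1"
  shows "(\<Sum>k<m. real (Suc k) powr - \<rho>) \<le> real m powr (1 - \<rho>) / (1 - \<rho>)"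
proof (induction m)
  case (Suc m)
  have "(1 - \<rho>) * real (Suc m) powr - \<rho> \<le> real (Suc m) powr (1 - \<rho>) - real m powr (1 - \<rho>)"
  \<comment> \<open>For \<open>m = 0\<close> the power is not differentiable at the left end 0;
    there the claim reads 1 - \<rho> \<le> 1.\<close>
  proof (cases "m = 0")
    case False
    have "\<exists>z. real m < z \<and> z < real (Suc m) \<and> real (Suc m) powr (1 - \<rho>) - real m powr (1 - \<rho>)
        = (real (Suc m) - real m) * ((1 - \<rho>) * z powr (1 - \<rho> - 1))"
      using False by (intro MVT2) (auto intro!: derivative_eq_intros simp: field_simps)
    then obtain z where z: "real m < z" "z < real (Suc m)"
      "real (Suc m) powr (1 - \<rho>) - real m powr (1 - \<rho>) = (1 - \<rho>) * z powr - \<rho>" by auto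
    have "real (Suc m) powr - \<rho> \<le> z powr - \<rho>"
      using z assms False by (intro powr_mono2') auto
    then show ?thesis using z(3) assms by (simp add: mult_left_mono)
  qed (use assms in simp)
  then have "real (Suc m) powr - \<rho> \<le> real (Suc m) powr (1 - \<rho>) / (1 - \<rho>) - real m powr (1 - \<rho>) / (1 - \<rho>)"
    using assms by (simp add: diff_divide_distrib[symmetric] pos_le_divide_eq mult.commute)
  with Suc show ?case by simp
qed simp

text \<open>Frequencies start at 1. Where the series diverges, as is possible at multiples of 2 pi,
  \<open>suminf\<close> has no meaningful value, so facts about infinite series are stated for 0 <
  |t| \<le> pi or almost everywhere.\<close>

definition cosine_series :: "(nat \<Rightarrow> real) \<Rightarrow> real \<Rightarrow> real \<Rightarrow> real" where
  "cosine_series a \<theta> t = (\<Sum>k. a (Suc k) * cos (real (Suc k) * t - \<theta>))"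

text \<open>\<open>C\<close> and \<open>\<rho>\<close> are parameters because whole families of
  coefficient sequences have to share them: they determine the common majorant in
  \<open>cosine_series_bound\<close>.\<close>

definition dominated_decreasing :: "real \<Rightarrow> real \<Rightarrow> (nat \<Rightarrow> real) \<Rightarrow> bool" where
  "dominated_decreasing C \<rho> a \<longleftrightarrow>
     (\<forall>k. a (Suc (Suc k)) \<le> a (Suc k) \<and> 0 \<le> a (Suc k) \<and> a (Suc k) \<le> C * real (Suc k) powr - \<rho>)"

context
  fixes a :: "nat \<Rightarrow> real" and C \<rho> t \<theta> :: real
  assumes a: "dominated_decreasing C \<rho> a" and t: "t \<noteq> 0" "\<bar>t\<bar> \<le> pi" and \<rho>: "0 < \<rho>" "\<rho> < 1"
begin

lemma cosine_tail_bound: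
  "\<bar>\<Sum>k=m..<N. a (Suc k) * cos (real (Suc k) * t - \<theta>)\<bar> \<le> a (Suc m) * (4 / \<bar>t\<bar>)"
proof (cases "m \<le> N")
  case True
  have "(\<Sum>k=m..<N. a (Suc k) * cos (real (Suc k) * t - \<theta>))
      = (\<Sum>k<N-m. a (Suc m + k) * cos (real (Suc m + k) * t - \<theta>))"
    by (rule sum.reindex_bij_witness[of _ "\<lambda>k. m + k" "\<lambda>k. k - m"]) auto
  also have "\<bar>\<dots>\<bar> \<le> a (Suc m + 0) * (4 / \<bar>t\<bar>)"
    using a by (intro abel_sum_bound cosine_block_bound t) (auto simp: dominated_decreasing_def)
  finally show ?thesis by simp
qed (use a in \<open>simp add: dominated_decreasing_def\<close>)

lemma dominated_decreasing_tendsto_0: "(\<lambda>k. a (Suc k)) \<longlonglongrightarrow> 0"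
proof (rule tendsto_sandwich[where f = "\<lambda>_. 0" and h = "\<lambda>k. C * real (Suc k) powr - \<rho>"])
  have "(\<lambda>k. real (Suc k) powr - \<rho>) \<longlonglongrightarrow> 0"
    using \<rho> by (intro tendsto_neg_powr filterlim_compose[OF filterlim_real_sequentially] filterlim_Suc) auto
  then show "(\<lambda>k. C * real (Suc k) powr - \<rho>) \<longlonglongrightarrow> 0" by (auto intro: tendsto_mult_right_zero)
qed (use a in \<open>auto simp: dominated_decreasing_def\<close>)

lemma cosine_series_summable: "summable (\<lambda>k. a (Suc k) * cos (real (Suc k) * t - \<theta>))"
  unfolding summable_Cauchy
proof (intro allI impI)
  fix e :: real assume "0 < e"
  then have "eventually (\<lambda>m. a (Suc m) < e * \<bar>t\<bar> / 4) sequentially"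
    using dominated_decreasing_tendsto_0 t by (intro order_tendstoD) auto
  then obtain M where M: "\<And>m. m \<ge> M \<Longrightarrow> a (Suc m) < e * \<bar>t\<bar> / 4"
    by (auto simp: eventually_sequentially)
  have "norm (\<Sum>k=m..<N. a (Suc k) * cos (real (Suc k) * t - \<theta>)) < e" if "m \<ge> M" for m N
  proof -
    have "a (Suc m) * (4 / \<bar>t\<bar>) < e" using M[OF that] t by (simp add: field_simps)
    with cosine_tail_bound[of m N] show ?thesis by simp
  qed
  then show "\<exists>N. \<forall>m\<ge>N. \<forall>n. norm (\<Sum>k=m..<n. a (Suc k) * cos (real (Suc k) * t - \<theta>)) < e" by blast
qed

lemma cosine_series_remainder:
  "\<bar>cosine_series a \<theta> t - (\<Sum>k<m. a (Suc k) * cos (real (Suc k) * t - \<theta>))\<bar> \<le> a (Suc m) * (4 / \<bar>t\<bar>)"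
proof (rule tendsto_upperbound)
  let ?f = "\<lambda>k. a (Suc k) * cos (real (Suc k) * t - \<theta>)"
  show "(\<lambda>N. \<bar>(\<Sum>k<N. ?f k) - (\<Sum>k<m. ?f k)\<bar>) \<longlonglongrightarrow> \<bar>cosine_series a \<theta> t - (\<Sum>k<m. ?f k)\<bar>"
    unfolding cosine_series_def
    by (intro tendsto_intros summable_LIMSEQ cosine_series_summable)
  show "eventually (\<lambda>N. \<bar>(\<Sum>k<N. ?f k) - (\<Sum>k<m. ?f k)\<bar> \<le> a (Suc m) * (4 / \<bar>t\<bar>)) sequentially"
    using eventually_ge_at_top[of m]
  proof eventually_elim
    case (elim N)
    have "{..<N} = {..<m} \<union> {m..<N}" using elim by auto
    then have "(\<Sum>k<N. ?f k) - (\<Sum>k<m. ?f k) = (\<Sum>k=m..<N. ?f k)"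
      by (simp add: sum.union_disjoint ivl_disj_int)
    then show ?case using cosine_tail_bound[of m N] by simp
  qed
qed simp

text \<open>The sum is split near 1 / |t|: below it the coefficients are added in absolute value,
  which gives the constant 1 / (1 - \<rho>); beyond it the Abel bound gives 4. Both parts have the
  integrable order |t| powr (\<rho> - 1).\<close>

lemma cosine_series_bound: "\<bar>cosine_series a \<theta> t\<bar> \<le> C * (1 / (1 - \<rho>) + 4) * \<bar>t\<bar> powr (\<rho> - 1)"
proof -
  have C: "0 \<le> C" using a by (auto simp: dominated_decreasing_def dest!: spec[of _ 0])
  define m where "m = nat \<lfloor>1 / \<bar>t\<bar>\<rfloor>"
  have m: "real m \<le> 1 / \<bar>t\<bar>" "1 / \<bar>t\<bar> \<le> real (Suc m)"
    using t by (auto simp: m_def of_nat_nat) linarith+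
  have p: "(1 / \<bar>t\<bar>) powr (1 - \<rho>) = \<bar>t\<bar> powr (\<rho> - 1)"
    using t by (simp add: powr_divide powr_minus_divide[symmetric])
  have "\<bar>\<Sum>k<m. a (Suc k) * cos (real (Suc k) * t - \<theta>)\<bar> \<le> (\<Sum>k<m. \<bar>a (Suc k) * cos (real (Suc k) * t - \<theta>)\<bar>)"
    by (rule sum_abs)
  also have "\<dots> \<le> (\<Sum>k<m. C * real (Suc k) powr - \<rho>)"
  proof (rule sum_mono)
    fix k
    have "\<bar>a (Suc k) * cos (real (Suc k) * t - \<theta>)\<bar> \<le> a (Suc k) * 1"
      unfolding abs_mult using a by (intro mult_mono) (auto simp: dominated_decreasing_def)
    also have "\<dots> \<le> C * real (Suc k) powr - \<rho>" using a by (simp add: dominated_decreasing_def)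
    finally show "\<bar>a (Suc k) * cos (real (Suc k) * t - \<theta>)\<bar> \<le> C * real (Suc k) powr - \<rho>" .
  qed
  also have "\<dots> \<le> C * (real m powr (1 - \<rho>) / (1 - \<rho>))"
    unfolding sum_distrib_left[symmetric] using C \<rho> by (intro mult_left_mono sum_powr_neg_le)
  also have "\<dots> \<le> C * ((1 / \<bar>t\<bar>) powr (1 - \<rho>) / (1 - \<rho>))"
    using C \<rho> m by (intro mult_left_mono divide_right_mono powr_mono2) auto
  finally have 1: "\<bar>\<Sum>k<m. a (Suc k) * cos (real (Suc k) * t - \<theta>)\<bar> \<le> C * (\<bar>t\<bar> powr (\<rho> - 1) / (1 - \<rho>))"
    unfolding p .
  have "a (Suc m) \<le> C * real (Suc m) powr - \<rho>" using a by (simp add: dominated_decreasing_def)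
  also have "\<dots> \<le> C * (1 / \<bar>t\<bar>) powr - \<rho>"
    using C \<rho> m t by (intro mult_left_mono powr_mono2') auto
  finally have "a (Suc m) * (4 / \<bar>t\<bar>) \<le> C * (1 / \<bar>t\<bar>) powr - \<rho> * (4 / \<bar>t\<bar>)"
    by (rule mult_right_mono) simp
  also have "\<dots> = C * 4 * (\<bar>t\<bar> powr (\<rho> - 1))"
    using t by (simp add: powr_divide powr_diff powr_minus field_simps)
  finally show ?thesis
    using 1 cosine_series_remainder[of m] by (simp add: algebra_simps)
qed

end

section \<open>Integration of periodic functions\<close>

text \<open>Cutting at a point and shifting one piece by a period moves any interval of length
  \<open>P\<close> onto the one starting at 0. Half-open intervals fit together without overlap, and
  in \<open>ennreal\<close> no integrability is involved.\<close>

lemma nn_integral_periodic: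
  fixes f :: "real \<Rightarrow> ennreal"
  assumes f[measurable]: "f \<in> borel_measurable lebesgue" and per: "\<And>t. f (t + P) = f t" and P: "0 < P"
  shows "(\<integral>\<^sup>+t. f t * indicator {a..<a + real m * P} t \<partial>lebesgue)
       = of_nat m * (\<integral>\<^sup>+t. f t * indicator {0..<P} t \<partial>lebesgue)"
proof -
  define N where "N a b = (\<integral>\<^sup>+t. f t * indicator {a..<b} t \<partial>lebesgue)" for a b
  have shift1: "N (a + P) (b + P) = N a b" for a b
  proof -
    have "N (a + P) (b + P) = (\<integral>\<^sup>+t. f (P + 1 * t) * indicator {a + P..<b + P} (P + 1 * t) \<partial>lebesgue)"
      unfolding N_def by (subst nn_integral_real_affine_lebesgue[where c = 1 and t = P])
        (auto intro!: borel_measurable_times_ennreal f borel_measurable_indicator)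
    also have "\<dots> = N a b"
      unfolding N_def using per by (intro nn_integral_cong) (auto simp: add.commute indicator_def)
    finally show ?thesis .
  qed
  have add: "N a b + N b c = N a c" if "a \<le> b" "b \<le> c" for a b c
  proof -
    have m: "(\<lambda>t. f t * indicator {a..<b} t) \<in> borel_measurable lebesgue" for a b
      by (intro borel_measurable_times_ennreal f borel_measurable_indicator) auto
    show ?thesis
      unfolding N_def nn_integral_add[OF m m, symmetric]
      using that by (intro nn_integral_cong) (auto simp: indicator_def)
  qed
  \<comment> \<open>The interval from a to a + P is cut at \<open>b\<close>; shifting its first
    piece by one period to the other end produces the interval from b to b + P.\<close>
  have local: "N b (b + P) = N a (a + P)" if "a \<le> b" "b \<le> a + P" for a b
    using add[of a b "a + P"] add[of b "a + P" "b + P"] shift1[of a b] that by (simp add: add.commute)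
  have shift: "N (a + real k * P) (b + real k * P) = N a b" for a b k
  proof (induction k)
    case (Suc k)
    then show ?case
      using shift1[of "a + real k * P" "b + real k * P"] by (simp add: algebra_simps)
  qed simp
  have one: "N a (a + P) = N 0 P" for a
  proof -
    define k where "k = \<lfloor>a / P\<rfloor>"
    define c where "c = a - of_int k * P"
    have "of_int k \<le> a / P" "a / P < of_int k + 1" by (auto simp: k_def)
    then have c: "0 \<le> c" "c \<le> 0 + P" using P by (auto simp: c_def field_simps)
    have "N a (a + P) = N c (c + P)"
    proof (cases "0 \<le> k")
      case True
      then show ?thesis using shift[of c "nat k" "c + P"] by (simp add: c_def of_nat_nat)
    next
      case False
      then show ?thesis using shift[of a "nat (- k)" "a + P"] by (simp add: c_def of_nat_nat algebra_simps)
    qed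
    also have "\<dots> = N 0 P" using local[OF c] by simp
    finally show ?thesis .
  qed
  have "N a (a + real m * P) = of_nat m * N 0 P"
  proof (induction m)
    case 0
    show ?case by (simp add: N_def)
  next
    case (Suc m)
    have "N a (a + real (Suc m) * P) = N a (a + real m * P) + N (a + real m * P) (a + real m * P + P)"
      using P by (subst add) (auto simp: algebra_simps)
    with Suc show ?case unfolding one by (simp add: algebra_simps)
  qed
  then show ?thesis unfolding N_def .
qed

lemma borel_measurable_lebesgue_affine:
  fixes f :: "real \<Rightarrow> 'a::topological_space"
  assumes "f \<in> borel_measurable lebesgue" "c \<noteq> 0"
  shows "(\<lambda>t. f (x + c * t)) \<in> borel_measurable lebesgue"
  using measurable_compose[OF lebesgue_affine_measurable[of "\<lambda>_. c" x] assms(1)] assms(2) by simp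

lemma nn_integral_Icc_Ico:
  fixes f :: "real \<Rightarrow> ennreal"
  shows "(\<integral>\<^sup>+t. f t * indicator {a..b} t \<partial>lebesgue) = (\<integral>\<^sup>+t. f t * indicator {a..<b} t \<partial>lebesgue)"
proof (rule nn_integral_cong_AE)
  have "AE t in lebesgue. t \<noteq> b" using AE_completion[OF AE_lborel_singleton[of b]] .
  then show "AE t in lebesgue. f t * indicator {a..b} t = f t * indicator {a..<b} t"
    by eventually_elim (auto simp: indicator_def)
qed

text \<open>The image of the period under t -> x + c t is the interval from x - pi to x + pi for
  both signs, so translations and reflections are handled together; convolutions use c = -1.\<close>

lemma nn_integral_period_affine:
  fixes f :: "real \<Rightarrow> ennreal"
  assumes f: "f \<in> borel_measurable lebesgue" and per: "\<And>t. f (t + 2 * pi) = f t" and c: "c = 1 \<or> c = -1"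
  shows "(\<integral>\<^sup>+t. f (x + c * t) \<partial>period) = (\<integral>\<^sup>+t. f t \<partial>period)"
proof -
  have Ico: "(\<integral>\<^sup>+t. f t * indicator {a..a + 2 * pi} t \<partial>lebesgue) = (\<integral>\<^sup>+t. f t * indicator {0..<2*pi} t \<partial>lebesgue)" for a
    unfolding nn_integral_Icc_Ico using nn_integral_periodic[OF f per, of a 1] by simp
  have 1: "\<bar>c\<bar> = 1" using c by auto
  have "(\<integral>\<^sup>+t. f t * indicator {x - pi..x - pi + 2 * pi} t \<partial>lebesgue)
      = (\<integral>\<^sup>+t. f (x + c * t) * indicator {x - pi..x - pi + 2 * pi} (x + c * t) \<partial>lebesgue)"
    using f c by (subst nn_integral_real_affine_lebesgue[where c = c and t = x])
      (auto simp: 1 intro!: borel_measurable_times_ennreal borel_measurable_indicator)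
  also have "\<dots> = (\<integral>\<^sup>+t. f (x + c * t) * indicator {-pi..pi} t \<partial>lebesgue)"
    using c by (intro nn_integral_cong) (auto simp: indicator_def)
  also have "\<dots> = (\<integral>\<^sup>+t. f (x + c * t) \<partial>period)" by (simp add: nn_integral_restrict_space)
  finally have "(\<integral>\<^sup>+t. f (x + c * t) \<partial>period) = (\<integral>\<^sup>+t. f t * indicator {0..<2*pi} t \<partial>lebesgue)"
    unfolding Ico by simp
  also have "\<dots> = (\<integral>\<^sup>+t. f t * indicator {-pi..-pi + 2*pi} t \<partial>lebesgue)" unfolding Ico ..
  finally show ?thesis by (simp add: nn_integral_restrict_space)
qed

lemma measurable_period_affine:
  fixes f :: "real \<Rightarrow> 'a::topological_space"
  assumes "f \<in> borel_measurable lebesgue" "c \<noteq> 0"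
  shows "(\<lambda>t. f (x + c * t)) \<in> borel_measurable period"
  using borel_measurable_lebesgue_affine[OF assms] by (rule measurable_restrict_space1)

lemma
  fixes f :: "real \<Rightarrow> real"
  assumes f: "f \<in> borel_measurable lebesgue" and per: "\<And>t. f (t + 2 * pi) = f t" and c: "c = 1 \<or> c = -1"
  shows integrable_period_affine_iff: "integrable period (\<lambda>t. f (x + c * t)) \<longleftrightarrow> integrable period f"
    and integral_period_affine: "(\<integral>t. f (x + c * t) \<partial>period) = (\<integral>t. f t \<partial>period)"
proof -
  have c0: "c \<noteq> 0" using c by auto
  have m: "(\<lambda>t. f (x + c * t)) \<in> borel_measurable period" "f \<in> borel_measurable period"
    using measurable_period_affine[OF f c0, of x] measurable_restrict_space1[OF f] by auto
  \<comment> \<open>Taking \<open>g\<close> as the norm, the positive part and the negative part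
    transfers the identity from \<open>ennreal\<close> to integrability and to the Bochner
    integral.\<close>
  have nn: "(\<integral>\<^sup>+t. g (f (x + c * t)) \<partial>period) = (\<integral>\<^sup>+t. g (f t) \<partial>period)"
    if "g \<in> borel_measurable borel" for g :: "real \<Rightarrow> ennreal"
    using nn_integral_period_affine[of "\<lambda>t. g (f t)", OF _ _ c] measurable_compose[OF f that] per by simp
  show iff: "integrable period (\<lambda>t. f (x + c * t)) \<longleftrightarrow> integrable period f"
    unfolding integrable_iff_bounded using m nn[of "\<lambda>y. ennreal (norm y)"] by simp
  show "(\<integral>t. f (x + c * t) \<partial>period) = (\<integral>t. f t \<partial>period)"
  proof (cases "integrable period f")
    case True
    then show ?thesis
      using iff nn[of ennreal] nn[of "\<lambda>y. ennreal (- y)"] by (simp add: real_lebesgue_integral_def)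
  next
    case False
    then show ?thesis using iff by (simp add: not_integrable_integral_eq)
  qed
qed

lemma finite_measure_period: "finite_measure period"
  by (rule finite_measure_lebesgue_on) auto

lemma sigma_finite_period: "sigma_finite_measure period"
  using finite_measure_period by (simp add: finite_measure_def)

lemma integrable_period_bounded:
  fixes f :: "real \<Rightarrow> real"
  assumes "f \<in> borel_measurable period" "\<And>t. \<bar>f t\<bar> \<le> B"
  shows "integrable period f"
  using finite_measure.integrable_const_bound[OF finite_measure_period, of f B] assms by simp

text \<open>Reduces the full circle to \<open>m\<close> copies of one small period, whose starting
  point \<open>a\<close> can be placed where the integrand is explicit.\<close>

lemma integral_small_period:
  fixes q :: "real \<Rightarrow> real"
  assumes q: "q \<in> borel_measurable lebesgue" and B: "\<And>t. \<bar>q t\<bar> \<le> B"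
    and per: "\<And>t. q (t + P) = q t" and P: "0 < P" "real m * P = 2 * pi"
  shows "(\<integral>t. q t \<partial>period) = real m * (\<integral>t. q t \<partial>lebesgue_on {a..a + P})"
proof -
  have nn: "(\<integral>\<^sup>+t. g (q t) \<partial>period) = of_nat m * (\<integral>\<^sup>+t. g (q t) \<partial>lebesgue_on {a..a + P})"
    if "g \<in> borel_measurable borel" for g :: "real \<Rightarrow> ennreal"
  proof -
    note h = nn_integral_periodic[of "\<lambda>t. g (q t)" P, OF measurable_compose[OF q that] _ P(1)]
    have "(\<integral>\<^sup>+t. g (q t) \<partial>period) = (\<integral>\<^sup>+t. g (q t) * indicator {-pi..<-pi + real m * P} t \<partial>lebesgue)"
      using P by (simp add: nn_integral_restrict_space nn_integral_Icc_Ico)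
    also have "\<dots> = of_nat m * (\<integral>\<^sup>+t. g (q t) * indicator {a..<a + real 1 * P} t \<partial>lebesgue)"
      using per by (subst (1 2) h) auto
    finally show ?thesis by (simp add: nn_integral_restrict_space nn_integral_Icc_Ico)
  qed
  have "integrable period q"
    using measurable_restrict_space1[OF q] B by (rule integrable_period_bounded)
  moreover have "integrable (lebesgue_on {a..a + P}) q"
    using finite_measure.integrable_const_bound[OF finite_measure_lebesgue_on[of "{a..a+P}"], of q B]
      measurable_restrict_space1[OF q] B by simp
  ultimately show ?thesis
    using nn[of ennreal] nn[of "\<lambda>y. ennreal (- y)"]
    by (simp add: real_lebesgue_integral_def enn2real_mult right_diff_distrib)
qed

text \<open>These are the elements of \<open>Lp_space 1\<close>, freed of the \<open>ereal\<close>
  norm; see \<open>Lp_space_1_iff\<close>.\<close>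

definition periodic_L1 :: "(real \<Rightarrow> real) \<Rightarrow> bool" where
  "periodic_L1 f \<longleftrightarrow> f \<in> borel_measurable lebesgue \<and> (\<forall>t. f (t + 2 * pi) = f t) \<and> integrable period f"

lemma periodic_L1_integrable: "periodic_L1 f \<Longrightarrow> integrable period f"
  by (simp add: periodic_L1_def)

lemma periodic_L1_diff: "periodic_L1 f \<Longrightarrow> periodic_L1 g \<Longrightarrow> periodic_L1 (\<lambda>t. f t - g t)"
  by (auto simp: periodic_L1_def)

lemma integral_period_translate:
  assumes "periodic_L1 f"
  shows "(\<integral>t. f (x - t) \<partial>period) = (\<integral>t. f t \<partial>period)" "(\<integral>t. f (x + t) \<partial>period) = (\<integral>t. f t \<partial>period)"
    "integrable period (\<lambda>t. f (x - t))" "integrable period (\<lambda>t. f (x + t))"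
  using assms integral_period_affine[of f "-1" x] integral_period_affine[of f 1 x]
    integrable_period_affine_iff[of f "-1" x] integrable_period_affine_iff[of f 1 x]
  by (simp_all add: periodic_L1_def)

lemma AE_lebesgue_affine:
  fixes x c :: real
  assumes "AE t in lebesgue. Q t" "c \<noteq> 0"
  shows "AE t in lebesgue. Q (x + c * t)"
proof -
  from assms(1) obtain N where N: "{t. \<not> Q t} \<subseteq> N" "N \<in> null_sets lebesgue"
    by (auto elim!: AE_E2 AE_E3 simp: eventually_ae_filter)
  have [measurable]: "N \<in> sets lebesgue" using N by auto
  have "(\<integral>\<^sup>+t. indicator N t \<partial>lebesgue) = ennreal \<bar>c\<bar> * (\<integral>\<^sup>+t. indicator N (x + c * t) \<partial>lebesgue)"
    using assms by (intro nn_integral_real_affine_lebesgue) auto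
  then have "(\<integral>\<^sup>+t. indicator N (x + c * t) \<partial>lebesgue) = 0"
    using N assms(2) by (auto simp: null_sets_def)
  then have "AE t in lebesgue. (indicator N (x + c * t) :: ennreal) = 0"
    using borel_measurable_lebesgue_affine[of "indicator N :: real \<Rightarrow> ennreal" c x] assms(2)
    by (subst (asm) nn_integral_0_iff_AE) auto
  then show ?thesis by eventually_elim (use N in \<open>auto simp: indicator_def split: if_splits\<close>)
qed

lemma AE_period_affine:
  fixes x c :: real
  assumes "AE t in lebesgue. Q t" "c \<noteq> 0"
  shows "AE t in period. Q (x + c * t)"
  using AE_lebesgue_affine[OF assms, of x] by (subst AE_restrict_space_iff) (auto elim: eventually_mono)

text \<open>A Borel version makes (x, t) -> f (x - t) measurable on the product, which Lebesgue
  measurability of \<open>f\<close> does not give directly.\<close>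

lemma borel_representative:
  fixes f :: "real \<Rightarrow> real"
  assumes "f \<in> borel_measurable lebesgue"
  obtains f' where "f' \<in> borel_measurable borel" "AE t in lebesgue. f t = f' t"
  using completion_ex_borel_measurable_real[OF assms] AE_completion by fastforce

section \<open>Convolution\<close>

lemma pair_sigma_finite_period: "pair_sigma_finite period period"
  by (simp add: pair_sigma_finite_def sigma_finite_period)

lemma measurable_period_diff:
  "(\<lambda>(x, t). x - t) \<in> borel_measurable (lebesgue \<Otimes>\<^sub>M period)"
  "(\<lambda>(x, t). x - t) \<in> borel_measurable (period \<Otimes>\<^sub>M period)"
proof -
  have "(\<lambda>x. x) \<in> borel_measurable lebesgue" "(\<lambda>x. x) \<in> borel_measurable period"
    using id_borel_measurable_lebesgue id_borel_measurable_lebesgue_on by (simp_all add: id_def)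
  note id = this
  show "(\<lambda>(x, t). x - t) \<in> borel_measurable (lebesgue \<Otimes>\<^sub>M period)"
    "(\<lambda>(x, t). x - t) \<in> borel_measurable (period \<Otimes>\<^sub>M period)"
    unfolding case_prod_beta
    by (rule borel_measurable_diff[OF measurable_compose[OF measurable_fst id(1)] measurable_compose[OF measurable_snd id(2)]]
        borel_measurable_diff[OF measurable_compose[OF measurable_fst id(2)] measurable_compose[OF measurable_snd id(2)]])+
qed

lemma borel_measurable_period:
  fixes f :: "real \<Rightarrow> 'a::topological_space"
  assumes "f \<in> borel_measurable borel"
  shows "f \<in> borel_measurable period" "f \<in> borel_measurable lebesgue"
proof -
  show "f \<in> borel_measurable lebesgue" using assms by (intro measurable_completion) simp
  then show "f \<in> borel_measurable period" by (rule measurable_restrict_space1)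
qed

context
  fixes \<phi> b :: "real \<Rightarrow> real"
  assumes \<phi>: "periodic_L1 \<phi>" and b: "integrable period b"
begin

text \<open>Young's inequality for L1. Tonelli evaluates the double integral of |\<phi>' (x - t) b
  t| as the product of the two norms; its finiteness yields integrability of almost every section
  and the bound on the norm.\<close>

lemma convolution_borel_measurable: "convolution \<phi> b \<in> borel_measurable lebesgue"
  and convolution_integrand_integrable: "AE x in period. integrable period (\<lambda>t. \<phi> (x - t) * b t)"
  and integrable_convolution: "integrable period (convolution \<phi> b)"
  and convolution_norm_le:
    "(\<integral>x. \<bar>convolution \<phi> b x\<bar> \<partial>period) \<le> 1 / (2 * pi) * (\<integral>t. \<bar>\<phi> t\<bar> \<partial>period) * (\<integral>t. \<bar>b t\<bar> \<partial>period)"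
proof -
  interpret pair_sigma_finite period period by (rule pair_sigma_finite_period)
  have \<phi>m: "\<phi> \<in> borel_measurable lebesgue" and \<phi>p: "\<And>t. \<phi> (t + 2 * pi) = \<phi> t"
    and \<phi>i: "integrable period \<phi>"
    using \<phi> by (auto simp: periodic_L1_def)
  have bm: "b \<in> borel_measurable period" using b by auto
  obtain \<phi>' where [measurable]: "\<phi>' \<in> borel_measurable borel" and ae: "AE t in lebesgue. \<phi> t = \<phi>' t"
    using borel_representative[OF \<phi>m] by blast
  have ae': "AE t in period. \<phi> (x - t) = \<phi>' (x - t)" for x
    using AE_period_affine[OF ae, of "-1" x] by simp
  have m1: "(\<lambda>t. \<phi> (x - t) * b t) \<in> borel_measurable period" for x
    using measurable_period_affine[OF \<phi>m, of "-1" x] bm by (intro borel_measurable_times) auto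
  have joint: "(\<lambda>p. \<phi>' (fst p - snd p)) \<in> borel_measurable (lebesgue \<Otimes>\<^sub>M period)"
    "(\<lambda>p. \<phi>' (fst p - snd p)) \<in> borel_measurable (period \<Otimes>\<^sub>M period)"
    using measurable_compose[OF measurable_period_diff(1), of \<phi>' borel]
      measurable_compose[OF measurable_period_diff(2), of \<phi>' borel]
    by (simp_all add: case_prod_beta)
  have "(\<lambda>t. \<phi>' (x - t)) \<in> borel_measurable borel" "(\<lambda>x. \<phi>' (x - t)) \<in> borel_measurable borel" for x t
    by measurable
  note sections = this[THEN borel_measurable_period(1)]
  have m2: "(\<lambda>t. \<phi>' (x - t) * b t) \<in> borel_measurable period" for x
    by (rule borel_measurable_times[OF sections(1)[of x] bm])
  \<comment> \<open>For each fixed \<open>x\<close> the functions \<open>\<phi>\<close> and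
    \<open>\<phi>'\<close> agree at x - t for almost every t, so replacing one by the other changes
    the convolution at no point.\<close>
  have eq: "convolution \<phi> b = (\<lambda>x. 1 / (2 * pi) * (\<integral>t. \<phi>' (x - t) * b t \<partial>period))"
  proof
    fix x
    have "(\<integral>t. \<phi> (x - t) * b t \<partial>period) = (\<integral>t. \<phi>' (x - t) * b t \<partial>period)"
    proof (rule integral_cong_AE[OF m1 m2])
      show "AE t in period. \<phi> (x - t) * b t = \<phi>' (x - t) * b t"
        using ae'[of x] by eventually_elim simp
    qed
    then show "convolution \<phi> b x = 1 / (2 * pi) * (\<integral>t. \<phi>' (x - t) * b t \<partial>period)"
      by (simp add: convolution_def)
  qed
  have jm: "(\<lambda>p. \<phi>' (fst p - snd p) * b (snd p)) \<in> borel_measurable (lebesgue \<Otimes>\<^sub>M period)"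
    "(\<lambda>p. \<phi>' (fst p - snd p) * b (snd p)) \<in> borel_measurable (period \<Otimes>\<^sub>M period)"
    by (rule borel_measurable_times[OF joint(1) measurable_compose[OF measurable_snd bm]]
        borel_measurable_times[OF joint(2) measurable_compose[OF measurable_snd bm]])+
  show meas: "convolution \<phi> b \<in> borel_measurable lebesgue"
    unfolding eq using sigma_finite_measure.borel_measurable_lebesgue_integral[OF sigma_finite_period,
        of "\<lambda>x t. \<phi>' (x - t) * b t" lebesgue] jm by (simp add: case_prod_beta)
  then have meas': "convolution \<phi> b \<in> borel_measurable period" by (rule measurable_restrict_space1)
  let ?I = "\<lambda>x. \<integral>\<^sup>+t. ennreal (norm (\<phi>' (x - t) * b t)) \<partial>period"
  have I_meas: "?I \<in> borel_measurable period"
    using jm(2) by (intro sigma_finite_measure.borel_measurable_nn_integral[OF sigma_finite_period])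
      (simp add: case_prod_beta)
  have inner: "(\<integral>\<^sup>+x. ennreal \<bar>\<phi>' (x - t)\<bar> \<partial>period) = ennreal (\<integral>t. \<bar>\<phi> t\<bar> \<partial>period)" for t
  proof -
    have "AE x in period. \<phi> (-t + 1 * x) = \<phi>' (-t + 1 * x)" by (rule AE_period_affine[OF ae]) simp
    then have "(\<integral>\<^sup>+x. ennreal \<bar>\<phi>' (x - t)\<bar> \<partial>period) = (\<integral>\<^sup>+x. ennreal \<bar>\<phi> (-t + 1 * x)\<bar> \<partial>period)"
      by (intro nn_integral_cong_AE) (auto elim!: eventually_mono)
    also have "\<dots> = (\<integral>\<^sup>+x. ennreal \<bar>\<phi> x\<bar> \<partial>period)"
      using \<phi>m \<phi>p by (intro nn_integral_period_affine) auto
    also have "\<dots> = ennreal (\<integral>t. \<bar>\<phi> t\<bar> \<partial>period)"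
      using \<phi>i by (intro nn_integral_eq_integral) auto
    finally show ?thesis .
  qed
  have "(\<integral>\<^sup>+x. ?I x \<partial>period) = (\<integral>\<^sup>+t. (\<integral>\<^sup>+x. ennreal (norm (\<phi>' (x - t) * b t)) \<partial>period) \<partial>period)"
    using jm(2) by (intro Fubini'[symmetric]) (simp add: case_prod_beta)
  also have "\<dots> = (\<integral>\<^sup>+t. ennreal (\<integral>t. \<bar>\<phi> t\<bar> \<partial>period) * ennreal \<bar>b t\<bar> \<partial>period)"
  proof (rule nn_integral_cong)
    fix t
    have "(\<lambda>x. ennreal \<bar>\<phi>' (x - t)\<bar>) \<in> borel_measurable period"
      using sections(2) by measurable
    then have "(\<integral>\<^sup>+x. ennreal (norm (\<phi>' (x - t) * b t)) \<partial>period) = (\<integral>\<^sup>+x. ennreal \<bar>\<phi>' (x - t)\<bar> \<partial>period) * ennreal \<bar>b t\<bar>"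
      by (subst nn_integral_multc[symmetric]) (auto simp: abs_mult ennreal_mult)
    then show "(\<integral>\<^sup>+x. ennreal (norm (\<phi>' (x - t) * b t)) \<partial>period) = ennreal (\<integral>t. \<bar>\<phi> t\<bar> \<partial>period) * ennreal \<bar>b t\<bar>"
      unfolding inner .
  qed
  also have "\<dots> = ennreal ((\<integral>t. \<bar>\<phi> t\<bar> \<partial>period) * (\<integral>t. \<bar>b t\<bar> \<partial>period))"
    using b by (subst nn_integral_cmult) (auto simp: nn_integral_eq_integral ennreal_mult)
  finally have tot: "(\<integral>\<^sup>+x. ?I x \<partial>period) = ennreal ((\<integral>t. \<bar>\<phi> t\<bar> \<partial>period) * (\<integral>t. \<bar>b t\<bar> \<partial>period))" .
  then have "AE x in period. ?I x \<noteq> \<infinity>"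
    by (intro nn_integral_PInf_AE[OF I_meas]) simp
  then show "AE x in period. integrable period (\<lambda>t. \<phi> (x - t) * b t)"
  proof eventually_elim
    case (elim x)
    then have "integrable period (\<lambda>t. \<phi>' (x - t) * b t)"
      using m2 by (auto simp: integrable_iff_bounded top.not_eq_extremum)
    moreover have "integrable period (\<lambda>t. \<phi> (x - t) * b t) = integrable period (\<lambda>t. \<phi>' (x - t) * b t)"
      using ae'[of x] by (intro integrable_cong_AE m1 m2) (auto elim!: eventually_mono)
    ultimately show ?case by simp
  qed
  have nnle: "(\<integral>\<^sup>+x. ennreal \<bar>convolution \<phi> b x\<bar> \<partial>period)
      \<le> ennreal (1 / (2 * pi) * (\<integral>t. \<bar>\<phi> t\<bar> \<partial>period) * (\<integral>t. \<bar>b t\<bar> \<partial>period))"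
  proof -
    \<comment> \<open>Where the section is not integrable the integral is 0 by convention and the
      estimate is trivial.\<close>
    have "ennreal \<bar>convolution \<phi> b x\<bar> \<le> ennreal (1 / (2 * pi)) * ?I x" for x
    proof -
      have "ennreal \<bar>convolution \<phi> b x\<bar> = ennreal (1 / (2 * pi)) * ennreal (norm (\<integral>t. \<phi>' (x - t) * b t \<partial>period))"
        by (simp add: eq abs_mult ennreal_mult[symmetric])
      also have "\<dots> \<le> ennreal (1 / (2 * pi)) * ?I x"
        by (cases "integrable period (\<lambda>t. \<phi>' (x - t) * b t)")
          (auto intro!: mult_left_mono integral_norm_bound_ennreal[of _ "\<lambda>t. \<phi>' (x - t) * b t", unfolded real_norm_def]
            simp: not_integrable_integral_eq)
      finally show ?thesis .
    qed
    then have "(\<integral>\<^sup>+x. ennreal \<bar>convolution \<phi> b x\<bar> \<partial>period) \<le> (\<integral>\<^sup>+x. ennreal (1 / (2 * pi)) * ?I x \<partial>period)"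
      by (intro nn_integral_mono) auto
    also have "\<dots> = ennreal (1 / (2 * pi)) * (\<integral>\<^sup>+x. ?I x \<partial>period)"
      using I_meas by (rule nn_integral_cmult)
    also have "\<dots> = ennreal (1 / (2 * pi) * (\<integral>t. \<bar>\<phi> t\<bar> \<partial>period) * (\<integral>t. \<bar>b t\<bar> \<partial>period))"
      unfolding tot by (subst ennreal_mult[symmetric]) (auto simp: mult.assoc)
    finally show ?thesis .
  qed
  then show int: "integrable period (convolution \<phi> b)"
    using meas' by (auto simp: integrable_iff_bounded intro: le_less_trans)
  then show "(\<integral>x. \<bar>convolution \<phi> b x\<bar> \<partial>period) \<le> 1 / (2 * pi) * (\<integral>t. \<bar>\<phi> t\<bar> \<partial>period) * (\<integral>t. \<bar>b t\<bar> \<partial>period)"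
    using nnle by (subst (asm) nn_integral_eq_integral) (auto simp: ennreal_le_iff integral_nonneg_AE)
qed

lemma periodic_L1_convolution: "periodic_L1 (convolution \<phi> b)"
proof -
  have "\<phi> (x + 2 * pi - t) = \<phi> (x - t)" for x t
  proof -
    have "x + 2 * pi - t = (x - t) + 2 * pi" by simp
    then show ?thesis using \<phi> by (simp only: periodic_L1_def)
  qed
  then show ?thesis
    using convolution_borel_measurable integrable_convolution
    by (simp add: periodic_L1_def convolution_def)
qed

end

text \<open>Only almost everywhere: both integrands must be integrable for the integral to
  split.\<close>

lemma convolution_diff_right:
  assumes "periodic_L1 \<phi>" "integrable period b" "integrable period c"
  shows "AE x in period. convolution \<phi> (\<lambda>t. b t - c t) x = convolution \<phi> b x - convolution \<phi> c x"
  using convolution_integrand_integrable[OF assms(1,2)] convolution_integrand_integrable[OF assms(1,3)]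
  by eventually_elim (simp add: convolution_def right_diff_distrib)

lemma convolution_diff_left:
  assumes "periodic_L1 \<phi>" "periodic_L1 \<eta>" "integrable period b"
  shows "AE x in period. convolution (\<lambda>t. \<phi> t - \<eta> t) b x = convolution \<phi> b x - convolution \<eta> b x"
  using convolution_integrand_integrable[OF assms(1,3)] convolution_integrand_integrable[OF assms(2,3)]
  by eventually_elim (simp add: convolution_def left_diff_distrib right_diff_distrib)

lemma convolution_bounded_integrable:
  assumes "periodic_L1 \<phi>" "b \<in> borel_measurable period" "\<And>t. \<bar>b t\<bar> \<le> B"
  shows "integrable period (\<lambda>t. \<phi> (x - t) * b t)"
proof (rule Bochner_Integration.integrable_bound)
  show "integrable period (\<lambda>t. B * \<phi> (x - t))"
    using integral_period_translate(3)[OF assms(1)] by simp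
  show "(\<lambda>t. \<phi> (x - t) * b t) \<in> borel_measurable period"
    using assms(2) integral_period_translate(3)[OF assms(1), of x] by measurable
  show "AE t in period. norm (\<phi> (x - t) * b t) \<le> norm (B * \<phi> (x - t))"
  proof (rule AE_I2)
    fix t
    have "\<bar>b t\<bar> \<le> \<bar>B\<bar>" using assms(3)[of t] by linarith
    then have "\<bar>b t\<bar> * \<bar>\<phi> (x - t)\<bar> \<le> \<bar>B\<bar> * \<bar>\<phi> (x - t)\<bar>" by (rule mult_right_mono) (rule abs_ge_zero)
    then show "norm (\<phi> (x - t) * b t) \<le> norm (B * \<phi> (x - t))"
      unfolding real_norm_def abs_mult by (subst mult.commute)
  qed
qed

text \<open>Unlike the estimate in the mean this holds at every \<open>x\<close>, because the
  reflection t -> x - t carries the exceptional set of \<open>\<phi>\<close> to a null set for each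
  x.\<close>

lemma convolution_Linf_bound:
  assumes \<phi>: "periodic_L1 \<phi>" "AE t in period. \<bar>\<phi> t\<bar> \<le> B" and b: "integrable period b"
  shows "\<bar>convolution \<phi> b x\<bar> \<le> 1 / (2 * pi) * B * (\<integral>t. \<bar>b t\<bar> \<partial>period)"
proof -
  have "AE t in period. \<bar>\<phi> (x - t)\<bar> \<le> B"
  proof -
    \<comment> \<open>\<open>e\<close> marks the exceptional set as a periodic function, so that its
      vanishing integral over a period survives the substitution.\<close>
    define e where "e t = (if \<bar>\<phi> t\<bar> \<le> B then 0 else 1 :: ennreal)" for t
    have em: "e \<in> borel_measurable lebesgue" and ep: "\<And>t. e (t + 2 * pi) = e t"
    proof -
      have [measurable]: "\<phi> \<in> borel_measurable lebesgue" using \<phi> by (simp add: periodic_L1_def)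
      show "e \<in> borel_measurable lebesgue" unfolding e_def by measurable
    qed (use \<phi> in \<open>simp add: e_def periodic_L1_def\<close>)
    have "(\<integral>\<^sup>+t. e t \<partial>period) = 0"
      using \<phi>(2) measurable_restrict_space1[OF em]
      by (subst nn_integral_0_iff_AE) (auto simp: e_def elim!: eventually_mono)
    then have "(\<integral>\<^sup>+t. e (x + (-1) * t) \<partial>period) = 0"
      by (subst nn_integral_period_affine[OF em ep]) auto
    then have "AE t in period. e (x + (-1) * t) = 0"
      using measurable_period_affine[OF em, of "-1" x] by (subst (asm) nn_integral_0_iff_AE) auto
    then show ?thesis by eventually_elim (auto simp: e_def split: if_splits)
  qed
  then have le: "AE t in period. \<bar>\<phi> (x - t) * b t\<bar> \<le> B * \<bar>b t\<bar>"
    by eventually_elim (auto simp: abs_mult intro!: mult_right_mono)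
  have "(\<lambda>t. \<phi> (x - t) * b t) \<in> borel_measurable period"
    using b integral_period_translate(3)[OF \<phi>(1), of x] by measurable
  moreover have Bb: "integrable period (\<lambda>t. B * \<bar>b t\<bar>)" using b by simp
  ultimately have "integrable period (\<lambda>t. \<phi> (x - t) * b t)"
    using le by (intro Bochner_Integration.integrable_bound[OF Bb]) (auto elim!: eventually_mono)
  then have "(\<integral>t. \<bar>\<phi> (x - t) * b t\<bar> \<partial>period) \<le> (\<integral>t. B * \<bar>b t\<bar> \<partial>period)"
    using Bb le by (intro integral_mono_AE integrable_abs)
  then have "\<bar>\<integral>t. \<phi> (x - t) * b t \<partial>period\<bar> \<le> (\<integral>t. B * \<bar>b t\<bar> \<partial>period)"
    using integral_abs_bound[of period "\<lambda>t. \<phi> (x - t) * b t"] by linarith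
  then show ?thesis by (simp add: convolution_def abs_mult field_simps)
qed

section \<open>Convergence in the mean of cosine series\<close>

lemma integrable_abs_powr_period:
  fixes \<rho> :: real
  assumes "0 < \<rho>"
  shows "integrable period (\<lambda>t. \<bar>t\<bar> powr (\<rho> - 1))"
proof -
  have p: "(\<lambda>t. \<bar>t\<bar> powr (\<rho> - 1)) integrable_on {0..pi}"
    using integrable_on_powr_from_0[of "\<rho> - 1" pi] assms
    by (subst integrable_cong[where g = "\<lambda>t. t powr (\<rho> - 1)"]) auto
  have n: "(\<lambda>t. \<bar>t\<bar> powr (\<rho> - 1)) integrable_on {-pi..0}"
    using Henstock_Kurzweil_Integration.integrable_reflect_real[where f = "\<lambda>t. \<bar>t\<bar> powr (\<rho> - 1)" and a = 0 and b = pi] p by simp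
  have "(\<lambda>t. \<bar>t\<bar> powr (\<rho> - 1)) integrable_on {-pi..pi}"
    using n p by (rule Henstock_Kurzweil_Integration.integrable_combine[rotated 2]) auto
  then show ?thesis
    by (intro absolutely_integrable_imp_integrable nonnegative_absolutely_integrable_1) auto
qed

lemma cosine_series_measurable [measurable]: "cosine_series a \<theta> \<in> borel_measurable borel"
  unfolding cosine_series_def[abs_def] by measurable

lemma AE_period_nonzero: "AE t in period. t \<noteq> 0 \<and> \<bar>t\<bar> \<le> pi"
proof -
  have "AE t in lebesgue. t \<noteq> (0::real)" using AE_completion[OF AE_lborel_singleton[of 0]] .
  then show ?thesis by (subst AE_restrict_space_iff) (auto elim!: eventually_mono)
qed

context
  fixes a :: "nat \<Rightarrow> real" and aj :: "nat \<Rightarrow> nat \<Rightarrow> real" and C \<rho> \<theta> :: real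
  assumes aj: "\<And>j. dominated_decreasing C \<rho> (aj j)" and lim: "\<And>k. (\<lambda>j. aj j (Suc k)) \<longlonglongrightarrow> a (Suc k)"
    and \<rho>: "0 < \<rho>" "\<rho> < 1"
begin

lemma dominated_decreasing_limit: "dominated_decreasing C \<rho> a"
  unfolding dominated_decreasing_def
proof (intro allI conjI)
  fix k
  show "a (Suc (Suc k)) \<le> a (Suc k)"
    using aj by (intro LIMSEQ_le[OF lim lim]) (auto simp: dominated_decreasing_def)
  show "0 \<le> a (Suc k)"
    using aj by (intro LIMSEQ_le_const[OF lim]) (auto simp: dominated_decreasing_def)
  show "a (Suc k) \<le> C * real (Suc k) powr - \<rho>"
    using aj by (intro LIMSEQ_le_const2[OF lim]) (auto simp: dominated_decreasing_def)
qed

text \<open>The common bound makes the remainder after \<open>m\<close> terms small uniformly in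
  \<open>j\<close>; what is left is a finite sum, which converges termwise.\<close>

lemma cosine_series_pointwise_limit:
  assumes t: "t \<noteq> 0" "\<bar>t\<bar> \<le> pi"
  shows "(\<lambda>j. cosine_series (aj j) \<theta> t) \<longlonglongrightarrow> cosine_series a \<theta> t"
proof (rule LIMSEQ_I)
  fix e :: real assume e: "0 < e"
  define \<tau> where "\<tau> m = C * real (Suc m) powr - \<rho> * (4 / \<bar>t\<bar>)" for m
  have "(\<lambda>m. real (Suc m) powr - \<rho>) \<longlonglongrightarrow> 0"
    using \<rho> by (intro tendsto_neg_powr filterlim_compose[OF filterlim_real_sequentially] filterlim_Suc) auto
  then have "\<tau> \<longlonglongrightarrow> 0"
    unfolding \<tau>_def[abs_def] by (intro tendsto_mult_left_zero tendsto_mult_right_zero)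
  then have "eventually (\<lambda>m. \<tau> m < e / 4) sequentially"
    using e by (intro order_tendstoD) auto
  then obtain m where m: "\<tau> m < e / 4" by (auto simp: eventually_sequentially)
  define s where "s c = (\<Sum>k<m. c (Suc k) * cos (real (Suc k) * t - \<theta>))" for c :: "nat \<Rightarrow> real"
  have rem: "\<bar>cosine_series c \<theta> t - s c\<bar> \<le> \<tau> m" if c: "dominated_decreasing C \<rho> c" for c
  proof -
    have "c (Suc m) * (4 / \<bar>t\<bar>) \<le> \<tau> m"
      unfolding \<tau>_def using c by (intro mult_right_mono) (auto simp: dominated_decreasing_def)
    then show ?thesis using cosine_series_remainder[OF c t \<rho>, of \<theta> m] by (simp add: s_def)
  qed
  have "(\<lambda>j. s (aj j)) \<longlonglongrightarrow> s a"
    unfolding s_def by (intro tendsto_intros lim)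
  then obtain J where J: "\<And>j. j \<ge> J \<Longrightarrow> \<bar>s (aj j) - s a\<bar> < e / 4"
    using LIMSEQ_D[of "\<lambda>j. s (aj j)" "s a" "e/4"] e by auto
  have "norm (cosine_series (aj j) \<theta> t - cosine_series a \<theta> t) < e" if "j \<ge> J" for j
    using rem[OF aj[of j]] rem[OF dominated_decreasing_limit] J[OF that] m unfolding real_norm_def by linarith
  then show "\<exists>J. \<forall>j\<ge>J. norm (cosine_series (aj j) \<theta> t - cosine_series a \<theta> t) < e" by blast
qed

text \<open>Dominated convergence under the majorant from \<open>cosine_series_bound\<close>,
  doubled since both functions obey it. Every passage to the limit in the kernels, for partial sums
  as for truncations, is an instance.\<close>

lemma cosine_series_L1_limit:
  "(\<lambda>j. \<integral>t. \<bar>cosine_series (aj j) \<theta> t - cosine_series a \<theta> t\<bar> \<partial>period) \<longlonglongrightarrow> 0"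
proof -
  define W where "W t = C * (1 / (1 - \<rho>) + 4) * \<bar>t\<bar> powr (\<rho> - 1)" for t
  have "(\<lambda>j. \<integral>t. \<bar>cosine_series (aj j) \<theta> t - cosine_series a \<theta> t\<bar> \<partial>period) \<longlonglongrightarrow> (\<integral>t. 0 \<partial>period)"
  proof (rule integral_dominated_convergence[where w = "\<lambda>t. 2 * W t"])
    show "integrable period (\<lambda>t. 2 * W t)"
      unfolding W_def using integrable_abs_powr_period[OF \<rho>(1)] by simp
    show "(\<lambda>t. \<bar>cosine_series (aj j) \<theta> t - cosine_series a \<theta> t\<bar>) \<in> borel_measurable period" for j
      by (rule borel_measurable_period) measurable
    show "AE t in period. (\<lambda>j. \<bar>cosine_series (aj j) \<theta> t - cosine_series a \<theta> t\<bar>) \<longlonglongrightarrow> 0"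
      using AE_period_nonzero
    proof eventually_elim
      case (elim t)
      then have "(\<lambda>j. \<bar>cosine_series (aj j) \<theta> t - cosine_series a \<theta> t\<bar>) \<longlonglongrightarrow> \<bar>cosine_series a \<theta> t - cosine_series a \<theta> t\<bar>"
        by (intro tendsto_intros cosine_series_pointwise_limit) auto
      then show ?case by simp
    qed
    show "AE t in period. norm \<bar>cosine_series (aj j) \<theta> t - cosine_series a \<theta> t\<bar> \<le> 2 * W t" for j
      using AE_period_nonzero
    proof eventually_elim
      case (elim t)
      then show ?case
        using cosine_series_bound[OF aj[of j], of t \<theta>] cosine_series_bound[OF dominated_decreasing_limit, of t \<theta>] \<rho>
        unfolding W_def by simp
    qed
  qed simp
  then show ?thesis by simp
qed

end

lemma integrable_cosine_series:
  assumes a: "dominated_decreasing C \<rho> a" and \<rho>: "0 < \<rho>" "\<rho> < 1"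
  shows "integrable period (cosine_series a \<theta>)"
proof (rule Bochner_Integration.integrable_bound)
  show "integrable period (\<lambda>t. C * (1 / (1 - \<rho>) + 4) * \<bar>t\<bar> powr (\<rho> - 1))"
    using integrable_abs_powr_period[OF \<rho>(1)] by simp
  show "cosine_series a \<theta> \<in> borel_measurable period"
    by (rule borel_measurable_period) measurable
  show "AE t in period. norm (cosine_series a \<theta> t) \<le> norm (C * (1 / (1 - \<rho>) + 4) * \<bar>t\<bar> powr (\<rho> - 1))"
    using AE_period_nonzero
  proof eventually_elim
    case (elim t)
    then show ?case
      using cosine_series_bound[OF a, of t \<theta>] \<rho> unfolding real_norm_def by linarith
  qed
qed

definition truncated :: "nat \<Rightarrow> (nat \<Rightarrow> real) \<Rightarrow> nat \<Rightarrow> real" where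
  "truncated N a k = (if k \<le> N then a k else 0)"

lemma cosine_series_finite:
  assumes "\<And>k. N < k \<Longrightarrow> a k = 0"
  shows "cosine_series a \<theta> t = (\<Sum>k<N. a (Suc k) * cos (real (Suc k) * t - \<theta>))"
  unfolding cosine_series_def using assms by (intro suminf_finite) auto

lemma cosine_series_truncated:
  "cosine_series (truncated N a) \<theta> t = (\<Sum>k<N. a (Suc k) * cos (real (Suc k) * t - \<theta>))"
  by (subst cosine_series_finite[of N]) (auto simp: truncated_def)

text \<open>A cutoff replaces values by 0, which lies below the nonnegative values before it, so
  monotonicity and the bound survive with the same constants. Convexity in general does not.\<close>

lemma dominated_decreasing_truncated:
  assumes "dominated_decreasing C \<rho> a"
  shows "dominated_decreasing C \<rho> (truncated N a)"
  unfolding dominated_decreasing_def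
proof
  fix k
  have "a (Suc (Suc k)) \<le> a (Suc k)" "0 \<le> a (Suc k)" "a (Suc k) \<le> C * real (Suc k) powr - \<rho>"
    using assms by (simp_all add: dominated_decreasing_def)
  then show "truncated N a (Suc (Suc k)) \<le> truncated N a (Suc k) \<and> 0 \<le> truncated N a (Suc k)
      \<and> truncated N a (Suc k) \<le> C * real (Suc k) powr - \<rho>"
    unfolding truncated_def by (auto simp del: of_nat_Suc)
qed

lemma truncated_tendsto: "(\<lambda>N. truncated N a k) \<longlonglongrightarrow> a k"
  by (rule tendsto_eventually, rule eventually_mono[OF eventually_ge_at_top[of k]]) (simp add: truncated_def)

lemma cosine_series_partial_L1_limit:
  assumes "dominated_decreasing C \<rho> a" "0 < \<rho>" "\<rho> < 1"
  shows "(\<lambda>N. \<integral>t. \<bar>cosine_series (truncated N a) \<theta> t - cosine_series a \<theta> t\<bar> \<partial>period) \<longlonglongrightarrow> 0"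
  using dominated_decreasing_truncated[OF assms(1)] truncated_tendsto assms(2,3)
  by (rule cosine_series_L1_limit[where aj = "\<lambda>N. truncated N a"])

section \<open>Real Fourier coefficients and convolution with trigonometric sums\<close>

definition cos_coef :: "(real \<Rightarrow> real) \<Rightarrow> nat \<Rightarrow> real" where
  "cos_coef f k = (\<integral>t. f t * cos (real k * t) \<partial>period)"

definition sin_coef :: "(real \<Rightarrow> real) \<Rightarrow> nat \<Rightarrow> real" where
  "sin_coef f k = (\<integral>t. f t * sin (real k * t) \<partial>period)"

lemma integrable_mult_bounded:
  fixes f b :: "real \<Rightarrow> real"
  assumes "integrable period f" "b \<in> borel_measurable period" "\<And>t. \<bar>b t\<bar> \<le> B"
  shows "integrable period (\<lambda>t. f t * b t)"
proof (rule Bochner_Integration.integrable_bound)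
  show "integrable period (\<lambda>t. \<bar>B\<bar> * f t)" using assms(1) by simp
  show "(\<lambda>t. f t * b t) \<in> borel_measurable period"
    using assms by (intro borel_measurable_times) auto
  show "AE t in period. norm (f t * b t) \<le> norm (\<bar>B\<bar> * f t)"
  proof (rule AE_I2)
    fix t
    have "\<bar>b t\<bar> \<le> \<bar>B\<bar>" using assms(3)[of t] by linarith
    then have "\<bar>b t\<bar> * \<bar>f t\<bar> \<le> \<bar>B\<bar> * \<bar>f t\<bar>" by (rule mult_right_mono) simp
    then show "norm (f t * b t) \<le> norm (\<bar>B\<bar> * f t)" by (simp add: abs_mult mult.commute)
  qed
qed

lemma integrable_cos_sin:
  assumes "integrable period f"
  shows "integrable period (\<lambda>t. f t * cos (c * t - d))" "integrable period (\<lambda>t. f t * sin (c * t - d))"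
    "integrable period (\<lambda>t. f t * cos (c * t))" "integrable period (\<lambda>t. f t * sin (c * t))"
  by (rule integrable_mult_bounded[where B = 1, OF assms]; (rule borel_measurable_period, measurable)?; simp)+

lemma fourier_coeff_cos_sin:
  assumes "integrable period f"
  shows "Re (fourier_coeff f (int k)) = cos_coef f k / (2 * pi)"
    and "Im (fourier_coeff f (int k)) = - sin_coef f k / (2 * pi)"
proof -
  let ?F = "\<lambda>t. complex_of_real (f t) * exp (- \<i> * of_int (int k) * of_real t)"
  have eq: "?F t = complex_of_real (f t * cos (real k * t)) - \<i> * complex_of_real (f t * sin (real k * t))" for t
    by (rule complex_eqI) (simp_all add: Re_exp Im_exp)
  have "(\<integral>t. ?F t \<partial>period) = (\<integral>t. complex_of_real (f t * cos (real k * t)) \<partial>period) - (\<integral>t. \<i> * complex_of_real (f t * sin (real k * t)) \<partial>period)"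
    unfolding eq by (rule Bochner_Integration.integral_diff)
      (intro integrable_mult_right integrable_of_real integrable_cos_sin assms)+
  also have "\<dots> = complex_of_real (cos_coef f k) - \<i> * complex_of_real (sin_coef f k)"
    unfolding cos_coef_def sin_coef_def integral_mult_right_zero integral_complex_of_real ..
  finally have "fourier_coeff f (int k) = 1 / (2 * pi) * (complex_of_real (cos_coef f k) - \<i> * complex_of_real (sin_coef f k))"
    unfolding fourier_coeff_def by simp
  then show "Re (fourier_coeff f (int k)) = cos_coef f k / (2 * pi)"
    "Im (fourier_coeff f (int k)) = - sin_coef f k / (2 * pi)"
    by (simp_all add: Re_divide_of_real Im_divide_of_real)
qed

lemma fourier_coeff_uminus:
  "fourier_coeff f (- k) = cnj (fourier_coeff f k)"
proof -
  have "cnj (complex_of_real (f t) * exp (- \<i> * of_int k * of_real t)) = complex_of_real (f t) * exp (- \<i> * of_int (- k) * of_real t)" for t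
    by (simp add: exp_cnj)
  note h = this
  have "cnj (\<integral>t. complex_of_real (f t) * exp (- \<i> * of_int k * of_real t) \<partial>period)
      = (\<integral>t. complex_of_real (f t) * exp (- \<i> * of_int (- k) * of_real t) \<partial>period)"
    unfolding h[symmetric] by (rule Bochner_Integration.integral_cnj[symmetric])
  then show ?thesis unfolding fourier_coeff_def by simp
qed

lemma periodic_L1_mult:
  assumes "periodic_L1 f" "b \<in> borel_measurable borel" "\<And>t. b (t + 2 * pi) = b t" "\<And>t. \<bar>b t\<bar> \<le> B"
  shows "periodic_L1 (\<lambda>t. f t * b t)"
  using assms(1,3) integrable_mult_bounded[of f b B] borel_measurable_period[OF assms(2)] assms(4)
  by (auto simp: periodic_L1_def intro: borel_measurable_times)

lemma cos_sin_periodic: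
  "cos (real k * (t + 2 * pi) - \<theta>) = cos (real k * t - \<theta>)"
  "sin (real k * (t + 2 * pi) - \<theta>) = sin (real k * t - \<theta>)"
proof -
  have "real k * (t + 2 * pi) - \<theta> = (real k * t - \<theta>) + of_nat k * (2 * pi)" by (simp add: algebra_simps)
  then show "cos (real k * (t + 2 * pi) - \<theta>) = cos (real k * t - \<theta>)"
    "sin (real k * (t + 2 * pi) - \<theta>) = sin (real k * t - \<theta>)"
    using cos.plus_of_nat[of "real k * t - \<theta>" k] sin.plus_of_nat[of "real k * t - \<theta>" k]
    by (simp_all only: of_real_eq_id id_apply)
qed

text \<open>The substitution u = x - t leaves \<open>\<phi>\<close> without shift. Only its
  coefficients of order \<open>k\<close> remain: if they vanish, convolution with the harmonic gives
  0.\<close>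

lemma convolution_cos:
  assumes \<phi>: "periodic_L1 \<phi>"
  shows "convolution \<phi> (\<lambda>t. cos (real k * t - \<theta>)) x
       = 1 / (2 * pi) * (cos (real k * x - \<theta>) * cos_coef \<phi> k + sin (real k * x - \<theta>) * sin_coef \<phi> k)"
proof -
  have i: "integrable period \<phi>" using \<phi> by (rule periodic_L1_integrable)
  define F where "F u = \<phi> u * cos (real k * (x - u) - \<theta>)" for u
  have *: "cos (real k * (x - u) - \<theta>) = cos (real k * u - (real k * x - \<theta>))" for u
    using cos_minus[of "real k * (x - u) - \<theta>"] by (simp add: algebra_simps)
  have F: "periodic_L1 F"
    unfolding F_def[abs_def] * by (rule periodic_L1_mult[OF \<phi>, where B = 1]) (measurable, simp_all add: cos_sin_periodic)
  have "(\<integral>t. \<phi> (x - t) * cos (real k * t - \<theta>) \<partial>period) = (\<integral>t. F (x - t) \<partial>period)"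
    by (simp add: F_def)
  also have "\<dots> = (\<integral>u. F u \<partial>period)" by (rule integral_period_translate(1)[OF F])
  also have "\<dots> = (\<integral>u. cos (real k * x - \<theta>) * (\<phi> u * cos (real k * u)) + sin (real k * x - \<theta>) * (\<phi> u * sin (real k * u)) \<partial>period)"
    unfolding F_def * cos_diff[of "real k * _" "real k * x - \<theta>"]
    by (simp only: distrib_left mult_ac)
  also have "\<dots> = cos (real k * x - \<theta>) * cos_coef \<phi> k + sin (real k * x - \<theta>) * sin_coef \<phi> k"
    unfolding cos_coef_def sin_coef_def using integrable_cos_sin[OF i] by simp
  finally show ?thesis by (simp add: convolution_def)
qed

lemma convolution_of_cos_sin:
  assumes i: "integrable period g"
  shows "(\<integral>t. cos (real k * (x - t) - \<theta>) * g t \<partial>period) = cos (real k * x - \<theta>) * cos_coef g k + sin (real k * x - \<theta>) * sin_coef g k"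
    and "(\<integral>t. sin (real k * (x - t) - \<theta>) * g t \<partial>period) = sin (real k * x - \<theta>) * cos_coef g k - cos (real k * x - \<theta>) * sin_coef g k"
proof -
  have *: "cos (real k * (x - u) - \<theta>) = cos ((real k * x - \<theta>) - real k * u)"
    "sin (real k * (x - u) - \<theta>) = sin ((real k * x - \<theta>) - real k * u)" for u
    by (simp_all add: algebra_simps)
  have "(\<integral>t. cos (real k * (x - t) - \<theta>) * g t \<partial>period)
     = (\<integral>u. cos (real k * x - \<theta>) * (g u * cos (real k * u)) + sin (real k * x - \<theta>) * (g u * sin (real k * u)) \<partial>period)"
    unfolding * cos_diff[of "real k * x - \<theta>"] by (simp only: distrib_left mult_ac)
  then show "(\<integral>t. cos (real k * (x - t) - \<theta>) * g t \<partial>period) = cos (real k * x - \<theta>) * cos_coef g k + sin (real k * x - \<theta>) * sin_coef g k"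
    unfolding cos_coef_def sin_coef_def using integrable_cos_sin[OF i] by simp
  have "(\<integral>t. sin (real k * (x - t) - \<theta>) * g t \<partial>period)
     = (\<integral>u. sin (real k * x - \<theta>) * (g u * cos (real k * u)) - cos (real k * x - \<theta>) * (g u * sin (real k * u)) \<partial>period)"
    unfolding * sin_diff[of "real k * x - \<theta>"] by (simp only: right_diff_distrib mult_ac)
  then show "(\<integral>t. sin (real k * (x - t) - \<theta>) * g t \<partial>period) = sin (real k * x - \<theta>) * cos_coef g k - cos (real k * x - \<theta>) * sin_coef g k"
    unfolding cos_coef_def sin_coef_def using integrable_cos_sin[OF i] by simp
qed

lemma convolution_trig_sum:
  assumes \<phi>: "periodic_L1 \<phi>"
  shows "convolution \<phi> (\<lambda>t. \<Sum>k<N. a k * cos (real (Suc k) * t - \<theta>)) x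
       = (\<Sum>k<N. a k * convolution \<phi> (\<lambda>t. cos (real (Suc k) * t - \<theta>)) x)"
proof -
  have i: "integrable period (\<lambda>t. \<phi> (x - t) * cos (real k * t - \<theta>))" for k
    by (rule convolution_bounded_integrable[OF \<phi>, where B = 1]; (rule borel_measurable_period, measurable)?; simp)
  have "(\<integral>t. \<phi> (x - t) * (\<Sum>k<N. a k * cos (real (Suc k) * t - \<theta>)) \<partial>period)
      = (\<integral>t. (\<Sum>k<N. a k * (\<phi> (x - t) * cos (real (Suc k) * t - \<theta>))) \<partial>period)"
    by (simp only: sum_distrib_left mult.left_commute)
  also have "\<dots> = (\<Sum>k<N. a k * (\<integral>t. \<phi> (x - t) * cos (real (Suc k) * t - \<theta>) \<partial>period))"
    by (subst Bochner_Integration.integral_sum) (simp_all only: integral_mult_right_zero integrable_mult_right[OF i])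
  finally show ?thesis
    unfolding convolution_def by (simp only: sum_distrib_left mult.left_commute)
qed

text \<open>Harmonics are eigenfunctions of convolution with \<open>g\<close>: its sine coefficients
  vanish, so frequency k is multiplied by \<open>H k\<close> without a change of phase. For finite
  sums the identity is exact at every \<open>x\<close>.\<close>

lemma convolution_trig_sum_conv:
  assumes \<phi>: "periodic_L1 \<phi>" and g: "integrable period g"
    and c: "\<And>k. cos_coef g (Suc k) = 2 * pi * H (Suc k)" and s: "\<And>k. sin_coef g (Suc k) = 0"
  shows "convolution \<phi> (\<lambda>t. \<Sum>k<N. a (Suc k) * cos (real (Suc k) * t - \<theta>)) x
       - convolution (convolution \<phi> (\<lambda>t. \<Sum>k<N. a (Suc k) * cos (real (Suc k) * t - \<theta>))) g x
       = convolution \<phi> (\<lambda>t. \<Sum>k<N. (a (Suc k) * (1 - H (Suc k))) * cos (real (Suc k) * t - \<theta>)) x"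
proof -
  have one: "convolution (convolution \<phi> (\<lambda>t. cos (real (Suc k) * t - \<theta>))) g x
     = H (Suc k) * convolution \<phi> (\<lambda>t. cos (real (Suc k) * t - \<theta>)) x" for k
  proof -
    let ?m = "Suc k"
    have i: "integrable period (\<lambda>t. cos (real ?m * (x - t) - \<theta>) * g t)" "integrable period (\<lambda>t. sin (real ?m * (x - t) - \<theta>) * g t)"
      using integrable_cos_sin(1,2)[OF g, of "- real ?m" "\<theta> - real ?m * x"] by (simp_all add: algebra_simps)
    have "(\<integral>t. convolution \<phi> (\<lambda>t. cos (real ?m * t - \<theta>)) (x - t) * g t \<partial>period)
       = (\<integral>t. 1 / (2 * pi) * (cos_coef \<phi> ?m * (cos (real ?m * (x - t) - \<theta>) * g t) + sin_coef \<phi> ?m * (sin (real ?m * (x - t) - \<theta>) * g t)) \<partial>period)"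
      unfolding convolution_cos[OF \<phi>] by (intro Bochner_Integration.integral_cong refl) (simp add: algebra_simps)
    also have "\<dots> = 1 / (2 * pi) * (cos_coef \<phi> ?m * (2 * pi * H ?m * cos (real ?m * x - \<theta>)) + sin_coef \<phi> ?m * (2 * pi * H ?m * sin (real ?m * x - \<theta>)))"
      unfolding integral_mult_right_zero
        Bochner_Integration.integral_add[OF integrable_mult_right[OF i(1)] integrable_mult_right[OF i(2)]]
        convolution_of_cos_sin[OF g] c s by (simp add: mult_ac del: of_nat_Suc)
    finally show ?thesis
      unfolding convolution_cos[OF \<phi>] unfolding convolution_def[of _ g] by (simp add: algebra_simps)
  qed
  define T where "T k = convolution \<phi> (\<lambda>t. cos (real (Suc k) * t - \<theta>))" for k
  have T: "periodic_L1 (T k)" for k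
    unfolding T_def using integrable_cos_sin(1)[OF integrable_period_bounded[of "\<lambda>_. 1" 1], of "real (Suc k)" \<theta>]
    by (intro periodic_L1_convolution[OF \<phi>]) simp
  have Ti: "integrable period (\<lambda>t. T k (x - t) * g t)" for k
  proof -
    have "(\<lambda>t. T k (x - t) * g t) = (\<lambda>t. 1 / (2 * pi) * (cos_coef \<phi> (Suc k) * (g t * cos (- real (Suc k) * t - (\<theta> - real (Suc k) * x))) + sin_coef \<phi> (Suc k) * (g t * sin (- real (Suc k) * t - (\<theta> - real (Suc k) * x)))))"
      unfolding T_def convolution_cos[OF \<phi>] by (intro ext) (simp add: algebra_simps)
    then show ?thesis using integrable_cos_sin(1,2)[OF g] by simp
  qed
  have "convolution (convolution \<phi> (\<lambda>t. \<Sum>k<N. a (Suc k) * cos (real (Suc k) * t - \<theta>))) g x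
      = convolution (\<lambda>x. \<Sum>k<N. a (Suc k) * T k x) g x"
    unfolding T_def using convolution_trig_sum[OF \<phi>, where N = N and a = "\<lambda>k. a (Suc k)" and \<theta> = \<theta>] by presburger
  also have "\<dots> = (\<Sum>k<N. a (Suc k) * convolution (T k) g x)"
  proof -
    have "(\<integral>t. (\<Sum>k<N. a (Suc k) * T k (x - t)) * g t \<partial>period) = (\<integral>t. (\<Sum>k<N. a (Suc k) * (T k (x - t) * g t)) \<partial>period)"
      by (simp only: sum_distrib_right mult.assoc)
    also have "\<dots> = (\<Sum>k<N. a (Suc k) * (\<integral>t. T k (x - t) * g t \<partial>period))"
      by (subst Bochner_Integration.integral_sum) (simp_all only: integral_mult_right_zero integrable_mult_right[OF Ti])
    finally show ?thesis
      unfolding convolution_def[of _ g] by (simp only: sum_distrib_left mult.left_commute)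
  qed
  also have "\<dots> = (\<Sum>k<N. a (Suc k) * (H (Suc k) * T k x))"
    unfolding T_def one ..
  finally show ?thesis
    unfolding convolution_trig_sum[OF \<phi>, where N = N and a = "\<lambda>k. a (Suc k)" and \<theta> = \<theta>]
      convolution_trig_sum[OF \<phi>, where N = N and a = "\<lambda>k. a (Suc k) * (1 - H (Suc k))" and \<theta> = \<theta>] T_def
    by (simp add: sum_subtractf[symmetric] algebra_simps)
qed

text \<open>The identity is exact for partial sums, and both sides are continuous in the mean by
  Young's inequality, so the integral of |F| for the difference \<open>F\<close> lies below a null
  sequence.\<close>

lemma deviation_eq_convolution:
  assumes \<phi>: "periodic_L1 \<phi>" and g: "integrable period g"
    and c: "\<And>k. cos_coef g (Suc k) = 2 * pi * H (Suc k)" and s: "\<And>k. sin_coef g (Suc k) = 0"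
    and u: "dominated_decreasing C \<rho> u" and v: "dominated_decreasing C' \<rho> v" and \<rho>: "0 < \<rho>" "\<rho> < 1"
    and v_eq: "\<And>k. v (Suc k) = u (Suc k) * (1 - H (Suc k))"
  shows "AE x in period. convolution \<phi> (cosine_series u \<theta>) x - convolution (convolution \<phi> (cosine_series u \<theta>)) g x
     = convolution \<phi> (cosine_series v \<theta>) x"
proof -
  let ?u = "cosine_series u \<theta>" and ?v = "cosine_series v \<theta>"
  let ?uN = "\<lambda>N. cosine_series (truncated N u) \<theta>" and ?vN = "\<lambda>N. cosine_series (truncated N v) \<theta>"
  let ?f = "convolution \<phi> ?u"
  let ?fN = "\<lambda>N. convolution \<phi> (?uN N)"
  have ui: "integrable period ?u" "integrable period (?uN N)" and vi: "integrable period ?v" "integrable period (?vN N)" for N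
    using u v \<rho> by (auto intro!: integrable_cosine_series dominated_decreasing_truncated)
  have f: "periodic_L1 ?f" "periodic_L1 (?fN N)" for N
    using ui by (auto intro: periodic_L1_convolution[OF \<phi>])
  have exact: "?fN N x - convolution (?fN N) g x = convolution \<phi> (?vN N) x" for N x
    unfolding cosine_series_truncated[abs_def] v_eq using \<phi> g c s by (rule convolution_trig_sum_conv)
  define F where "F x = ?f x - convolution ?f g x - convolution \<phi> ?v x" for x
  have Fi: "integrable period F"
    unfolding F_def[abs_def] using f(1) g ui(1) vi(1) \<phi>
    by (intro Bochner_Integration.integrable_diff integrable_convolution)
  define I where "I b = (\<integral>t. \<bar>b t\<bar> \<partial>period)" for b :: "real \<Rightarrow> real"
  \<comment> \<open>One summand for each replacement of a series by its partial sum: in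
    \<open>f\<close>, in the convolution of \<open>f\<close> with \<open>g\<close> (where the
    inequality is used twice) and on the right-hand side.\<close>
  define e where "e N = 1 / (2*pi) * I \<phi> * I (\<lambda>t. ?uN N t - ?u t)
      + 1 / (2*pi) * (1 / (2*pi) * I \<phi> * I (\<lambda>t. ?uN N t - ?u t)) * I g
      + 1 / (2*pi) * I \<phi> * I (\<lambda>t. ?vN N t - ?v t)" for N
  have "I F \<le> e N" for N
  proof -
    define A where "A = convolution \<phi> (\<lambda>t. ?uN N t - ?u t)"
    define B where "B = convolution (\<lambda>t. ?fN N t - ?f t) g"
    define D where "D = convolution \<phi> (\<lambda>t. ?vN N t - ?v t)"
    have ud: "integrable period (\<lambda>t. ?uN N t - ?u t)" and vd: "integrable period (\<lambda>t. ?vN N t - ?v t)"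
      using ui vi by auto
    have fd: "periodic_L1 (\<lambda>t. ?fN N t - ?f t)" using f by (intro periodic_L1_diff) auto
    have i: "integrable period A" "integrable period B" "integrable period D"
      unfolding A_def B_def D_def using \<phi> ud vd fd g by (auto intro: integrable_convolution)
    have AEq: "AE x in period. A x = ?fN N x - ?f x"
      unfolding A_def by (rule convolution_diff_right[OF \<phi> ui(2) ui(1)])
    have "AE x in period. \<bar>F x\<bar> \<le> \<bar>A x\<bar> + \<bar>B x\<bar> + \<bar>D x\<bar>"
      using AEq convolution_diff_left[OF f(2)[of N] f(1) g] convolution_diff_right[OF \<phi> vi(2)[of N] vi(1)]
    proof eventually_elim
      case (elim x)
      then show ?case using exact[of N x] unfolding F_def B_def D_def by linarith
    qed
    then have "I F \<le> (\<integral>x. \<bar>A x\<bar> + \<bar>B x\<bar> + \<bar>D x\<bar> \<partial>period)"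
      unfolding I_def using Fi i by (intro integral_mono_AE) auto
    also have "\<dots> = I A + I B + I D" unfolding I_def using i by simp
    finally have 1: "I F \<le> I A + I B + I D" .
    have A: "I A \<le> 1 / (2*pi) * I \<phi> * I (\<lambda>t. ?uN N t - ?u t)"
      unfolding I_def A_def by (rule convolution_norm_le[OF \<phi> ud])
    have D: "I D \<le> 1 / (2*pi) * I \<phi> * I (\<lambda>t. ?vN N t - ?v t)"
      unfolding I_def D_def by (rule convolution_norm_le[OF \<phi> vd])
    have "I (\<lambda>t. ?fN N t - ?f t) = I A"
      unfolding I_def using AEq i(1) periodic_L1_integrable[OF fd] by (intro integral_cong_AE) (auto elim!: eventually_mono)
    then have "I B \<le> 1 / (2*pi) * I A * I g"
      unfolding B_def I_def using convolution_norm_le[OF fd g] by simp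
    also have "\<dots> \<le> 1 / (2*pi) * (1 / (2*pi) * I \<phi> * I (\<lambda>t. ?uN N t - ?u t)) * I g"
      using A by (intro mult_right_mono mult_left_mono) (auto simp: I_def)
    finally show ?thesis using 1 A D unfolding e_def by linarith
  qed
  moreover have "e \<longlonglongrightarrow> 1 / (2*pi) * I \<phi> * 0 + 1 / (2*pi) * (1 / (2*pi) * I \<phi> * 0) * I g + 1 / (2*pi) * I \<phi> * 0"
    unfolding e_def[abs_def] unfolding I_def
    by (intro tendsto_intros cosine_series_partial_L1_limit[OF u \<rho>] cosine_series_partial_L1_limit[OF v \<rho>])
  then have "e \<longlonglongrightarrow> 0" by simp
  ultimately have "I F \<le> 0" by (intro LIMSEQ_le_const[where X = e]) auto
  moreover have "0 \<le> I F" by (simp add: I_def)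
  ultimately have "(\<integral>x. \<bar>F x\<bar> \<partial>period) = 0" unfolding I_def by linarith
  then have "AE x in period. \<bar>F x\<bar> = 0"
    using Fi by (subst (asm) integral_nonneg_eq_0_iff_AE) auto
  then show ?thesis by eventually_elim (simp add: F_def)
qed

section \<open>Square waves\<close>

text \<open>The shift by pi / n rotates the pair of coefficients by the angle k pi / n, and
  antiperiodicity makes it change sign. A rotation turns a nonzero plane vector into its negative
  only if the cosine of its angle is -1.\<close>

lemma antiperiodic_coef_zero:
  assumes \<phi>: "periodic_L1 \<phi>" and n: "n \<ge> 1" and anti: "\<And>t. \<phi> (t + pi / real n) = - \<phi> t"
    and k: "cos (real k * pi / real n) \<noteq> -1"
  shows "cos_coef \<phi> k = 0" "sin_coef \<phi> k = 0"
proof -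
  define x where "x = real k * pi / real n"
  have i: "integrable period \<phi>" by (rule periodic_L1_integrable[OF \<phi>])
  have P: "periodic_L1 (\<lambda>t. \<phi> t * cos (real k * t))" "periodic_L1 (\<lambda>t. \<phi> t * sin (real k * t))"
    using cos_sin_periodic[of k _ 0]
    by (auto intro!: periodic_L1_mult[OF \<phi>, where B = 1])
  have a: "real k * (pi / real n + t) = x + real k * t" for t by (simp add: x_def algebra_simps)
  have anti': "\<phi> (pi / real n + t) = - \<phi> t" for t using anti[of t] by (simp add: add.commute)
  have "cos_coef \<phi> k = (\<integral>t. \<phi> (pi / real n + t) * cos (real k * (pi / real n + t)) \<partial>period)"
    unfolding cos_coef_def using integral_period_translate(2)[OF P(1), of "pi / real n"] by simp
  also have "\<dots> = (\<integral>t. sin x * (\<phi> t * sin (real k * t)) - cos x * (\<phi> t * cos (real k * t)) \<partial>period)"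
    unfolding anti' a cos_add by (simp add: algebra_simps)
  also have "\<dots> = sin x * sin_coef \<phi> k - cos x * cos_coef \<phi> k"
    unfolding cos_coef_def sin_coef_def using integrable_cos_sin[OF i] by simp
  finally have 1: "cos_coef \<phi> k = sin x * sin_coef \<phi> k - cos x * cos_coef \<phi> k" .
  have "sin_coef \<phi> k = (\<integral>t. \<phi> (pi / real n + t) * sin (real k * (pi / real n + t)) \<partial>period)"
    unfolding sin_coef_def using integral_period_translate(2)[OF P(2), of "pi / real n"] by simp
  also have "\<dots> = (\<integral>t. - sin x * (\<phi> t * cos (real k * t)) - cos x * (\<phi> t * sin (real k * t)) \<partial>period)"
    unfolding anti' a sin_add by (intro Bochner_Integration.integral_cong refl) (simp add: algebra_simps)
  also have "\<dots> = - sin x * cos_coef \<phi> k - cos x * sin_coef \<phi> k"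
    unfolding cos_coef_def sin_coef_def using integrable_cos_sin[OF i] by simp
  finally have 2: "sin_coef \<phi> k = - sin x * cos_coef \<phi> k - cos x * sin_coef \<phi> k" .
  define A B where "A = cos_coef \<phi> k" and "B = sin_coef \<phi> k"
  have "(1 + cos x) * A = sin x * B" "(1 + cos x) * B = - sin x * A"
    using 1 2 unfolding A_def B_def by (simp_all add: algebra_simps)
  \<comment> \<open>The first equation times A plus the second times B: the terms with sin x
    cancel.\<close>
  then have "(1 + cos x) * (A * A + B * B) = 0" by (simp add: distrib_left mult.assoc[symmetric])
  moreover have "1 + cos x \<noteq> 0" using k unfolding x_def by linarith
  ultimately have "A * A + B * B = 0" by simp
  then show "cos_coef \<phi> k = 0" "sin_coef \<phi> k = 0"
    unfolding A_def B_def by (simp_all add: sum_squares_eq_zero_iff)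
qed

lemma antiperiodic_imp_periodic:
  fixes \<phi> :: "real \<Rightarrow> real"
  assumes n: "n \<ge> 1" and anti: "\<And>t. \<phi> (t + pi / real n) = - \<phi> t"
  shows "\<phi> (t + 2 * pi) = \<phi> t"
proof -
  have "\<phi> (t + real (2 * m) * (pi / real n)) = \<phi> t" for m
  proof (induction m)
    case (Suc m)
    have "t + real (2 * Suc m) * (pi / real n) = (t + real (2 * m) * (pi / real n)) + pi / real n + pi / real n"
      by (simp add: algebra_simps)
    then show ?case by (simp only: anti minus_minus Suc)
  qed simp
  from this[of n] show ?thesis using n by simp
qed

lemma periodic_L1_bounded:
  fixes \<phi> :: "real \<Rightarrow> real"
  assumes "\<phi> \<in> borel_measurable borel" "\<And>t. \<phi> (t + 2 * pi) = \<phi> t" "\<And>t. \<bar>\<phi> t\<bar> \<le> B"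
  shows "periodic_L1 \<phi>"
  unfolding periodic_L1_def
proof (intro conjI allI)
  show "integrable period \<phi>"
    using borel_measurable_period(1)[OF assms(1)] assms(3) by (rule integrable_period_bounded)
qed (rule borel_measurable_period(2)[OF assms(1)], rule assms(2))

text \<open>\<open>sgn\<close> vanishes at the jumps, so the change of sign under the shift by pi /
  n holds at every point and not only almost everywhere.\<close>

definition square_wave :: "nat \<Rightarrow> real \<Rightarrow> real \<Rightarrow> real" where
  "square_wave n \<theta> t = sgn (cos (real n * t - \<theta>))"

lemma square_wave_measurable [measurable]: "square_wave n \<theta> \<in> borel_measurable borel"
  unfolding square_wave_def[abs_def] by measurable

lemma square_wave_bounded: "\<bar>square_wave n \<theta> t\<bar> \<le> 1"
  by (simp add: square_wave_def sgn_if)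

lemma square_wave_antiperiodic:
  assumes "n \<ge> 1"
  shows "square_wave n \<theta> (t + pi / real n) = - square_wave n \<theta> t"
proof -
  have "real n * (t + pi / real n) - \<theta> = (real n * t - \<theta>) + pi" using assms by (simp add: field_simps)
  then show ?thesis unfolding square_wave_def by (simp only: cos_periodic_pi sgn_minus)
qed

lemma periodic_L1_square_wave: "n \<ge> 1 \<Longrightarrow> periodic_L1 (square_wave n \<theta>)"
  by (intro periodic_L1_bounded[where B = 1] square_wave_measurable square_wave_bounded
      antiperiodic_imp_periodic[where \<phi> = "square_wave n \<theta>" and n = n] square_wave_antiperiodic)

lemma AE_square_wave_nonzero: "n \<ge> 1 \<Longrightarrow> AE t in lebesgue. cos (real n * t - \<theta>) \<noteq> 0"
proof -
  assume n: "n \<ge> 1"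
  have "{t. cos (real n * t - \<theta>) = 0} \<subseteq> range (\<lambda>i::int. (of_int i * (pi / 2) + \<theta>) / real n)"
    using n by (auto simp: cos_zero_iff_int field_simps image_iff)
  then have "countable {t. cos (real n * t - \<theta>) = 0}" by (rule countable_subset) auto
  then have "{t. cos (real n * t - \<theta>) = 0} \<in> null_sets lborel" by (rule countable_imp_null_set_lborel)
  then have "AE t in lborel. t \<notin> {t. cos (real n * t - \<theta>) = 0}" by (rule AE_not_in)
  then show ?thesis using AE_completion by fastforce
qed

text \<open>Identifies the only frequencies at which a function antiperiodic under pi / n can have
  nonzero coefficients: the odd multiples of \<open>n\<close>.\<close>

lemma cos_mult_pi_div_eq_minus_one:
  assumes n: "n \<ge> 1" and c: "cos (real k * pi / real n) = -1"
  obtains j where "k = (2 * j + 1) * n"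
proof -
  obtain i :: int where i: "real k * pi / real n = (2 * of_int i + 1) * pi"
    using c by (auto simp: cos_eq_minus1 algebra_simps)
  then have "pi * real k = pi * ((2 * of_int i + 1) * real n)" using n by (simp add: field_simps)
  then have "real k = (2 * of_int i + 1) * real n" by simp
  then have "of_int (int k) = (of_int ((2 * i + 1) * int n) :: real)" by simp
  then have k: "int k = (2 * i + 1) * int n" by (simp only: of_int_eq_iff)
  have "0 \<le> i"
  proof (rule ccontr)
    assume "\<not> 0 \<le> i"
    then have "(2 * i + 1) * int n < 0" using n by (intro mult_neg_pos) auto
    then show False using k by simp
  qed
  then have "int k = int ((2 * nat i + 1) * n)" using k by (simp add: algebra_simps)
  then have "k = (2 * nat i + 1) * n" by (simp only: of_nat_eq_iff)
  then show ?thesis by (rule that)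
qed

section \<open>Integrals of harmonics and of cosine series against the square wave\<close>

lemma integral_cos_square_wave:
  assumes n: "n \<ge> 1"
  shows "(\<integral>t. cos (real k * t - \<theta>) * square_wave n \<theta> t \<partial>period)
     = cos \<theta> * cos_coef (square_wave n \<theta>) k + sin \<theta> * sin_coef (square_wave n \<theta>) k"
proof -
  have i: "integrable period (square_wave n \<theta>)" by (rule periodic_L1_integrable[OF periodic_L1_square_wave[OF n]])
  have "(\<integral>t. cos (real k * t - \<theta>) * square_wave n \<theta> t \<partial>period)
     = (\<integral>t. cos \<theta> * (square_wave n \<theta> t * cos (real k * t)) + sin \<theta> * (square_wave n \<theta> t * sin (real k * t)) \<partial>period)"
    unfolding cos_diff by (simp add: algebra_simps)
  also have "\<dots> = cos \<theta> * cos_coef (square_wave n \<theta>) k + sin \<theta> * sin_coef (square_wave n \<theta>) k"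
    unfolding cos_coef_def sin_coef_def using integrable_cos_sin[OF i] by simp
  finally show ?thesis .
qed

lemma integral_cos_square_wave_zero:
  assumes n: "n \<ge> 1" and k: "\<And>j. k \<noteq> (2 * j + 1) * n"
  shows "(\<integral>t. cos (real k * t - \<theta>) * square_wave n \<theta> t \<partial>period) = 0"
proof -
  have "cos (real k * pi / real n) \<noteq> -1" using cos_mult_pi_div_eq_minus_one[OF n] k by metis
  then show ?thesis
    using antiperiodic_coef_zero[OF periodic_L1_square_wave[OF n] n square_wave_antiperiodic[OF n]]
    by (simp add: integral_cos_square_wave[OF n])
qed

text \<open>Both factors change sign under the shift by pi / n, so their product has that period,
  and 2 n copies of one elementary integral remain. The factor
  \<open>(-1) ^ j * cos (2 * real j * \<theta>)\<close> unites the parities: with 2 \<theta> =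
  \<beta> pi it is 1 for \<beta> odd and \<open>(-1) ^ j\<close> for \<beta> even.\<close>

lemma integral_cos_square_wave_odd:
  fixes j :: nat
  assumes n: "n \<ge> 1" and \<theta>: "sin (2 * \<theta>) = 0"
  defines "k \<equiv> (2 * j + 1) * n"
  shows "(\<integral>t. cos (real k * t - \<theta>) * square_wave n \<theta> t \<partial>period) = 4 / real (2 * j + 1) * ((-1) ^ j * cos (2 * real j * \<theta>))"
proof -
  define q where "q t = cos (real k * t - \<theta>) * square_wave n \<theta> t" for t
  \<comment> \<open>A zero of cos (n t - \<theta>) at which the cosine becomes positive; inside the
    half wave that starts there the square wave is 1.\<close>
  define a where "a = (\<theta> - pi / 2) / real n"
  have n0: "real n > 0" and k0: "real k > 0"
    using n by (auto simp: k_def intro: add_pos_nonneg)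
  have kn: "real k = (2 * real j + 1) * real n" by (simp add: k_def algebra_simps)
  have qm: "q \<in> borel_measurable borel" unfolding q_def[abs_def] by measurable
  have qB: "\<bar>q t\<bar> \<le> 1" for t
    using mult_mono[OF abs_cos_le_one[of "real k * t - \<theta>"] square_wave_bounded[of n \<theta> t]]
    by (simp add: q_def abs_mult)
  have qP: "q (t + pi / real n) = q t" for t
  proof -
    have "real k * (t + pi / real n) - \<theta> = (real k * t - \<theta>) + pi + of_nat j * (2 * pi)"
      using n0 by (simp add: kn field_simps)
    then have "cos (real k * (t + pi / real n) - \<theta>) = - cos (real k * t - \<theta>)"
      using cos.plus_of_nat[of "(real k * t - \<theta>) + pi" j] by (simp only: of_real_eq_id id_apply cos_periodic_pi)
    then show ?thesis using square_wave_antiperiodic[OF n] by (simp add: q_def)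
  qed
  have 1: "(\<integral>t. q t \<partial>period) = real (2 * n) * (\<integral>t. q t \<partial>lebesgue_on {a..a + pi / real n})"
    by (rule integral_small_period[OF borel_measurable_period(2)[OF qm] qB qP]) (use n0 in auto)
  have "(\<integral>t. q t \<partial>lebesgue_on {a..a + pi / real n}) = (\<integral>t. cos (real k * t - \<theta>) \<partial>lebesgue_on {a..a + pi / real n})"
  proof (rule integral_cong_AE)
    show "q \<in> borel_measurable (lebesgue_on {a..a + pi / real n})"
      "(\<lambda>t. cos (real k * t - \<theta>)) \<in> borel_measurable (lebesgue_on {a..a + pi / real n})"
      by (intro measurable_restrict_space1 borel_measurable_period(2) qm; measurable)+
    have "AE t in lebesgue. t \<noteq> a" "AE t in lebesgue. t \<noteq> a + pi / real n"
      using AE_completion[OF AE_lborel_singleton[of a]] AE_completion[OF AE_lborel_singleton[of "a + pi / real n"]] .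
    then have "AE t in lebesgue. t \<in> {a..a + pi / real n} \<longrightarrow> q t = cos (real k * t - \<theta>)"
    proof eventually_elim
      case (elim t)
      show ?case
      proof
        assume "t \<in> {a..a + pi / real n}"
        then have "a < t" "t < a + pi / real n" using elim by auto
        then have "- (pi / 2) < real n * t - \<theta>" "real n * t - \<theta> < pi / 2"
          using n0 by (auto simp: a_def field_simps)
        then have "0 < cos (real n * t - \<theta>)" by (intro cos_gt_zero_pi) auto
        then show "q t = cos (real k * t - \<theta>)" by (simp add: q_def square_wave_def)
      qed
    qed
    then show "AE t in lebesgue_on {a..a + pi / real n}. q t = cos (real k * t - \<theta>)"
      by (subst AE_restrict_space_iff) auto
  qed
  also have "\<dots> = integral {a..a + pi / real n} (\<lambda>t. cos (real k * t - \<theta>))"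
  proof (rule lebesgue_integral_eq_integral)
    show "integrable (lebesgue_on {a..a + pi / real n}) (\<lambda>t. cos (real k * t - \<theta>))"
      by (rule continuous_imp_integrable_real) (intro continuous_intros)
  qed auto
  also have "\<dots> = sin (real k * (a + pi / real n) - \<theta>) / real k - sin (real k * a - \<theta>) / real k"
    using n0 k0 by (intro integral_unique fundamental_theorem_of_calculus)
      (auto intro!: derivative_eq_intros simp: has_real_derivative_iff_has_vector_derivative[symmetric])
  also have "sin (real k * (a + pi / real n) - \<theta>) = (-1) ^ j * cos (2 * real j * \<theta>)"
  proof -
    have "real k * (a + pi / real n) - \<theta> = (2 * real j * \<theta> + real j * pi) + pi / 2"
      using n0 by (simp add: kn a_def field_simps)
    also have "sin \<dots> = cos (2 * real j * \<theta> + real j * pi)" by (simp add: sin_add)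
    finally show ?thesis by (simp add: cos_add cos_npi sin_npi mult.commute)
  qed
  also have "sin (real k * a - \<theta>) = - ((-1) ^ j * cos (2 * real j * \<theta>))"
  proof -
    have "real k * a - \<theta> = (2 * real j * \<theta> - real j * pi) - pi / 2"
      using n0 by (simp add: kn a_def field_simps)
    also have "sin \<dots> = - cos (2 * real j * \<theta> - real j * pi)" by (simp add: sin_diff)
    finally show ?thesis by (simp add: cos_diff cos_npi sin_npi mult.commute)
  qed
  finally have 2: "(\<integral>t. q t \<partial>lebesgue_on {a..a + pi / real n}) = 2 * ((-1) ^ j * cos (2 * real j * \<theta>)) / real k"
    by simp
  have "real (2 * n) * (2 * W / real k) = 4 / real (2 * j + 1) * W" for W
  proof -
    have "real (2 * n) * (2 * W / real k) = (4 * W) * real n / ((2 * real j + 1) * real n)" by (simp add: kn)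
    also have "\<dots> = 4 * W / (2 * real j + 1)" using n0 by (intro nonzero_mult_divide_mult_cancel_right) simp
    finally show ?thesis by (simp add: add.commute)
  qed
  then show ?thesis unfolding q_def[symmetric] 1 2 .
qed

text \<open>Termwise integration is justified by convergence of the partial sums in the mean, since
  the square wave is bounded. Frequencies that are not odd multiples of \<open>n\<close> contribute
  0 and are dropped.\<close>

lemma integral_cosine_series_square_wave:
  assumes n: "n \<ge> 1" and \<theta>: "sin (2 * \<theta>) = 0" and a: "dominated_decreasing C \<rho> a" and \<rho>: "0 < \<rho>" "\<rho> < 1"
  shows "(\<lambda>j. a ((2 * j + 1) * n) * (4 / real (2 * j + 1) * ((-1) ^ j * cos (2 * real j * \<theta>))))
     sums (\<integral>t. cosine_series a \<theta> t * square_wave n \<theta> t \<partial>period)"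
proof -
  let ?s = "square_wave n \<theta>"
  have sm: "?s \<in> borel_measurable period" by (rule borel_measurable_period) measurable
  define I where "I k = (\<integral>t. cos (real k * t - \<theta>) * ?s t \<partial>period)" for k
  have ic: "integrable period (\<lambda>t. cos (real k * t - \<theta>) * ?s t)" for k
  proof -
    have "integrable period (\<lambda>t. cos (real k * t - \<theta>))"
      by (rule integrable_period_bounded[where B = 1]; (rule borel_measurable_period, measurable)?; simp)
    then show ?thesis using sm square_wave_bounded by (rule integrable_mult_bounded)
  qed
  have ai: "integrable period (cosine_series a \<theta>)" "integrable period (cosine_series (truncated N a) \<theta>)" for N
    using a \<rho> by (auto intro!: integrable_cosine_series dominated_decreasing_truncated)
  have ais: "integrable period (\<lambda>t. cosine_series a \<theta> t * ?s t)" "integrable period (\<lambda>t. cosine_series (truncated N a) \<theta> t * ?s t)" for N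
    by (rule integrable_mult_bounded[OF ai(1) sm square_wave_bounded] integrable_mult_bounded[OF ai(2) sm square_wave_bounded])+
  have part: "(\<integral>t. cosine_series (truncated N a) \<theta> t * ?s t \<partial>period) = (\<Sum>k<N. a (Suc k) * I (Suc k))" for N
  proof -
    have "(\<integral>t. cosine_series (truncated N a) \<theta> t * ?s t \<partial>period) = (\<integral>t. (\<Sum>k<N. a (Suc k) * (cos (real (Suc k) * t - \<theta>) * ?s t)) \<partial>period)"
      by (simp only: cosine_series_truncated sum_distrib_right mult.assoc)
    also have "\<dots> = (\<Sum>k<N. a (Suc k) * I (Suc k))"
      unfolding I_def by (subst Bochner_Integration.integral_sum) (simp_all only: integral_mult_right_zero integrable_mult_right[OF ic])
    finally show ?thesis .
  qed
  have "(\<lambda>N. (\<integral>t. cosine_series (truncated N a) \<theta> t * ?s t \<partial>period) - (\<integral>t. cosine_series a \<theta> t * ?s t \<partial>period)) \<longlonglongrightarrow> 0"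
  proof (rule Lim_null_comparison[OF always_eventually cosine_series_partial_L1_limit[OF a \<rho>, of \<theta>]], rule allI)
    fix N
    have d: "integrable period (\<lambda>t. cosine_series (truncated N a) \<theta> t - cosine_series a \<theta> t)" using ai by auto
    have "(\<integral>t. cosine_series (truncated N a) \<theta> t * ?s t \<partial>period) - (\<integral>t. cosine_series a \<theta> t * ?s t \<partial>period)
       = (\<integral>t. (cosine_series (truncated N a) \<theta> t - cosine_series a \<theta> t) * ?s t \<partial>period)"
      using ais by (simp add: left_diff_distrib)
    also have "norm \<dots> \<le> (\<integral>t. norm ((cosine_series (truncated N a) \<theta> t - cosine_series a \<theta> t) * ?s t) \<partial>period)"
      by (rule integral_norm_bound)
    also have "\<dots> \<le> (\<integral>t. \<bar>cosine_series (truncated N a) \<theta> t - cosine_series a \<theta> t\<bar> \<partial>period)"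
    proof (rule integral_mono)
      show "integrable period (\<lambda>t. norm ((cosine_series (truncated N a) \<theta> t - cosine_series a \<theta> t) * ?s t))"
        using integrable_mult_bounded[OF d sm square_wave_bounded] by (rule integrable_norm)
      show "integrable period (\<lambda>t. \<bar>cosine_series (truncated N a) \<theta> t - cosine_series a \<theta> t\<bar>)" using d by simp
      show "norm ((cosine_series (truncated N a) \<theta> t - cosine_series a \<theta> t) * ?s t)
          \<le> \<bar>cosine_series (truncated N a) \<theta> t - cosine_series a \<theta> t\<bar>" for t
        using mult_left_mono[OF square_wave_bounded[of n \<theta> t], of "\<bar>cosine_series (truncated N a) \<theta> t - cosine_series a \<theta> t\<bar>"]
        by (simp add: abs_mult)
    qed
    finally show "norm ((\<integral>t. cosine_series (truncated N a) \<theta> t * ?s t \<partial>period) - (\<integral>t. cosine_series a \<theta> t * ?s t \<partial>period))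
      \<le> (\<integral>t. \<bar>cosine_series (truncated N a) \<theta> t - cosine_series a \<theta> t\<bar> \<partial>period)" .
  qed
  then have "(\<lambda>N. \<Sum>k<N. a (Suc k) * I (Suc k)) \<longlonglongrightarrow> (\<integral>t. cosine_series a \<theta> t * ?s t \<partial>period)"
    unfolding part by (rule LIM_zero_cancel)
  then have S: "(\<lambda>k. a (Suc k) * I (Suc k)) sums (\<integral>t. cosine_series a \<theta> t * ?s t \<partial>period)"
    by (simp add: sums_def)
  \<comment> \<open>Terms are indexed by k for the frequency \<open>Suc k\<close>, hence the
    subtraction of 1.\<close>
  define m where "m j = (2 * j + 1) * n - 1" for j
  have m: "Suc (m j) = (2 * j + 1) * n" for j using n by (simp add: m_def)
  have "strict_mono m"
  proof (rule strict_monoI)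
    fix i j :: nat assume "i < j"
    then have "(2 * i + 1) * n < (2 * j + 1) * n" using n by simp
    then show "m i < m j" using m[of i] m[of j] by linarith
  qed
  moreover have "a (Suc k) * I (Suc k) = 0" if "k \<notin> range m" for k
  proof -
    have "Suc k \<noteq> (2 * j + 1) * n" for j using that m[of j] by (metis Suc_inject rangeI)
    then have "I (Suc k) = 0" unfolding I_def by (rule integral_cos_square_wave_zero[OF n])
    then show ?thesis by simp
  qed
  ultimately have "(\<lambda>j. a (Suc (m j)) * I (Suc (m j))) sums (\<integral>t. cosine_series a \<theta> t * ?s t \<partial>period)"
    using S sums_mono_reindex[of m "\<lambda>k. a (Suc k) * I (Suc k)"] by auto
  then show ?thesis
    unfolding m I_def integral_cos_square_wave_odd[OF n \<theta>] .
qed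

section \<open>The function classes\<close>

lemma Lp_norm_1:
  assumes "integrable period f"
  shows "Lp_norm 1 f = ereal (\<integral>t. \<bar>f t\<bar> \<partial>period)"
proof -
  have "(\<integral>\<^sup>+t. ennreal (\<bar>f t\<bar> powr real_of_ereal 1) \<partial>period) = ennreal (\<integral>t. \<bar>f t\<bar> \<partial>period)"
    using assms by (simp add: nn_integral_eq_integral)
  then show ?thesis by (simp add: Lp_norm_def Let_def)
qed

lemma Lp_norm_infinity: "Lp_norm \<infinity> f = esssup period (\<lambda>t. ereal \<bar>f t\<bar>)"
  by (simp add: Lp_norm_def)

lemma Lp_space_1_iff: "f \<in> Lp_space 1 \<longleftrightarrow> periodic_L1 f"
proof
  assume f: "f \<in> Lp_space 1"
  then have m: "f \<in> borel_measurable lebesgue" by (simp add: Lp_space_def)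
  have "(\<integral>\<^sup>+t. ennreal \<bar>f t\<bar> \<partial>period) < \<infinity>"
    using f by (auto simp: Lp_space_def Lp_norm_def Let_def top.not_eq_extremum split: if_splits)
  then have "integrable period f"
    using measurable_restrict_space1[OF m] by (auto simp: integrable_iff_bounded)
  then show "periodic_L1 f" using f by (simp add: periodic_L1_def Lp_space_def)
next
  assume "periodic_L1 f"
  then show "f \<in> Lp_space 1" by (simp add: Lp_space_def periodic_L1_def Lp_norm_1)
qed

lemma Lp_norm_cong_AE:
  assumes "p = 1 \<or> p = \<infinity>" "f \<in> borel_measurable period" "g \<in> borel_measurable period" "AE t in period. f t = g t"
  shows "Lp_norm p f = Lp_norm p g"
proof -
  have 1: "(\<integral>\<^sup>+t. ennreal (\<bar>f t\<bar> powr real_of_ereal p) \<partial>period) = (\<integral>\<^sup>+t. ennreal (\<bar>g t\<bar> powr real_of_ereal p) \<partial>period)"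
    using assms(4) by (intro nn_integral_cong_AE) (auto elim!: eventually_mono)
  have 2: "esssup period (\<lambda>t. ereal \<bar>f t\<bar>) = esssup period (\<lambda>t. ereal \<bar>g t\<bar>)"
    using assms(2-4) by (intro esssup_AE_cong) (auto elim!: eventually_mono)
  show ?thesis unfolding Lp_norm_def 1 2 ..
qed

lemma
  assumes \<phi>: "\<phi> \<in> Hclass p n" and p: "p = 1 \<or> p = \<infinity>"
  shows Hclass_periodic_L1: "periodic_L1 \<phi>"
    and Hclass_coef: "k < n \<Longrightarrow> cos_coef \<phi> k = 0" "k < n \<Longrightarrow> sin_coef \<phi> k = 0"
    and Hclass_norm_1: "p = 1 \<Longrightarrow> (\<integral>t. \<bar>\<phi> t\<bar> \<partial>period) \<le> 1"
    and Hclass_norm_infinity: "p = \<infinity> \<Longrightarrow> AE t in period. \<bar>\<phi> t\<bar> \<le> 1"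
proof -
  show inf: "AE t in period. \<bar>\<phi> t\<bar> \<le> 1" if "p = \<infinity>"
  proof -
    have "esssup period (\<lambda>t. ereal \<bar>\<phi> t\<bar>) \<le> 1" using \<phi> that by (simp add: Hclass_def Lp_norm_infinity)
    moreover have "AE t in period. ereal \<bar>\<phi> t\<bar> \<le> esssup period (\<lambda>t. ereal \<bar>\<phi> t\<bar>)" by (rule esssup_AE)
    ultimately show ?thesis by (auto elim!: eventually_mono dest: order_trans)
  qed
  show P: "periodic_L1 \<phi>"
  proof (cases "p = 1")
    case True
    then show ?thesis using \<phi> Lp_space_1_iff by (simp add: Hclass_def)
  next
    case False
    then have "p = \<infinity>" using p by simp
    have m: "\<phi> \<in> borel_measurable lebesgue" using \<phi> by (simp add: Hclass_def Lp_space_def)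
    have "integrable period \<phi>"
      using finite_measure.integrable_const_bound[OF finite_measure_period, of \<phi> 1] inf[OF \<open>p = \<infinity>\<close>]
        measurable_restrict_space1[OF m] by simp
    then show ?thesis using \<phi> by (simp add: periodic_L1_def Hclass_def Lp_space_def)
  qed
  show "(\<integral>t. \<bar>\<phi> t\<bar> \<partial>period) \<le> 1" if "p = 1"
    using \<phi> that Lp_norm_1[OF periodic_L1_integrable[OF P]] by (simp add: Hclass_def)
  have z: "fourier_coeff \<phi> (int k) = 0" if "k < n" using \<phi> that by (simp add: Hclass_def)
  show "cos_coef \<phi> k = 0" "sin_coef \<phi> k = 0" if "k < n"
    using fourier_coeff_cos_sin[OF periodic_L1_integrable[OF P], of k] z[OF that] by simp_all
qed

text \<open>Frequencies k < n have k pi / n < pi, hence a cosine above -1, and antiperiodicity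
  removes their coefficients. Both extremal functions enter the class in this way.\<close>

lemma HclassI:
  assumes \<phi>: "periodic_L1 \<phi>" and n: "n \<ge> 1" and anti: "\<And>t. \<phi> (t + pi / real n) = - \<phi> t"
    and norm: "Lp_norm p \<phi> \<le> 1"
  shows "\<phi> \<in> Hclass p n"
proof -
  have i: "integrable period \<phi>" by (rule periodic_L1_integrable[OF \<phi>])
  have z: "fourier_coeff \<phi> (int k) = 0" if k: "k < n" for k
  proof -
    have "0 \<le> real k * pi / real n" "real k * pi / real n < pi" using k by (auto simp: field_simps)
    then have "cos pi < cos (real k * pi / real n)" by (intro cos_monotone_0_pi) auto
    then have "cos (real k * pi / real n) \<noteq> -1" by simp
    then have "cos_coef \<phi> k = 0" "sin_coef \<phi> k = 0"
      using antiperiodic_coef_zero[OF \<phi> n anti] by auto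
    then show ?thesis using fourier_coeff_cos_sin[OF i, of k] by (simp add: complex_eq_iff)
  qed
  have "fourier_coeff \<phi> k = 0" if k: "\<bar>k\<bar> \<le> int n - 1" for k
  proof (cases "0 \<le> k")
    case True
    then show ?thesis using z[of "nat k"] k by simp
  next
    case False
    then show ?thesis using z[of "nat (- k)"] k fourier_coeff_uminus[of \<phi> "- k"] by simp
  qed
  moreover have "Lp_norm p \<phi> < \<infinity>" using norm by (rule le_less_trans) simp
  ultimately show ?thesis using \<phi> norm by (simp add: Hclass_def Lp_space_def periodic_L1_def)
qed

lemma Lp_norm_convolution_le:
  assumes \<phi>: "\<phi> \<in> Hclass p n" and p: "p = 1 \<or> p = \<infinity>" and b: "integrable period b"
  shows "Lp_norm p (convolution \<phi> b) \<le> ereal (1 / (2 * pi) * (\<integral>t. \<bar>b t\<bar> \<partial>period))"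
proof (cases "p = 1")
  case True
  have P: "periodic_L1 \<phi>" by (rule Hclass_periodic_L1[OF \<phi> p])
  have "(\<integral>x. \<bar>convolution \<phi> b x\<bar> \<partial>period) \<le> 1 / (2 * pi) * (\<integral>t. \<bar>\<phi> t\<bar> \<partial>period) * (\<integral>t. \<bar>b t\<bar> \<partial>period)"
    by (rule convolution_norm_le[OF P b])
  also have "\<dots> \<le> 1 / (2 * pi) * 1 * (\<integral>t. \<bar>b t\<bar> \<partial>period)"
    using Hclass_norm_1[OF \<phi> p True] by (intro mult_right_mono mult_left_mono) auto
  finally show ?thesis using True Lp_norm_1[OF integrable_convolution[OF P b]] by simp
next
  case False
  then have inf: "p = \<infinity>" using p by simp
  have P: "periodic_L1 \<phi>" by (rule Hclass_periodic_L1[OF \<phi> p])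
  have m: "convolution \<phi> b \<in> borel_measurable period"
    using integrable_convolution[OF P b] by (rule borel_measurable_integrable)
  have "\<bar>convolution \<phi> b x\<bar> \<le> 1 / (2 * pi) * 1 * (\<integral>t. \<bar>b t\<bar> \<partial>period)" for x
    by (rule convolution_Linf_bound[OF P Hclass_norm_infinity[OF \<phi> p inf] b])
  then show ?thesis
    unfolding inf Lp_norm_infinity using m by (intro esssup_I borel_measurable_ereal borel_measurable_abs AE_I2) auto
qed

text \<open>The free phase \<open>\<gamma>\<close> admits sines, and k = 0 gives constants. The
  inductive form lets orthogonality be checked one harmonic at a time.\<close>

inductive trig_poly_below :: "nat \<Rightarrow> (real \<Rightarrow> real) \<Rightarrow> bool" for n where
  zero: "trig_poly_below n (\<lambda>_. 0)"
| add_term: "trig_poly_below n b \<Longrightarrow> k < n \<Longrightarrow> trig_poly_below n (\<lambda>t. b t + c * cos (real k * t - \<gamma>))"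

lemma trig_poly_below_term: "k < n \<Longrightarrow> trig_poly_below n (\<lambda>t. c * cos (real k * t - \<gamma>))"
  using trig_poly_below.add_term[OF trig_poly_below.zero] by simp

lemma trig_poly_below_add:
  assumes "trig_poly_below n b" "trig_poly_below n d"
  shows "trig_poly_below n (\<lambda>t. b t + d t)"
  using assms(2)
proof induction
  case zero
  then show ?case using assms(1) by simp
next
  case (add_term d k c \<gamma>)
  then show ?case using trig_poly_below.add_term[OF add_term.IH add_term.hyps(2), of c \<gamma>] by (simp add: add.assoc)
qed

lemma trig_poly_below_sum:
  assumes "\<And>i. i \<in> A \<Longrightarrow> trig_poly_below n (b i)"
  shows "trig_poly_below n (\<lambda>t. \<Sum>i\<in>A. b i t)"
  using assms
  by (induction A rule: infinite_finite_induct) (auto intro: trig_poly_below.zero trig_poly_below_add)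

lemma trig_poly_below_uminus: "trig_poly_below n b \<Longrightarrow> trig_poly_below n (\<lambda>t. - b t)"
proof (induction rule: trig_poly_below.induct)
  case (add_term b k c \<gamma>)
  then show ?case using trig_poly_below.add_term[OF add_term.IH add_term.hyps(2), of "- c" \<gamma>] by simp
qed (simp add: trig_poly_below.zero)

lemma trig_poly_below_diff:
  "trig_poly_below n b \<Longrightarrow> trig_poly_below n d \<Longrightarrow> trig_poly_below n (\<lambda>t. b t - d t)"
  using trig_poly_below_add[OF _ trig_poly_below_uminus, of n b d] by simp

lemma cos_borel_measurable_period: "(\<lambda>t. cos (real k * t - \<gamma>)) \<in> borel_measurable period"
  by (rule borel_measurable_period) measurable

lemma integrable_cos_period: "integrable period (\<lambda>t. cos (real k * t - \<gamma>))"
  by (rule integrable_period_bounded[where B = 1, OF cos_borel_measurable_period]) simp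

lemma trig_poly_below_integrable: "trig_poly_below n b \<Longrightarrow> integrable period b"
proof (induction rule: trig_poly_below.induct)
  case (add_term b k c \<gamma>)
  show ?case
    by (rule Bochner_Integration.integrable_add[OF add_term.IH integrable_mult_right[OF integrable_cos_period]])
qed simp

lemma convolution_trig_poly_below:
  assumes "trig_poly_below n b" and \<phi>: "\<phi> \<in> Hclass p n" "p = 1 \<or> p = \<infinity>"
  shows "convolution \<phi> b x = 0"
proof -
  have P: "periodic_L1 \<phi>" by (rule Hclass_periodic_L1[OF \<phi>])
  \<comment> \<open>Integrability is carried along because the integral of the sum splits only with
    it.\<close>
  have "integrable period (\<lambda>t. \<phi> (x - t) * b t) \<and> (\<integral>t. \<phi> (x - t) * b t \<partial>period) = 0"
    using assms(1)
  proof induction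
    case (add_term b k c \<gamma>)
    have i: "integrable period (\<lambda>t. \<phi> (x - t) * cos (real k * t - \<gamma>))"
      by (rule convolution_bounded_integrable[OF P cos_borel_measurable_period, where B = 1]) simp
    have "convolution \<phi> (\<lambda>t. cos (real k * t - \<gamma>)) x = 0"
      using Hclass_coef[OF \<phi> add_term.hyps(2)] by (simp add: convolution_cos[OF P])
    then have z: "(\<integral>t. \<phi> (x - t) * cos (real k * t - \<gamma>) \<partial>period) = 0" by (simp add: convolution_def)
    have eq: "(\<lambda>t. \<phi> (x - t) * (b t + c * cos (real k * t - \<gamma>))) = (\<lambda>t. \<phi> (x - t) * b t + c * (\<phi> (x - t) * cos (real k * t - \<gamma>)))"
      by (simp add: fun_eq_iff algebra_simps)
    show ?case
      unfolding eq using add_term.IH i z by simp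
  qed simp
  then show ?thesis by (simp add: convolution_def)
qed

text \<open>The square wave itself belongs to \<open>Hclass \<infinity> n\<close>, so its
  coefficients below \<open>n\<close> vanish.\<close>

lemma integral_trig_poly_below_square_wave:
  assumes "trig_poly_below n b" and n: "n \<ge> 1"
  shows "integrable period (\<lambda>t. b t * square_wave n \<theta> t)" "(\<integral>t. b t * square_wave n \<theta> t \<partial>period) = 0"
proof -
  have P: "periodic_L1 (square_wave n \<theta>)" by (rule periodic_L1_square_wave[OF n])
  have "Lp_norm \<infinity> (square_wave n \<theta>) \<le> 1"
    unfolding Lp_norm_infinity using square_wave_bounded[of n \<theta>]
    by (intro esssup_I borel_measurable_ereal borel_measurable_abs borel_measurable_period(1) square_wave_measurable AE_I2)
      (auto simp: one_ereal_def)
  then have H: "square_wave n \<theta> \<in> Hclass \<infinity> n"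
    using P n square_wave_antiperiodic by (intro HclassI) auto
  have "integrable period (\<lambda>t. b t * square_wave n \<theta> t) \<and> (\<integral>t. b t * square_wave n \<theta> t \<partial>period) = 0"
    using assms(1)
  proof induction
    case (add_term b k c \<gamma>)
    have i: "integrable period (\<lambda>t. square_wave n \<theta> t * cos (real k * t - \<gamma>))"
      by (rule integrable_cos_sin[OF periodic_L1_integrable[OF P]])
    have "(\<integral>t. square_wave n \<theta> t * cos (real k * t - \<gamma>) \<partial>period)
       = (\<integral>t. cos \<gamma> * (square_wave n \<theta> t * cos (real k * t)) + sin \<gamma> * (square_wave n \<theta> t * sin (real k * t)) \<partial>period)"
      unfolding cos_diff by (intro Bochner_Integration.integral_cong refl) (simp add: algebra_simps)
    also have "\<dots> = cos \<gamma> * cos_coef (square_wave n \<theta>) k + sin \<gamma> * sin_coef (square_wave n \<theta>) k"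
      unfolding cos_coef_def sin_coef_def using integrable_cos_sin[OF periodic_L1_integrable[OF P]] by simp
    also have "\<dots> = 0" using Hclass_coef[OF H disjI2[OF refl] add_term.hyps(2)] by simp
    finally have z: "(\<integral>t. square_wave n \<theta> t * cos (real k * t - \<gamma>) \<partial>period) = 0" .
    have eq: "(\<lambda>t. (b t + c * cos (real k * t - \<gamma>)) * square_wave n \<theta> t) = (\<lambda>t. b t * square_wave n \<theta> t + c * (square_wave n \<theta> t * cos (real k * t - \<gamma>)))"
      by (simp add: fun_eq_iff algebra_simps)
    show ?case unfolding eq using add_term.IH i z by simp
  qed simp
  then show "integrable period (\<lambda>t. b t * square_wave n \<theta> t)" "(\<integral>t. b t * square_wave n \<theta> t \<partial>period) = 0"
    by auto
qed

lemma period_integral_swap: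
  fixes w :: "real \<Rightarrow> real \<Rightarrow> real"
  assumes w: "(\<lambda>p. w (fst p) (snd p)) \<in> borel_measurable (period \<Otimes>\<^sub>M period)" and B: "\<And>x t. \<bar>w x t\<bar> \<le> B"
    and K: "integrable period K"
  shows "(\<integral>x. (\<integral>t. w x t * K t \<partial>period) \<partial>period) = (\<integral>t. (\<integral>x. w x t * K t \<partial>period) \<partial>period)"
    and "integrable period (\<lambda>x. \<integral>t. w x t * K t \<partial>period)"
proof -
  interpret pair_sigma_finite period period by (rule pair_sigma_finite_period)
  have Km: "(\<lambda>p. K (snd p)) \<in> borel_measurable (period \<Otimes>\<^sub>M period)"
    using measurable_compose[OF measurable_snd borel_measurable_integrable[OF K]] .
  have fin: "integrable period (\<lambda>_. c :: real)" for c using finite_measure.integrable_const[OF finite_measure_period] .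
  have KI: "integrable (period \<Otimes>\<^sub>M period) (\<lambda>p. \<bar>B\<bar> * K (snd p))"
    by (rule integrable_mult_right, rule Fubini_integrable) (use Km K fin in auto)
  have "integrable (period \<Otimes>\<^sub>M period) (\<lambda>p. w (fst p) (snd p) * K (snd p))"
  proof (rule Bochner_Integration.integrable_bound[OF KI borel_measurable_times[OF w Km]], rule AE_I2)
    fix p
    have "\<bar>w (fst p) (snd p)\<bar> \<le> \<bar>B\<bar>" using B[of "fst p" "snd p"] by linarith
    then have "\<bar>w (fst p) (snd p)\<bar> * \<bar>K (snd p)\<bar> \<le> \<bar>B\<bar> * \<bar>K (snd p)\<bar>" by (rule mult_right_mono) simp
    then show "norm (w (fst p) (snd p) * K (snd p)) \<le> norm (\<bar>B\<bar> * K (snd p))" by (simp add: abs_mult)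
  qed
  then have I: "integrable (period \<Otimes>\<^sub>M period) (\<lambda>(x, t). w x t * K t)"
    unfolding case_prod_beta' .
  show "(\<integral>x. (\<integral>t. w x t * K t \<partial>period) \<partial>period) = (\<integral>t. (\<integral>x. w x t * K t \<partial>period) \<partial>period)"
    using Fubini_integral[OF I] by simp
  show "integrable period (\<lambda>x. \<integral>t. w x t * K t \<partial>period)"
    using integrable_fst'[OF I] by simp
qed

section \<open>Duality\<close>

context
  fixes n :: nat and \<theta> :: real and K :: "real \<Rightarrow> real"
  assumes n: "n \<ge> 1" and K: "integrable period K"
begin

text \<open>The correlation of the kernel with the square wave. Its value at 0 is the error to be
  established, and its value at -x is the convolution of the kernel with the reflected square wave
  at x.\<close>

definition dual_function :: "real \<Rightarrow> real" where
  "dual_function u = 1 / (2 * pi) * (\<integral>t. square_wave n \<theta> (u + t) * K t \<partial>period)"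

lemma square_wave_shift_measurable: "(\<lambda>t. square_wave n \<theta> (u + t)) \<in> borel_measurable period"
  by (rule borel_measurable_period) measurable

lemma dual_function_borel: "dual_function \<in> borel_measurable borel"
proof -
  have id: "(\<lambda>x. x) \<in> borel_measurable period"
    using id_borel_measurable_lebesgue_on by (simp add: id_def)
  have "(\<lambda>p. fst p + snd p) \<in> borel_measurable (borel \<Otimes>\<^sub>M period)"
    by (rule borel_measurable_add[OF measurable_fst measurable_compose[OF measurable_snd id]])
  then have "(\<lambda>p. square_wave n \<theta> (fst p + snd p)) \<in> borel_measurable (borel \<Otimes>\<^sub>M period)"
    by (rule measurable_compose[OF _ square_wave_measurable])
  then have "(\<lambda>p. square_wave n \<theta> (fst p + snd p) * K (snd p)) \<in> borel_measurable (borel \<Otimes>\<^sub>M period)"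
    by (rule borel_measurable_times[OF _ measurable_compose[OF measurable_snd borel_measurable_integrable[OF K]]])
  then have "(\<lambda>u. \<integral>t. square_wave n \<theta> (u + t) * K t \<partial>period) \<in> borel_measurable borel"
    by (intro sigma_finite_measure.borel_measurable_lebesgue_integral[OF sigma_finite_period]) (simp only: case_prod_beta')
  then show ?thesis
    unfolding dual_function_def[abs_def] by measurable
qed

lemma dual_function_antiperiodic: "dual_function (u + pi / real n) = - dual_function u"
proof -
  have "square_wave n \<theta> (u + pi / real n + t) = - square_wave n \<theta> (u + t)" for t
    using square_wave_antiperiodic[OF n, of \<theta> "u + t"] by (simp add: algebra_simps)
  then show ?thesis by (simp add: dual_function_def)
qed

lemma dual_function_bounded: "\<bar>dual_function u\<bar> \<le> 1 / (2 * pi) * (\<integral>t. \<bar>K t\<bar> \<partial>period)"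
proof -
  have "\<bar>\<integral>t. square_wave n \<theta> (u + t) * K t \<partial>period\<bar> \<le> (\<integral>t. \<bar>square_wave n \<theta> (u + t) * K t\<bar> \<partial>period)"
    by (rule integral_abs_bound)
  also have "\<dots> \<le> (\<integral>t. \<bar>K t\<bar> \<partial>period)"
  proof (rule integral_mono)
    show "integrable period (\<lambda>t. \<bar>square_wave n \<theta> (u + t) * K t\<bar>)"
      using integrable_mult_bounded[OF K square_wave_shift_measurable square_wave_bounded] by (simp add: mult.commute)
    show "\<bar>square_wave n \<theta> (u + t) * K t\<bar> \<le> \<bar>K t\<bar>" for t
      using mult_right_mono[OF square_wave_bounded[of n \<theta> "u + t"] abs_ge_zero[of "K t"]] by (simp add: abs_mult)
  qed (use K in simp)
  finally show ?thesis by (simp add: dual_function_def abs_mult mult_left_mono divide_right_mono)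
qed

text \<open>The square wave is continuous off the zeros of the cosine, a null set, and |K|
  dominates. Continuity spreads the single value at 0 over a set of positive measure, which an
  essential supremum or an integral can notice.\<close>

lemma dual_function_continuous_0: "isCont dual_function 0"
  unfolding continuous_at_sequentially
proof (intro allI impI)
  fix x :: "nat \<Rightarrow> real" assume x: "x \<longlonglongrightarrow> 0"
  have "(\<lambda>i. \<integral>t. square_wave n \<theta> (x i + t) * K t \<partial>period) \<longlonglongrightarrow> (\<integral>t. square_wave n \<theta> (0 + t) * K t \<partial>period)"
  proof (rule integral_dominated_convergence[where w = "\<lambda>t. \<bar>K t\<bar>"])
    have "AE t in period. cos (real n * t - \<theta>) \<noteq> 0"
      using AE_period_affine[OF AE_square_wave_nonzero[OF n, of \<theta>], of 1 0] by simp
    then show "AE t in period. (\<lambda>i. square_wave n \<theta> (x i + t) * K t) \<longlonglongrightarrow> square_wave n \<theta> (0 + t) * K t"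
    proof eventually_elim
      case (elim t)
      have "(\<lambda>i. sgn (cos (real n * (x i + t) - \<theta>))) \<longlonglongrightarrow> sgn (cos (real n * (0 + t) - \<theta>))"
        using elim by (intro tendsto_sgn tendsto_intros x) simp
      then show ?case unfolding square_wave_def by (rule tendsto_mult_right)
    qed
    show "AE t in period. norm (square_wave n \<theta> (x i + t) * K t) \<le> \<bar>K t\<bar>" for i
      using mult_right_mono[OF square_wave_bounded abs_ge_zero[of "K _"]] by (intro AE_I2) (simp add: abs_mult)
    show "(\<lambda>t. square_wave n \<theta> (x i + t) * K t) \<in> borel_measurable period"
      "(\<lambda>t. square_wave n \<theta> (0 + t) * K t) \<in> borel_measurable period" for i
      by (intro borel_measurable_times square_wave_shift_measurable borel_measurable_integrable[OF K])+
  qed (use K in simp)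
  then show "(dual_function \<circ> x) \<longlonglongrightarrow> dual_function 0"
    unfolding dual_function_def[abs_def] comp_def by (intro tendsto_intros)
qed

lemma dual_function_large_set_measurable:
  "{u \<in> {-pi..pi}. c < dual_function u} \<in> sets period"
  "{u \<in> {-pi..pi}. c < dual_function (- u)} \<in> sets period"
proof -
  show "{u \<in> {-pi..pi}. c < dual_function u} \<in> sets period"
    using borel_measurable_period(1)[OF dual_function_borel] by (auto simp: borel_measurable_iff_greater)
  have "(\<lambda>u. dual_function (- u)) \<in> borel_measurable borel"
    using dual_function_borel by measurable
  from borel_measurable_period(1)[OF this]
  show "{u \<in> {-pi..pi}. c < dual_function (- u)} \<in> sets period"
    by (auto simp: borel_measurable_iff_greater)
qed

lemma dual_function_large_set:
  assumes "c < dual_function 0"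
  shows "0 < emeasure period {u \<in> {-pi..pi}. c < dual_function u}"
    and "0 < emeasure period {u \<in> {-pi..pi}. c < dual_function (- u)}"
proof -
  have "eventually (\<lambda>u. c < dual_function u) (nhds 0)"
    using dual_function_continuous_0 assms by (intro order_tendstoD) (simp add: isCont_def tendsto_at_iff_tendsto_nhds)
  then obtain d where d: "d > 0" "\<And>u. dist u 0 < d \<Longrightarrow> c < dual_function u"
    by (auto simp: eventually_nhds_metric)
  define m where "m = min (d / 2) 1"
  have m: "0 < m" "m < d" "m \<le> pi" using d(1) pi_gt3 by (auto simp: m_def)
  have pos: "0 < emeasure period {-m..m}"
    using m by (subst emeasure_restrict_space) auto
  have sub: "{-m..m} \<subseteq> {u \<in> {-pi..pi}. c < dual_function u}" "{-m..m} \<subseteq> {u \<in> {-pi..pi}. c < dual_function (- u)}"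
    using m d by (auto simp: dist_real_def)
  show "0 < emeasure period {u \<in> {-pi..pi}. c < dual_function u}"
    "0 < emeasure period {u \<in> {-pi..pi}. c < dual_function (- u)}"
    using pos emeasure_mono[OF sub(1) dual_function_large_set_measurable(1)]
      emeasure_mono[OF sub(2) dual_function_large_set_measurable(2)] by (auto intro: less_le_trans)
qed

text \<open>For the reflected square wave the convolution at 0 equals
  \<open>dual_function 0\<close>. A smaller essential supremum would contradict the positive measure
  of the set where the values exceed some c between the two.\<close>

lemma exists_extremal_infinity:
  obtains \<phi> where "\<phi> \<in> Hclass \<infinity> n" "ereal (dual_function 0) \<le> Lp_norm \<infinity> (convolution \<phi> K)"
proof
  define \<phi> where "\<phi> t = square_wave n \<theta> (- t)" for t
  have \<phi>m: "\<phi> \<in> borel_measurable borel" unfolding \<phi>_def[abs_def] by measurable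
  have anti: "\<phi> (t + pi / real n) = - \<phi> t" for t
    using square_wave_antiperiodic[OF n, of \<theta> "- (t + pi / real n)"] by (simp add: \<phi>_def)
  have P: "periodic_L1 \<phi>"
    using \<phi>m antiperiodic_imp_periodic[where \<phi> = \<phi>, OF n anti] square_wave_bounded by (intro periodic_L1_bounded[where B = 1]) (auto simp: \<phi>_def)
  have "Lp_norm \<infinity> \<phi> \<le> 1"
    unfolding Lp_norm_infinity using square_wave_bounded
    by (intro esssup_I borel_measurable_ereal borel_measurable_abs borel_measurable_period(1) \<phi>m AE_I2) (auto simp: one_ereal_def \<phi>_def)
  then show "\<phi> \<in> Hclass \<infinity> n" using P n anti by (intro HclassI)
  have eq: "convolution \<phi> K x = dual_function (- x)" for x
    by (simp add: convolution_def dual_function_def \<phi>_def)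
  show "ereal (dual_function 0) \<le> Lp_norm \<infinity> (convolution \<phi> K)"
  proof (rule ccontr)
    assume "\<not> ereal (dual_function 0) \<le> Lp_norm \<infinity> (convolution \<phi> K)"
    then obtain c where c: "Lp_norm \<infinity> (convolution \<phi> K) < ereal c" "ereal c < ereal (dual_function 0)"
      using ereal_dense2 not_le by metis
    have "AE x in period. ereal \<bar>convolution \<phi> K x\<bar> \<le> Lp_norm \<infinity> (convolution \<phi> K)"
      unfolding Lp_norm_infinity by (rule esssup_AE)
    then have "AE x in period. \<not> c < dual_function (- x)"
    proof eventually_elim
      case (elim x)
      then have "ereal \<bar>convolution \<phi> K x\<bar> < ereal c" using c(1) by (rule le_less_trans)
      then show ?case unfolding eq by auto
    qed
    then have "emeasure period {x \<in> {-pi..pi}. c < dual_function (- x)} = 0"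
      by (subst (asm) AE_iff_measurable[OF _ refl]) (use dual_function_large_set_measurable in auto)
    then show False using dual_function_large_set(2)[of c] c(2) by simp
  qed
qed

text \<open>Fubini and the substitution x -> x + t move the convolution from \<open>\<phi>\<close>
  to the square wave: convolution with \<open>K\<close> and correlation with \<open>K\<close> are
  adjoint.\<close>

lemma integral_convolution_square_wave:
  assumes \<phi>: "\<phi> \<in> borel_measurable borel" "\<And>t. \<phi> (t + 2 * pi) = \<phi> t" "\<And>t. \<bar>\<phi> t\<bar> \<le> B"
  shows "(\<integral>x. square_wave n \<theta> x * convolution \<phi> K x \<partial>period) = (\<integral>u. \<phi> u * dual_function u \<partial>period)"
proof -
  let ?s = "square_wave n \<theta>"
  have id: "(\<lambda>x. x) \<in> borel_measurable period"
    using id_borel_measurable_lebesgue_on by (simp add: id_def)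
  note f = measurable_compose[OF measurable_fst[of period period] id]
    and s = measurable_compose[OF measurable_snd[of period period] id]
  have prod_le: "\<bar>?s x * \<phi> y\<bar> \<le> B" for x y
    using mult_mono[OF square_wave_bounded[of n \<theta> x] \<phi>(3)[of y]] by (simp add: abs_mult)
  define w1 w2 where "w1 x t = ?s x * \<phi> (x - t)" and "w2 u t = ?s (u + t) * \<phi> u" for x t u
  have w1: "(\<lambda>p. w1 (fst p) (snd p)) \<in> borel_measurable (period \<Otimes>\<^sub>M period)"
    unfolding w1_def
    by (intro borel_measurable_times measurable_compose[OF _ square_wave_measurable] measurable_compose[OF _ \<phi>(1)]
        borel_measurable_diff f s)
  have w2: "(\<lambda>p. w2 (fst p) (snd p)) \<in> borel_measurable (period \<Otimes>\<^sub>M period)"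
    unfolding w2_def
    by (intro borel_measurable_times measurable_compose[OF _ square_wave_measurable] measurable_compose[OF _ \<phi>(1)]
        borel_measurable_add f s)
  have B: "\<bar>w1 x t\<bar> \<le> B" "\<bar>w2 x t\<bar> \<le> B" for x t unfolding w1_def w2_def by (rule prod_le)+
  have inner: "(\<integral>x. w1 x t \<partial>period) = (\<integral>u. w2 u t \<partial>period)" for t
  proof -
    define q where "q x = ?s x * \<phi> (x - t)" for x
    have "periodic_L1 q"
    proof (rule periodic_L1_bounded)
      show "q \<in> borel_measurable borel" unfolding q_def[abs_def] using \<phi>(1) by measurable
      show "q (x + 2 * pi) = q x" for x
      proof -
        have "x + 2 * pi - t = (x - t) + 2 * pi" by simp
        then show ?thesis
          unfolding q_def using \<phi>(2)[of "x - t"] periodic_L1_square_wave[OF n, of \<theta>] by (simp only: periodic_L1_def)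
      qed
      show "\<bar>q x\<bar> \<le> B" for x unfolding q_def by (rule prod_le)
    qed
    from integral_period_translate(2)[OF this, of t] show ?thesis
      unfolding q_def w1_def w2_def by (simp add: add.commute)
  qed
  have "(\<integral>x. ?s x * convolution \<phi> K x \<partial>period) = 1 / (2 * pi) * (\<integral>x. (\<integral>t. w1 x t * K t \<partial>period) \<partial>period)"
    unfolding convolution_def w1_def integral_mult_right_zero[symmetric] by (simp only: mult_ac)
  also have "(\<integral>x. (\<integral>t. w1 x t * K t \<partial>period) \<partial>period) = (\<integral>t. (\<integral>x. w1 x t * K t \<partial>period) \<partial>period)"
    by (rule period_integral_swap(1)[OF w1 B(1) K])
  also have "\<dots> = (\<integral>t. (\<integral>x. w2 x t * K t \<partial>period) \<partial>period)"
    unfolding integral_mult_left_zero inner ..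
  also have "\<dots> = (\<integral>x. (\<integral>t. w2 x t * K t \<partial>period) \<partial>period)"
    by (rule period_integral_swap(1)[OF w2 B(2) K, symmetric])
  also have "1 / (2 * pi) * \<dots> = (\<integral>u. \<phi> u * dual_function u \<partial>period)"
    unfolding dual_function_def w2_def integral_mult_right_zero[symmetric] by (simp only: mult_ac)
  finally show ?thesis .
qed

text \<open>Alternating point masses at the multiples of pi / n would be extremal but are no
  functions. Instead \<open>\<phi>\<close> is spread over the set where the modulus of
  \<open>dual_function\<close> exceeds \<open>c\<close>, with its sign, and normalised: testing the
  convolution with the square wave, of modulus at most 1, returns at least \<open>c\<close>.\<close>

lemma exists_extremal_1:
  assumes c: "0 \<le> c" "c < dual_function 0"
  obtains \<phi> where "\<phi> \<in> Hclass 1 n" "ereal c \<le> Lp_norm 1 (convolution \<phi> K)"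
proof
  let ?F = dual_function
  \<comment> \<open>The modulus keeps the set invariant under the shift by pi / n, so that
    \<open>\<eta>\<close> inherits antiperiodicity.\<close>
  define \<eta> where "\<eta> u = (if c < \<bar>?F u\<bar> then sgn (?F u) else 0)" for u
  define I where "I = (\<integral>u. \<bar>\<eta> u\<bar> \<partial>period)"
  define \<phi> where "\<phi> u = \<eta> u / I" for u
  note Fm [measurable] = dual_function_borel
  have \<eta>m: "\<eta> \<in> borel_measurable borel" unfolding \<eta>_def[abs_def] by measurable
  have \<eta>1: "\<bar>\<eta> u\<bar> \<le> 1" for u by (simp add: \<eta>_def sgn_if)
  have \<eta>anti: "\<eta> (u + pi / real n) = - \<eta> u" for u by (simp add: \<eta>_def dual_function_antiperiodic sgn_minus)
  have \<eta>P: "periodic_L1 \<eta>"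
    using \<eta>m antiperiodic_imp_periodic[where \<phi> = \<eta>, OF n \<eta>anti] \<eta>1 by (rule periodic_L1_bounded)
  have \<eta>i: "integrable period \<eta>" by (rule periodic_L1_integrable[OF \<eta>P])
  have "I \<noteq> 0"
  proof
    assume "I = 0"
    then have "AE u in period. \<bar>\<eta> u\<bar> = 0"
      using \<eta>i unfolding I_def by (subst (asm) integral_nonneg_eq_0_iff_AE) auto
    then have "AE u in period. \<not> c < ?F u"
      by eventually_elim (use c(1) in \<open>auto simp: \<eta>_def sgn_if split: if_splits\<close>)
    then have "emeasure period {u \<in> {-pi..pi}. c < ?F u} = 0"
      by (subst (asm) AE_iff_measurable[OF _ refl]) (use dual_function_large_set_measurable in auto)
    then show False using dual_function_large_set(1)[OF c(2)] by simp
  qed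
  moreover have "0 \<le> I" by (simp add: I_def)
  ultimately have I: "0 < I" by simp
  have \<phi>m: "\<phi> \<in> borel_measurable borel" unfolding \<phi>_def[abs_def] using \<eta>m by measurable
  have \<phi>anti: "\<phi> (u + pi / real n) = - \<phi> u" for u by (simp add: \<phi>_def \<eta>anti)
  have \<phi>B: "\<bar>\<phi> u\<bar> \<le> 1 / I" for u using \<eta>1[of u] I by (simp add: \<phi>_def divide_right_mono)
  note \<phi>per = antiperiodic_imp_periodic[where \<phi> = \<phi>, OF n \<phi>anti]
  have \<phi>P: "periodic_L1 \<phi>" using \<phi>m \<phi>per \<phi>B by (rule periodic_L1_bounded)
  have "Lp_norm 1 \<phi> = 1"
    using Lp_norm_1[OF periodic_L1_integrable[OF \<phi>P]] I by (simp add: \<phi>_def I_def[symmetric] one_ereal_def)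
  then show "\<phi> \<in> Hclass 1 n" using \<phi>P n \<phi>anti by (intro HclassI) auto
  have Ci: "integrable period (convolution \<phi> K)" by (rule integrable_convolution[OF \<phi>P K])
  have Fb: "\<bar>?F u\<bar> \<le> 1 / (2 * pi) * (\<integral>t. \<bar>K t\<bar> \<partial>period)" for u by (rule dual_function_bounded)
  have "c = c * I / I" using I by simp
  also have "c * I = (\<integral>u. c * \<bar>\<eta> u\<bar> \<partial>period)" by (simp add: I_def)
  also have "\<dots> \<le> (\<integral>u. \<eta> u * ?F u \<partial>period)"
  proof (rule integral_mono)
    show "integrable period (\<lambda>u. \<eta> u * ?F u)"
      using \<eta>i borel_measurable_period(1)[OF Fm] Fb by (rule integrable_mult_bounded)
    show "c * \<bar>\<eta> u\<bar> \<le> \<eta> u * ?F u" for u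
      using c(1) by (auto simp: \<eta>_def sgn_if)
  qed (use \<eta>i in simp)
  also have "(\<integral>u. \<eta> u * ?F u \<partial>period) / I = (\<integral>u. \<phi> u * ?F u \<partial>period)"
    by (simp add: \<phi>_def)
  also have "\<dots> = (\<integral>x. square_wave n \<theta> x * convolution \<phi> K x \<partial>period)"
    by (rule integral_convolution_square_wave[OF \<phi>m \<phi>per \<phi>B, symmetric])
  also have "\<dots> \<le> (\<integral>x. \<bar>convolution \<phi> K x\<bar> \<partial>period)"
  proof (rule integral_mono)
    show "integrable period (\<lambda>x. square_wave n \<theta> x * convolution \<phi> K x)"
      using integrable_mult_bounded[OF Ci borel_measurable_period(1)[OF square_wave_measurable] square_wave_bounded]
      by (simp add: mult.commute)
    show "square_wave n \<theta> x * convolution \<phi> K x \<le> \<bar>convolution \<phi> K x\<bar>" for x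
      by (auto simp: square_wave_def sgn_if)
  qed (use Ci in simp)
  finally show "ereal c \<le> Lp_norm 1 (convolution \<phi> K)"
    unfolding Lp_norm_1[OF Ci] using I by (simp add: divide_right_mono)
qed

text \<open>Duality: an approximation of the kernel whose difference has the sign of the square wave bounds the
  error from above, and the square wave (for \<open>L\<^sub>\<infinity>\<close>) or the set where the correlation of the kernel
  with the square wave is nearly maximal (for \<open>L\<^sub>1\<close>) provides extremal functions.\<close>

lemma approx_error_eq_dual:
  fixes \<psi> g :: "real \<Rightarrow> real" and p :: ereal
  assumes p: "p = 1 \<or> p = \<infinity>" and \<psi>: "integrable period \<psi>" and g: "integrable period g"
    and dev: "\<And>\<phi>. periodic_L1 \<phi> \<Longrightarrow>
      AE x in period. convolution \<phi> \<psi> x - convolution (convolution \<phi> \<psi>) g x = convolution \<phi> K x"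
    and near: "\<And>e. e > 0 \<Longrightarrow> \<exists>b. trig_poly_below n b \<and>
      (\<integral>t. \<bar>K t - b t\<bar> \<partial>period) \<le> (\<integral>t. K t * square_wave n \<theta> t \<partial>period) + e"
  shows "approx_error p {convolution \<phi> \<psi> | \<phi>. \<phi> \<in> Hclass p n} (\<lambda>f. convolution f g)
    = ereal (1 / (2 * pi) * (\<integral>t. K t * square_wave n \<theta> t \<partial>period))"
proof -
  let ?E = "1 / (2 * pi) * (\<integral>t. K t * square_wave n \<theta> t \<partial>period)"
  have E: "dual_function 0 = ?E" by (simp add: dual_function_def mult.commute)
  have norm_eq: "Lp_norm p (\<lambda>x. convolution \<phi> \<psi> x - convolution (convolution \<phi> \<psi>) g x) = Lp_norm p (convolution \<phi> K)"
    if \<phi>: "\<phi> \<in> Hclass p n" for \<phi>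
  proof -
    have P: "periodic_L1 \<phi>" by (rule Hclass_periodic_L1[OF \<phi> p])
    have f: "periodic_L1 (convolution \<phi> \<psi>)" by (rule periodic_L1_convolution[OF P \<psi>])
    show ?thesis
      using p _ _ dev[OF P]
    proof (rule Lp_norm_cong_AE)
      show "(\<lambda>x. convolution \<phi> \<psi> x - convolution (convolution \<phi> \<psi>) g x) \<in> borel_measurable period"
        by (intro borel_measurable_diff borel_measurable_integrable periodic_L1_integrable f integrable_convolution g)
      show "convolution \<phi> K \<in> borel_measurable period"
        by (intro borel_measurable_integrable integrable_convolution P K)
    qed
  qed
  have upper: "Lp_norm p (convolution \<phi> K) \<le> ereal ?E" if \<phi>: "\<phi> \<in> Hclass p n" for \<phi>
  proof (rule ereal_le_epsilon2)
    fix e :: real assume e: "0 < e"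
    have P: "periodic_L1 \<phi>" by (rule Hclass_periodic_L1[OF \<phi> p])
    \<comment> \<open>The factor 2 pi compensates the normalisation of the convolution.\<close>
    obtain b where b: "trig_poly_below n b"
      "(\<integral>t. \<bar>K t - b t\<bar> \<partial>period) \<le> (\<integral>t. K t * square_wave n \<theta> t \<partial>period) + 2 * pi * e"
      using near[of "2 * pi * e"] e by auto
    have bi: "integrable period b" by (rule trig_poly_below_integrable[OF b(1)])
    have Kb: "integrable period (\<lambda>t. K t - b t)" using K bi by simp
    have "AE x in period. convolution \<phi> K x = convolution \<phi> (\<lambda>t. K t - b t) x"
      using convolution_diff_right[OF P K bi] by eventually_elim (simp add: convolution_trig_poly_below[OF b(1) \<phi> p])
    then have "Lp_norm p (convolution \<phi> K) = Lp_norm p (convolution \<phi> (\<lambda>t. K t - b t))"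
      by (intro Lp_norm_cong_AE p borel_measurable_integrable integrable_convolution P K Kb)
    also have "\<dots> \<le> ereal (1 / (2 * pi) * (\<integral>t. \<bar>K t - b t\<bar> \<partial>period))"
      by (rule Lp_norm_convolution_le[OF \<phi> p Kb])
    also have "\<dots> \<le> ereal (1 / (2 * pi) * ((\<integral>t. K t * square_wave n \<theta> t \<partial>period) + 2 * pi * e))"
      unfolding ereal_less_eq using b(2) by (intro mult_left_mono) auto
    also have "\<dots> = ereal ?E + ereal e" by (simp add: field_simps)
    finally show "Lp_norm p (convolution \<phi> K) \<le> ereal ?E + ereal e" .
  qed
  have E0: "0 \<le> ?E"
  proof -
    have "0 \<le> (\<integral>t. K t * square_wave n \<theta> t \<partial>period) + e" if "e > 0" for e
    proof -
      obtain b where "(\<integral>t. \<bar>K t - b t\<bar> \<partial>period) \<le> (\<integral>t. K t * square_wave n \<theta> t \<partial>period) + e"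
        using near \<open>e > 0\<close> by blast
      moreover have "0 \<le> (\<integral>t. \<bar>K t - b t\<bar> \<partial>period)" by simp
      ultimately show ?thesis by linarith
    qed
    then have "0 \<le> (\<integral>t. K t * square_wave n \<theta> t \<partial>period)" by (rule field_le_epsilon)
    then show ?thesis by simp
  qed
  let ?S = "SUP f\<in>{convolution \<phi> \<psi> | \<phi>. \<phi> \<in> Hclass p n}. Lp_norm p (\<lambda>x. f x - convolution f g x)"
  have mem: "Lp_norm p (convolution \<phi> K) \<le> ?S" if \<phi>: "\<phi> \<in> Hclass p n" for \<phi>
    unfolding norm_eq[OF \<phi>, symmetric] by (rule SUP_upper) (use \<phi> in blast)
  have "?S = ereal ?E"
  proof (rule antisym)
    show "?S \<le> ereal ?E"
      by (rule SUP_least) (use norm_eq upper in force)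
    show "ereal ?E \<le> ?S"
    proof (cases "p = 1")
      case False
      then have inf: "p = \<infinity>" using p by simp
      obtain \<phi> where "\<phi> \<in> Hclass \<infinity> n" "ereal (dual_function 0) \<le> Lp_norm \<infinity> (convolution \<phi> K)"
        by (rule exists_extremal_infinity)
      then show ?thesis using mem[of \<phi>] unfolding inf E by (auto intro: order_trans)
    next
      case True
      have "ereal c \<le> ?S" if "0 \<le> c" "c < ?E" for c
      proof -
        have "c < dual_function 0" unfolding E by (rule that(2))
        with that(1) obtain \<phi> where "\<phi> \<in> Hclass 1 n" "ereal c \<le> Lp_norm 1 (convolution \<phi> K)"
          by (rule exists_extremal_1)
        then show ?thesis using mem[of \<phi>] unfolding True by (auto intro: order_trans)
      qed
      note large = this
      \<comment> \<open>The zero function settles the levels y \<le> 0; extremal functions are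
        available for c \<ge> 0 only.\<close>
      have "(\<lambda>_. 0) \<in> Hclass 1 n"
        by (simp add: Hclass_def Lp_space_1_iff periodic_L1_def Lp_norm_1 fourier_coeff_def)
      then have "Lp_norm 1 (convolution (\<lambda>_. 0) K) \<le> ?S" using mem unfolding True by blast
      moreover have "Lp_norm 1 (convolution (\<lambda>_. 0) K) = 0"
        unfolding convolution_def[abs_def] by (simp add: Lp_norm_1 zero_ereal_def)
      ultimately have S0: "0 \<le> ?S" by (simp only:)
      show ?thesis
      proof (rule dense_le)
        fix y assume y: "y < ereal ?E"
        show "y \<le> ?S"
        proof (cases "y \<le> 0")
          case False
          then obtain c where "y = ereal c" using y by (cases y) auto
          then show ?thesis using large[of c] y False by simp
        qed (use S0 in \<open>auto intro: order_trans\<close>)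
      qed
    qed
  qed
  then show ?thesis unfolding approx_error_def .
qed

end

section \<open>Sign-preserving approximations of the kernel\<close>

lemma sum_lessThan_add:
  fixes f :: "nat \<Rightarrow> real"
  shows "(\<Sum>k<a + b. f k) = (\<Sum>k<a. f k) + (\<Sum>i<b. f (a + i))"
  by (induction b) (simp_all add: add.assoc)

text \<open>Multiplying \<open>cos (n t - \<theta>)\<close> by an even trigonometric series folds frequencies at \<open>\<plusminus>n\<close>; modulo
  frequencies below \<open>n\<close> the coefficients are \<open>d (m - n) \<plusminus> d (m + n)\<close>.\<close>

lemma cosine_series_factorization:
  fixes c d :: "nat \<Rightarrow> real"
  assumes n: "n \<ge> 1" and \<theta>: "sin (2 * \<theta>) = 0" and d: "\<And>k. L \<le> k \<Longrightarrow> d k = 0"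
    and c: "\<And>m. n \<le> m \<Longrightarrow> c m = d (m - n) + cos (2 * \<theta>) * d (m + n)"
  obtains b where "trig_poly_below n b"
    "\<And>t. cosine_series c \<theta> t - b t = cos (real n * t - \<theta>) * (d 0 + 2 * (\<Sum>k<2 * n + L. d (Suc k) * cos (real (Suc k) * t)))"
proof
  define Q where "Q = L + 1"
  define f where "f m t = cos (real m * t - \<theta>)" for m :: nat and t
  define C where "C t = (\<Sum>k<n-1. c (Suc k) * f (Suc k) t)" for t
  \<comment> \<open>For 1 \<le> k + 1 \<le> 2 n - 1 the lower frequency n - (k + 1) has modulus
    below \<open>n\<close>; from k + 1 = 2 n on its modulus is at least \<open>n\<close>
    again.\<close>
  define B where "B t = (\<Sum>k<2*n-1. d (Suc k) * cos ((real n - real (Suc k)) * t - \<theta>))" for t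
  have "trig_poly_below n C"
    unfolding C_def[abs_def] f_def by (intro trig_poly_below_sum trig_poly_below_term) auto
  moreover have "trig_poly_below n B"
    unfolding B_def[abs_def]
  proof (rule trig_poly_below_sum)
    fix k assume k: "k \<in> {..<2*n-1}"
    show "trig_poly_below n (\<lambda>t. d (Suc k) * cos ((real n - real (Suc k)) * t - \<theta>))"
    proof (cases "Suc k \<le> n")
      case True
      then have "real (n - Suc k) = real n - real (Suc k)" by (rule of_nat_diff)
      moreover have "n - Suc k < n" using n by simp
      ultimately show ?thesis using trig_poly_below_term[of "n - Suc k" n "d (Suc k)" \<theta>] by (simp only:)
    next
      case False
      then have *: "real n - real (Suc k) = - real (Suc k - n)" by (simp add: of_nat_diff)
      have "cos ((real n - real (Suc k)) * t - \<theta>) = cos (real (Suc k - n) * t - (- \<theta>))" for t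
        unfolding * using cos_minus[of "real (Suc k - n) * t + \<theta>"] by simp
      moreover have "Suc k - n < n" using k n by auto
      ultimately show ?thesis using trig_poly_below_term[of "Suc k - n" n "d (Suc k)" "- \<theta>"] by (simp only:)
    qed
  qed
  ultimately show "trig_poly_below n (\<lambda>t. C t - B t)" by (rule trig_poly_below_diff)
  fix t
  have c0: "c k = 0" if "n - 1 + Q < k" for k
    using that c[of k] d[of "k - n"] d[of "k + n"] by (simp add: Q_def)
  have 1: "cosine_series c \<theta> t = C t + (\<Sum>i<Q. c (n + i) * f (n + i) t)"
  proof -
    have "cosine_series c \<theta> t = (\<Sum>k<n - 1 + Q. c (Suc k) * cos (real (Suc k) * t - \<theta>))"
      by (rule cosine_series_finite) (rule c0)
    then show ?thesis unfolding sum_lessThan_add C_def f_def using n by simp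
  qed
  \<comment> \<open>The frequency n - (2 n + i) is the negative of n + i. Evenness of the cosine
    replaces the phase -\<theta> by \<theta>, a change of 2 \<theta>, which for sin (2 \<theta>) = 0
    only costs the factor cos (2 \<theta>).\<close>
  have fold: "cos ((real n - real (Suc (2 * n - 1 + i))) * t - \<theta>) = cos (2 * \<theta>) * f (n + i) t" for i
  proof -
    have "(real n - real (Suc (2 * n - 1 + i))) * t - \<theta> = - ((real (n + i) * t - \<theta>) + 2 * \<theta>)"
      using n by (simp add: algebra_simps of_nat_diff)
    then have "cos ((real n - real (Suc (2 * n - 1 + i))) * t - \<theta>) = cos ((real (n + i) * t - \<theta>) + 2 * \<theta>)"
      by (simp only: cos_minus)
    also have "\<dots> = cos (2 * \<theta>) * f (n + i) t"
      unfolding cos_add[of _ "2 * \<theta>"] \<theta> f_def by (simp add: mult.commute)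
    finally show ?thesis .
  qed
  define M where "M = 2 * n - 1 + Q"
  have M: "2 * n + L = M" using n by (simp add: M_def Q_def)
  have "cos (real n * t - \<theta>) * (d 0 + 2 * (\<Sum>k<M. d (Suc k) * cos (real (Suc k) * t)))
      = d 0 * f n t + (\<Sum>k<M. d (Suc k) * (2 * cos (real n * t - \<theta>) * cos (real (Suc k) * t)))"
    by (simp add: f_def algebra_simps sum_distrib_left del: of_nat_Suc)
  also have "\<dots> = d 0 * f n t + (\<Sum>k<M. d (Suc k) * f (n + Suc k) t + d (Suc k) * cos ((real n - real (Suc k)) * t - \<theta>))"
  proof -
    have "2 * cos (real n * t - \<theta>) * cos (real (Suc k) * t) = f (n + Suc k) t + cos ((real n - real (Suc k)) * t - \<theta>)" for k
      using cos_add[of "real n * t - \<theta>" "real (Suc k) * t"] cos_diff[of "real n * t - \<theta>" "real (Suc k) * t"]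
      by (simp add: f_def algebra_simps)
    then show ?thesis by (simp only: distrib_left)
  qed
  also have "\<dots> = (\<Sum>i<Suc M. d i * f (n + i) t) + (\<Sum>k<M. d (Suc k) * cos ((real n - real (Suc k)) * t - \<theta>))"
    unfolding sum.lessThan_Suc_shift sum.distrib by simp
  also have "(\<Sum>i<Suc M. d i * f (n + i) t) = (\<Sum>i<Q. d i * f (n + i) t)"
    by (rule sum.mono_neutral_right) (auto simp: M_def Q_def d)
  also have "(\<Sum>k<M. d (Suc k) * cos ((real n - real (Suc k)) * t - \<theta>)) = B t + (\<Sum>i<Q. d (2 * n + i) * (cos (2 * \<theta>) * f (n + i) t))"
    unfolding M_def sum_lessThan_add fold B_def using n by simp
  also have "(\<Sum>i<Q. d i * f (n + i) t) + (B t + (\<Sum>i<Q. d (2 * n + i) * (cos (2 * \<theta>) * f (n + i) t)))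
      = B t + (\<Sum>i<Q. c (n + i) * f (n + i) t)"
  proof -
    have "c (n + i) * f (n + i) t = d i * f (n + i) t + d (2 * n + i) * (cos (2 * \<theta>) * f (n + i) t)" for i
    proof -
      have "n + i + n = 2 * n + i" by simp
      then have "c (n + i) = d i + cos (2 * \<theta>) * d (2 * n + i)" using c[OF le_add1[of n i]] by (simp only: add_diff_cancel_left')
      then show ?thesis by (simp only: distrib_right mult.assoc mult.left_commute)
    qed
    then show ?thesis by (simp add: sum.distrib)
  qed
  finally show "cosine_series c \<theta> t - (C t - B t)
      = cos (real n * t - \<theta>) * (d 0 + 2 * (\<Sum>k<2 * n + L. d (Suc k) * cos (real (Suc k) * t)))"
    unfolding M 1 by simp
qed

lemma cosine_series_factorization_nonneg:
  fixes c d :: "nat \<Rightarrow> real"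
  assumes n: "n \<ge> 1" and \<theta>: "sin (2 * \<theta>) = 0" and d: "\<And>k. L \<le> k \<Longrightarrow> d k = 0"
    and c: "\<And>m. n \<le> m \<Longrightarrow> c m = d (m - n) + cos (2 * \<theta>) * d (m + n)"
    and conv: "\<And>k. 2 * d (Suc k) \<le> d k + d (Suc (Suc k))"
  obtains b D where "trig_poly_below n b" "\<And>t. cosine_series c \<theta> t - b t = cos (real n * t - \<theta>) * D t"
    "\<And>t. cos t \<noteq> 1 \<Longrightarrow> 0 \<le> D t"
proof -
  obtain b where b: "trig_poly_below n b"
    "\<And>t. cosine_series c \<theta> t - b t = cos (real n * t - \<theta>) * (d 0 + 2 * (\<Sum>k<2 * n + L. d (Suc k) * cos (real (Suc k) * t)))"
    by (rule cosine_series_factorization[where n = n and \<theta> = \<theta> and L = L and d = d and c = c, OF n \<theta>]) (rule d c that; assumption)+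
  have d': "d k = 0" if "2 * n + L \<le> k" for k using d that by simp
  show ?thesis
    by (rule that[OF b]) (rule convex_cosine_sum_nonneg[where d = d, OF d' conv])
qed

text \<open>With cos (2 \<theta>) = -1 the relation for \<open>d\<close> is a difference equation of
  step 2 n, which the sum of \<open>c\<close> along the progression solves by telescoping. Convexity
  passes to \<open>d\<close> term by term.\<close>

lemma odd_factorization:
  fixes c :: "nat \<Rightarrow> real"
  assumes n: "n \<ge> 1" and \<theta>: "sin (2 * \<theta>) = 0" "cos (2 * \<theta>) = -1" and supp: "\<And>k. N < k \<Longrightarrow> c k = 0"
    and conv: "\<And>k. k \<ge> 1 \<Longrightarrow> 2 * c (Suc k) \<le> c k + c (Suc (Suc k))"
  obtains b D where "trig_poly_below n b" "\<And>t. cosine_series c \<theta> t - b t = cos (real n * t - \<theta>) * D t"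
    "\<And>t. cos t \<noteq> 1 \<Longrightarrow> 0 \<le> D t"
proof -
  define d where "d k = (\<Sum>i<Suc N. c (n + k + 2 * n * i))" for k
  \<comment> \<open>Since n \<ge> 1, N steps of length 2 n lead beyond the support, so
    \<open>Suc N\<close> terms contain the whole sum.\<close>
  have big: "N < n + k + 2 * n * N" for k
  proof -
    have "1 * N \<le> (2 * n) * N" using n by (intro mult_right_mono) auto
    then show ?thesis using n by linarith
  qed
  have d0: "d k = 0" if "Suc N \<le> k" for k
    unfolding d_def by (rule sum.neutral) (use that supp in auto)
  have cd: "c m = d (m - n) + cos (2 * \<theta>) * d (m + n)" if m: "n \<le> m" for m
  proof -
    have "d (m - n) - d (m + n) = (\<Sum>i<Suc N. c (m + 2 * n * i) - c (m + 2 * n * Suc i))"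
      unfolding d_def sum_subtractf using m by (simp add: algebra_simps)
    also have "\<dots> = c m - c (m + 2 * n * Suc N)"
      using sum_lessThan_telescope'[of "\<lambda>i. c (m + 2 * n * i)" "Suc N"] by simp
    also have "c (m + 2 * n * Suc N) = 0"
      using big[of "m + n"] by (intro supp) (simp add: algebra_simps)
    finally show ?thesis unfolding \<theta>(2) by simp
  qed
  \<comment> \<open>All indices that occur are at least n \<ge> 1, where convexity of
    \<open>c\<close> is assumed.\<close>
  have dc: "2 * d (Suc k) \<le> d k + d (Suc (Suc k))" for k
    unfolding d_def sum_distrib_left sum.distrib[symmetric]
  proof (rule sum_mono)
    fix i
    show "2 * c (n + Suc k + 2 * n * i) \<le> c (n + k + 2 * n * i) + c (n + Suc (Suc k) + 2 * n * i)"
      using conv[of "n + k + 2 * n * i"] n by simp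
  qed
  show ?thesis
    by (rule cosine_series_factorization_nonneg[where c = c and d = d and L = "Suc N", OF n \<theta>(1)])
      (rule d0 cd dc that; assumption?)+
qed

section \<open>From finitely many coefficients to the kernel itself\<close>

lemma mult_sgn_eq_abs:
  fixes x D :: real
  assumes "0 \<le> D"
  shows "(x * D) * sgn x = \<bar>x * D\<bar>"
  using assms by (simp add: abs_mult sgn_if)

lemma AE_period_cos_not_one: "AE t in period. cos t \<noteq> 1"
  using AE_period_nonzero
proof eventually_elim
  case (elim t)
  show ?case
  proof
    assume "cos t = 1"
    then have "cos \<bar>t\<bar> = 1" by simp
    moreover have "cos \<bar>t\<bar> < cos 0" using elim by (intro cos_monotone_0_pi) auto
    ultimately show False by simp
  qed
qed

text \<open>\<open>v\<close> and \<open>a\<close> differ in degrees below \<open>n\<close> only,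
  which the polynomial \<open>T\<close> absorbs, and \<open>aj j\<close> is close to
  \<open>a\<close> in the mean. For \<open>aj j\<close> the agreement of signs makes the distance to
  \<open>b\<close> equal to the integral against the square wave, to which \<open>b\<close>
  contributes 0 by orthogonality.\<close>

lemma near_best_approximation:
  assumes n: "n \<ge> 1" and aj: "\<And>j. dominated_decreasing C \<rho> (aj j)"
    and lim: "\<And>k. (\<lambda>j. aj j (Suc k)) \<longlonglongrightarrow> a (Suc k)"
    and \<rho>: "0 < \<rho>" "\<rho> < 1"
    and v: "dominated_decreasing C' \<rho> v" and va: "\<And>k. n \<le> k \<Longrightarrow> v k = a k"
    and sign: "\<And>j. \<exists>b. trig_poly_below n b \<and>
      (AE t in period. (cosine_series (aj j) \<theta> t - b t) * square_wave n \<theta> t = \<bar>cosine_series (aj j) \<theta> t - b t\<bar>)"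
    and e: "e > 0"
  shows "\<exists>b. trig_poly_below n b \<and> (\<integral>t. \<bar>cosine_series v \<theta> t - b t\<bar> \<partial>period)
      \<le> (\<integral>t. cosine_series v \<theta> t * square_wave n \<theta> t \<partial>period) + e"
proof -
  let ?s = "square_wave n \<theta>" and ?V = "cosine_series v \<theta>" and ?A = "cosine_series a \<theta>"
  let ?Aj = "\<lambda>j. cosine_series (aj j) \<theta>"
  have a: "dominated_decreasing C \<rho> a" by (rule dominated_decreasing_limit[OF aj lim \<rho>])
  have sm: "?s \<in> borel_measurable period" by (rule borel_measurable_period(1)[OF square_wave_measurable])
  have Vi: "integrable period ?V" and Ai: "integrable period ?A" and Aji: "integrable period (?Aj j)" for j
    using integrable_cosine_series[OF v \<rho>] integrable_cosine_series[OF a \<rho>] integrable_cosine_series[OF aj \<rho>] by auto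
  define T where "T t = (\<Sum>k<n-1. (v (Suc k) - a (Suc k)) * cos (real (Suc k) * t - \<theta>))" for t
  have T: "trig_poly_below n T"
    unfolding T_def[abs_def] by (intro trig_poly_below_sum trig_poly_below_term) auto
  have VAT: "AE t in period. ?V t = ?A t + T t"
    using AE_period_nonzero
  proof eventually_elim
    case (elim t)
    let ?f = "\<lambda>k. v (Suc k) * cos (real (Suc k) * t - \<theta>)" and ?g = "\<lambda>k. a (Suc k) * cos (real (Suc k) * t - \<theta>)"
    have "summable ?f" "summable ?g"
      using cosine_series_summable[OF v _ _ \<rho>] cosine_series_summable[OF a _ _ \<rho>] elim by auto
    then have "?V t - ?A t = (\<Sum>k. ?f k - ?g k)" unfolding cosine_series_def by (rule suminf_diff)
    also have "\<dots> = (\<Sum>k<n-1. ?f k - ?g k)"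
      by (rule suminf_finite) (use va in auto)
    also have "\<dots> = T t" unfolding T_def by (simp only: left_diff_distrib)
    finally show ?case by simp
  qed
  \<comment> \<open>The distance between \<open>aj j\<close> and \<open>a\<close> enters twice, once
    in the norm and once in the integral against the square wave, hence e / 2.\<close>
  have "eventually (\<lambda>j. (\<integral>t. \<bar>?Aj j t - ?A t\<bar> \<partial>period) < e / 2) sequentially"
    using cosine_series_L1_limit[OF aj lim \<rho>, of \<theta>] e by (intro order_tendstoD) auto
  then obtain j where j: "(\<integral>t. \<bar>?Aj j t - ?A t\<bar> \<partial>period) < e / 2"
    by (auto simp: eventually_sequentially)
  obtain b where b: "trig_poly_below n b" and bs: "AE t in period. (?Aj j t - b t) * ?s t = \<bar>?Aj j t - b t\<bar>"
    using sign by blast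
  have bi: "integrable period b" and Ti: "integrable period T"
    using trig_poly_below_integrable b T by auto
  have times_s: "integrable period f \<Longrightarrow> integrable period (\<lambda>t. f t * ?s t)" for f
    by (rule integrable_mult_bounded[OF _ sm square_wave_bounded])
  have d: "integrable period (\<lambda>t. ?Aj j t - ?A t)" using Aji Ai by simp
  have "(\<integral>t. \<bar>?V t - (b t + T t)\<bar> \<partial>period) \<le> (\<integral>t. \<bar>?Aj j t - ?A t\<bar> + \<bar>?Aj j t - b t\<bar> \<partial>period)"
  proof (rule integral_mono_AE)
    show "AE t in period. \<bar>?V t - (b t + T t)\<bar> \<le> \<bar>?Aj j t - ?A t\<bar> + \<bar>?Aj j t - b t\<bar>"
      using VAT by eventually_elim linarith
  qed (use Vi bi Ti Aji Ai in auto)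
  also have "\<dots> = (\<integral>t. \<bar>?Aj j t - ?A t\<bar> \<partial>period) + (\<integral>t. \<bar>?Aj j t - b t\<bar> \<partial>period)"
    using Aji Ai bi by (intro Bochner_Integration.integral_add integrable_abs Bochner_Integration.integrable_diff)
  also have "(\<integral>t. \<bar>?Aj j t - b t\<bar> \<partial>period) = (\<integral>t. (?Aj j t - b t) * ?s t \<partial>period)"
  proof (rule integral_cong_AE)
    show "AE t in period. \<bar>?Aj j t - b t\<bar> = (?Aj j t - b t) * ?s t" using bs by eventually_elim simp
    show "(\<lambda>t. \<bar>?Aj j t - b t\<bar>) \<in> borel_measurable period"
      using Aji bi by (intro borel_measurable_integrable integrable_abs Bochner_Integration.integrable_diff)
    show "(\<lambda>t. (?Aj j t - b t) * ?s t) \<in> borel_measurable period"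
      using Aji bi by (intro borel_measurable_integrable times_s Bochner_Integration.integrable_diff)
  qed
  also have "\<dots> = (\<integral>t. ?A t * ?s t \<partial>period) + (\<integral>t. (?Aj j t - ?A t) * ?s t \<partial>period)"
  proof -
    have "(\<integral>t. (?Aj j t - b t) * ?s t \<partial>period) = (\<integral>t. (?A t * ?s t + (?Aj j t - ?A t) * ?s t) - b t * ?s t \<partial>period)"
      by (intro Bochner_Integration.integral_cong refl) (simp add: algebra_simps)
    also have "\<dots> = (\<integral>t. ?A t * ?s t + (?Aj j t - ?A t) * ?s t \<partial>period) - (\<integral>t. b t * ?s t \<partial>period)"
      by (intro Bochner_Integration.integral_diff Bochner_Integration.integrable_add times_s Ai d bi)
    also have "\<dots> = (\<integral>t. ?A t * ?s t \<partial>period) + (\<integral>t. (?Aj j t - ?A t) * ?s t \<partial>period)"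
      using integral_trig_poly_below_square_wave(2)[OF b n]
      by (simp add: Bochner_Integration.integral_add[OF times_s[OF Ai] times_s[OF d]])
    finally show ?thesis .
  qed
  also have "(\<integral>t. (?Aj j t - ?A t) * ?s t \<partial>period) \<le> (\<integral>t. \<bar>?Aj j t - ?A t\<bar> \<partial>period)"
  proof (rule integral_mono)
    show "(?Aj j t - ?A t) * ?s t \<le> \<bar>?Aj j t - ?A t\<bar>" for t
      by (auto simp: square_wave_def sgn_if)
  qed (use times_s[OF d] d in auto)
  also have "(\<integral>t. ?A t * ?s t \<partial>period) = (\<integral>t. ?V t * ?s t \<partial>period)"
  proof -
    have "(\<integral>t. ?V t * ?s t \<partial>period) = (\<integral>t. ?A t * ?s t + T t * ?s t \<partial>period)"
    proof (rule integral_cong_AE)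
      show "AE t in period. ?V t * ?s t = ?A t * ?s t + T t * ?s t"
        using VAT by eventually_elim (simp add: distrib_right)
    qed (intro borel_measurable_integrable Bochner_Integration.integrable_add times_s Ai Ti Vi)+
    then show ?thesis
      using integral_trig_poly_below_square_wave(2)[OF T n]
      by (simp add: Bochner_Integration.integral_add[OF times_s[OF Ai] times_s[OF Ti]])
  qed
  finally have "(\<integral>t. \<bar>?V t - (b t + T t)\<bar> \<partial>period) \<le> (\<integral>t. ?V t * ?s t \<partial>period) + e"
    using j by simp
  then show ?thesis using trig_poly_below_add[OF b T] by blast
qed

lemma dominated_decreasing_LIMSEQ_zero:
  assumes "dominated_decreasing C \<rho> v" "0 < \<rho>" "\<rho> < 1"
  shows "(\<lambda>k. v (Suc k)) \<longlonglongrightarrow> 0"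
  \<comment> \<open>That lemma carries a point t with 0 < |t| \<le> pi from its context; 1 is such a
    point.\<close>
  using dominated_decreasing_tendsto_0[OF assms(1), of 1] assms(2,3) pi_gt3 by simp

lemma eventually_below_finite_support:
  fixes v :: "nat \<Rightarrow> real"
  assumes "(\<lambda>k. v (Suc k)) \<longlonglongrightarrow> 0" "\<epsilon> > 0"
  obtains N where "\<And>k. N < k \<Longrightarrow> max (v k - \<epsilon>) 0 = 0"
proof -
  have "v \<longlonglongrightarrow> 0" using assms(1) by (rule LIMSEQ_imp_Suc)
  then have "eventually (\<lambda>k. v k < \<epsilon>) sequentially" using assms(2) by (rule order_tendstoD)
  then obtain N where "\<And>k. k \<ge> N \<Longrightarrow> v k < \<epsilon>" by (auto simp: eventually_sequentially)
  then show ?thesis by (intro that[of N]) (simp add: less_imp_le)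
qed

lemma max_shift_tendsto:
  fixes y :: real
  assumes "0 \<le> y"
  shows "(\<lambda>j. max (y - inverse (real (Suc j))) 0) \<longlonglongrightarrow> y"
proof -
  have "(\<lambda>j. max (y - inverse (real (Suc j))) 0) \<longlonglongrightarrow> max (y - 0) 0"
    by (intro tendsto_intros LIMSEQ_inverse_real_of_nat)
  then show ?thesis using assms by simp
qed

lemma max_shift_convex:
  fixes x y z :: real
  assumes "2 * y \<le> x + z"
  shows "2 * max (y - \<epsilon>) 0 \<le> max (x - \<epsilon>) 0 + max (z - \<epsilon>) 0"
  using assms by (auto simp: max_def)

lemma square_wave_sign:
  assumes "\<And>t. f t = cos (real n * t - \<theta>) * D t" "\<And>t. cos t \<noteq> 1 \<Longrightarrow> 0 \<le> D t"
  shows "AE t in period. f t * square_wave n \<theta> t = \<bar>f t\<bar>"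
  using AE_period_cos_not_one
proof eventually_elim
  case (elim t)
  then show ?case
    unfolding assms(1) square_wave_def by (intro mult_sgn_eq_abs assms(2))
qed

lemma near_best_approximation_odd:
  assumes n: "n \<ge> 1" and \<theta>: "sin (2 * \<theta>) = 0" "cos (2 * \<theta>) = -1"
    and v: "dominated_decreasing C \<rho> v" and \<rho>: "0 < \<rho>" "\<rho> < 1"
    and conv: "\<And>k. k \<ge> 1 \<Longrightarrow> 2 * v (Suc k) \<le> v k + v (Suc (Suc k))" and e: "e > 0"
  shows "\<exists>b. trig_poly_below n b \<and> (\<integral>t. \<bar>cosine_series v \<theta> t - b t\<bar> \<partial>period)
      \<le> (\<integral>t. cosine_series v \<theta> t * square_wave n \<theta> t \<partial>period) + e"
proof (rule near_best_approximation[where aj = "\<lambda>j k. max (v k - inverse (real (Suc j))) 0", OF n _ _ \<rho> v _ _ e])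
  show "dominated_decreasing C \<rho> (\<lambda>k. max (v k - inverse (real (Suc j))) 0)" for j
    unfolding dominated_decreasing_def
  proof
    fix k
    have "v (Suc (Suc k)) \<le> v (Suc k)" "0 \<le> v (Suc k)" "v (Suc k) \<le> C * real (Suc k) powr - \<rho>"
      "0 \<le> inverse (real (Suc j))"
      using v by (simp_all add: dominated_decreasing_def)
    then show "max (v (Suc (Suc k)) - inverse (real (Suc j))) 0 \<le> max (v (Suc k) - inverse (real (Suc j))) 0 \<and>
        0 \<le> max (v (Suc k) - inverse (real (Suc j))) 0 \<and>
        max (v (Suc k) - inverse (real (Suc j))) 0 \<le> C * real (Suc k) powr - \<rho>"
      by linarith
  qed
  show "(\<lambda>j. max (v (Suc k) - inverse (real (Suc j))) 0) \<longlonglongrightarrow> v (Suc k)" for k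
    using v by (intro max_shift_tendsto) (simp add: dominated_decreasing_def)
  show "\<exists>b. trig_poly_below n b \<and> (AE t in period.
      (cosine_series (\<lambda>k. max (v k - inverse (real (Suc j))) 0) \<theta> t - b t) * square_wave n \<theta> t
      = \<bar>cosine_series (\<lambda>k. max (v k - inverse (real (Suc j))) 0) \<theta> t - b t\<bar>)" for j
  proof -
    define c where "c k = max (v k - inverse (real (Suc j))) 0" for k
    obtain N where N: "\<And>k. N < k \<Longrightarrow> c k = 0"
      unfolding c_def
      using eventually_below_finite_support[OF dominated_decreasing_LIMSEQ_zero[OF v \<rho>], of "inverse (real (Suc j))"] by auto
    have cc: "2 * c (Suc k) \<le> c k + c (Suc (Suc k))" if "k \<ge> 1" for k
      unfolding c_def by (rule max_shift_convex[OF conv[OF that]])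
    obtain b D where "trig_poly_below n b" "\<And>t. cosine_series c \<theta> t - b t = cos (real n * t - \<theta>) * D t"
      "\<And>t. cos t \<noteq> 1 \<Longrightarrow> 0 \<le> D t"
      by (rule odd_factorization[where c = c and N = N and n = n and \<theta> = \<theta>, OF n \<theta>]) (rule N cc that; assumption)+
    then show ?thesis
      unfolding c_def[abs_def, symmetric] using square_wave_sign[of "\<lambda>t. cosine_series c \<theta> t - b t" n \<theta> D] by blast
  qed
qed simp

text \<open>Cutting \<open>d\<close> keeps its convexity, as a maximum of convex sequences. A cut of
  \<open>v\<close> would have to preserve decreasing second differences, and these can jump up at
  the point where the cut begins.\<close>

lemma near_best_approximation_even:
  assumes n: "n \<ge> 1" and \<theta>: "sin (2 * \<theta>) = 0" "cos (2 * \<theta>) = 1"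
    and v: "dominated_decreasing C \<rho> v" and \<rho>: "0 < \<rho>" "\<rho> < 1"
    and d: "\<And>k. d (Suc k) \<le> d k" "\<And>k. 0 \<le> d k" "\<And>k. d k \<le> v (n + k)"
      "\<And>k. 2 * d (Suc k) \<le> d k + d (Suc (Suc k))" "\<And>m. n \<le> m \<Longrightarrow> v m = d (m - n) + d (m + n)" and e: "e > 0"
  shows "\<exists>b. trig_poly_below n b \<and> (\<integral>t. \<bar>cosine_series v \<theta> t - b t\<bar> \<partial>period)
      \<le> (\<integral>t. cosine_series v \<theta> t * square_wave n \<theta> t \<partial>period) + e"
proof -
  define \<delta> where "\<delta> j k = max (d k - inverse (real (Suc j))) 0" for j k
  \<comment> \<open>For m < n the subtraction on naturals gives \<open>\<delta> j 0\<close> as first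
    summand: the sequence stays decreasing there, and coefficients below \<open>n\<close> may differ
    from those of \<open>v\<close>.\<close>
  define aj where "aj j m = \<delta> j (m - n) + \<delta> j (m + n)" for j m
  have C: "0 \<le> C" using v by (auto simp: dominated_decreasing_def dest!: spec[of _ 0])
  have d_le: "d k \<le> d i" if "i \<le> k" for i k using that d(1) by (rule lift_Suc_antimono_le[rotated])
  have d_lim: "(\<lambda>k. d (Suc k)) \<longlonglongrightarrow> 0"
  proof (rule tendsto_sandwich[where f = "\<lambda>_. 0" and h = "\<lambda>k. v (Suc (k + n))"])
    show "(\<lambda>k. v (Suc (k + n))) \<longlonglongrightarrow> 0"
      using dominated_decreasing_LIMSEQ_zero[OF v \<rho>] by (rule LIMSEQ_ignore_initial_segment)
    show "eventually (\<lambda>k. d (Suc k) \<le> v (Suc (k + n))) sequentially"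
      using d(3)[of "Suc _"] by (intro always_eventually allI) (simp add: add.commute)
  qed (use d(2) in auto)
  have inv: "0 \<le> inverse (real (Suc j))" for j by simp
  have \<delta>_props: "\<delta> j (Suc k) \<le> \<delta> j k" "0 \<le> \<delta> j k" "\<delta> j k \<le> d k" for j k
    using d(1)[of k] d(2)[of k] inv[of j] unfolding \<delta>_def by linarith+
  have \<delta>_convex: "2 * \<delta> j (Suc k) \<le> \<delta> j k + \<delta> j (Suc (Suc k))" for j k
    unfolding \<delta>_def by (rule max_shift_convex[OF d(4)])
  have \<delta>_le: "\<delta> j k \<le> \<delta> j i" if "i \<le> k" for i j k
    using that \<delta>_props(1) by (rule lift_Suc_antimono_le[rotated])
  show ?thesis
  proof (rule near_best_approximation[where aj = aj and a = "\<lambda>m. d (m - n) + d (m + n)" and C = "2 * C", OF n _ _ \<rho> v _ _ e])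
    show "dominated_decreasing (2 * C) \<rho> (aj j)" for j
      unfolding dominated_decreasing_def
    proof (intro allI conjI)
      fix k
      show "aj j (Suc (Suc k)) \<le> aj j (Suc k)" unfolding aj_def by (intro add_mono \<delta>_le) auto
      show "0 \<le> aj j (Suc k)" unfolding aj_def using \<delta>_props(2) by simp
      \<comment> \<open>Each summand obeys the bound with \<open>C\<close> at frequency k + 1, hence
        the constant 2 C. If k + 1 \<le> n, the first summand has i = 0, and n + i is still at least
        k + 1.\<close>
      have one: "\<delta> j i \<le> C * real (Suc k) powr - \<rho>" if i: "Suc k \<le> n + i" for i
      proof -
        have "n + i = Suc (n + i - 1)" using n by simp
        then have "v (n + i) \<le> C * real (n + i) powr - \<rho>"
          using v unfolding dominated_decreasing_def by metis
        also have "\<dots> \<le> C * real (Suc k) powr - \<rho>"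
          using C \<rho> i by (intro mult_left_mono powr_mono2') auto
        finally show ?thesis using \<delta>_props(3)[of j i] d(3)[of i] by linarith
      qed
      show "aj j (Suc k) \<le> 2 * C * real (Suc k) powr - \<rho>"
        using one[of "Suc k - n"] one[of "Suc k + n"] unfolding aj_def by linarith
    qed
    show "(\<lambda>j. aj j (Suc k)) \<longlonglongrightarrow> d (Suc k - n) + d (Suc k + n)" for k
      unfolding aj_def \<delta>_def using d(2) by (intro tendsto_add max_shift_tendsto)
    show "v k = d (k - n) + d (k + n)" if "n \<le> k" for k using d(5) that .
    show "\<exists>b. trig_poly_below n b \<and> (AE t in period.
        (cosine_series (aj j) \<theta> t - b t) * square_wave n \<theta> t = \<bar>cosine_series (aj j) \<theta> t - b t\<bar>)" for j
    proof -
      obtain N where N: "\<And>k. N < k \<Longrightarrow> \<delta> j k = 0"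
        unfolding \<delta>_def
        using eventually_below_finite_support[OF d_lim, of "inverse (real (Suc j))"] by auto
      have supp: "\<delta> j k = 0" if "Suc N \<le> k" for k using N that by simp
      have eq: "aj j m = \<delta> j (m - n) + cos (2 * \<theta>) * \<delta> j (m + n)" if "n \<le> m" for m
        by (simp add: aj_def \<theta>(2))
      obtain b D where "trig_poly_below n b" "\<And>t. cosine_series (aj j) \<theta> t - b t = cos (real n * t - \<theta>) * D t"
        "\<And>t. cos t \<noteq> 1 \<Longrightarrow> 0 \<le> D t"
        by (rule cosine_series_factorization_nonneg[where c = "aj j" and d = "\<delta> j" and L = "Suc N" and n = n and \<theta> = \<theta>, OF n \<theta>(1)])
          (rule supp eq \<delta>_convex that; assumption?)+
      then show ?thesis
        using square_wave_sign[of "\<lambda>t. cosine_series (aj j) \<theta> t - b t" n \<theta> D] by blast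
    qed
  qed
qed

section \<open>Even phase under decreasing second differences\<close>

lemma decreasing_from_one:
  fixes x :: "nat \<Rightarrow> real"
  assumes "\<And>k. k \<ge> 1 \<Longrightarrow> x (Suc k) \<le> x k" "1 \<le> i" "i \<le> j"
  shows "x j \<le> x i"
  using assms(3)
proof (induction j rule: dec_induct)
  case (step m)
  then show ?case using assms(1)[of m] assms(2) by linarith
qed simp

text \<open>For a sequence decreasing to 0 this is the solution y of y k + y (k + 2 n) = x k with 0
  \<le> y \<le> x.\<close>

definition alternating_sum :: "nat \<Rightarrow> (nat \<Rightarrow> real) \<Rightarrow> nat \<Rightarrow> real" where
  "alternating_sum n x k = (\<Sum>i. (-1) ^ i * x (k + 2 * n * i))"

lemma alternating_sum:
  fixes x :: "nat \<Rightarrow> real"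
  assumes n: "n \<ge> 1" and k: "k \<ge> 1" and dec: "\<And>k. k \<ge> 1 \<Longrightarrow> x (Suc k) \<le> x k"
    and nonneg: "\<And>k. k \<ge> 1 \<Longrightarrow> 0 \<le> x k" and lim: "x \<longlonglongrightarrow> 0"
  shows "(\<lambda>i. (-1) ^ i * x (k + 2 * n * i)) sums alternating_sum n x k"
    and "0 \<le> alternating_sum n x k"
    and "alternating_sum n x k \<le> x k"
proof -
  define a where "a i = x (k + 2 * n * i)" for i
  have "strict_mono (\<lambda>i. k + 2 * n * i)" using n by (intro strict_monoI) simp
  then have a0: "a \<longlonglongrightarrow> 0"
    using LIMSEQ_subseq_LIMSEQ[OF lim] unfolding a_def[abs_def] comp_def by blast
  have a_pos: "0 \<le> a i" for i using nonneg k by (simp add: a_def)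
  have a_dec: "a (Suc i) \<le> a i" for i
    unfolding a_def using k by (intro decreasing_from_one[where x = x, OF dec]) auto
  note leibniz = summable_Leibniz'[OF a0 a_pos a_dec]
  show "(\<lambda>i. (-1) ^ i * x (k + 2 * n * i)) sums alternating_sum n x k"
    using leibniz(1) unfolding a_def alternating_sum_def by (rule summable_sums)
  show "0 \<le> alternating_sum n x k"
    using leibniz(2)[of 0] unfolding a_def alternating_sum_def by simp
  show "alternating_sum n x k \<le> x k"
    using leibniz(4)[of 0] unfolding a_def alternating_sum_def by simp
qed

text \<open>Alternating summation commutes with differences. By the Leibniz criterion the
  alternating sums of \<open>v\<close>, of its first differences \<open>\<Delta>\<close> and of its
  second differences \<open>E\<close> are nonnegative, as each of these sequences decreases to 0; so
  the alternating sum of \<open>v\<close> is decreasing and convex. That \<open>E\<close> decreases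
  is the assumption on third differences.\<close>

lemma near_best_approximation_third_difference:
  assumes n: "n \<ge> 1" and \<theta>: "sin (2 * \<theta>) = 0" "cos (2 * \<theta>) = 1"
    and v: "dominated_decreasing C \<rho> v" and \<rho>: "0 < \<rho>" "\<rho> < 1"
    and conv: "\<And>k. k \<ge> 1 \<Longrightarrow> 2 * v (Suc k) \<le> v k + v (Suc (Suc k))"
    and third: "\<And>k. k \<ge> 1 \<Longrightarrow> v (Suc k) - 2 * v (Suc (Suc k)) + v (Suc (Suc (Suc k))) \<le> v k - 2 * v (Suc k) + v (Suc (Suc k))"
    and e: "e > 0"
  shows "\<exists>b. trig_poly_below n b \<and> (\<integral>t. \<bar>cosine_series v \<theta> t - b t\<bar> \<partial>period)
      \<le> (\<integral>t. cosine_series v \<theta> t * square_wave n \<theta> t \<partial>period) + e"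
proof -
  define \<Delta> where "\<Delta> k = v k - v (Suc k)" for k
  define E where "E k = v k - 2 * v (Suc k) + v (Suc (Suc k))" for k
  have v0: "v \<longlonglongrightarrow> 0" by (rule LIMSEQ_imp_Suc[OF dominated_decreasing_LIMSEQ_zero[OF v \<rho>]])
  have vs: "(\<lambda>k. v (Suc k)) \<longlonglongrightarrow> 0" "(\<lambda>k. v (Suc (Suc k))) \<longlonglongrightarrow> 0"
    using v0 by (auto intro: LIMSEQ_Suc)
  have vdec: "v (Suc k) \<le> v k" and vpos: "0 \<le> v k" if "k \<ge> 1" for k
    using v that by (cases k; simp add: dominated_decreasing_def)+
  have "\<Delta> \<longlonglongrightarrow> 0 - 0" unfolding \<Delta>_def[abs_def] by (intro tendsto_intros v0 vs)
  then have \<Delta>0: "\<Delta> \<longlonglongrightarrow> 0" by simp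
  have "E \<longlonglongrightarrow> 0 - 2 * 0 + 0" unfolding E_def[abs_def] by (intro tendsto_intros v0 vs)
  then have E0: "E \<longlonglongrightarrow> 0" by simp
  have \<Delta>dec: "\<Delta> (Suc k) \<le> \<Delta> k" and \<Delta>pos: "0 \<le> \<Delta> k" if "k \<ge> 1" for k
    using conv[OF that] vdec[OF that] unfolding \<Delta>_def by linarith+
  have Edec: "E (Suc k) \<le> E k" and Epos: "0 \<le> E k" if "k \<ge> 1" for k
    using third[OF that] conv[OF that] unfolding E_def by linarith+
  note V = alternating_sum[where x = v, OF n _ vdec vpos v0]
    and D = alternating_sum[where x = \<Delta>, OF n _ \<Delta>dec \<Delta>pos \<Delta>0]
    and E = alternating_sum[where x = E, OF n _ Edec Epos E0]
  have step1: "alternating_sum n \<Delta> k = alternating_sum n v k - alternating_sum n v (Suc k)" if "k \<ge> 1" for k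
  proof -
    have "(\<lambda>i. (-1) ^ i * v (k + 2 * n * i) - (-1) ^ i * v (Suc k + 2 * n * i)) sums (alternating_sum n v k - alternating_sum n v (Suc k))"
      using that by (intro sums_diff V(1)) auto
    then have "(\<lambda>i. (-1) ^ i * \<Delta> (k + 2 * n * i)) sums (alternating_sum n v k - alternating_sum n v (Suc k))"
      by (simp add: \<Delta>_def right_diff_distrib)
    then show ?thesis using D(1)[OF that] by (metis sums_unique2)
  qed
  have step2: "alternating_sum n E k = alternating_sum n \<Delta> k - alternating_sum n \<Delta> (Suc k)" if "k \<ge> 1" for k
  proof -
    have "(\<lambda>i. (-1) ^ i * \<Delta> (k + 2 * n * i) - (-1) ^ i * \<Delta> (Suc k + 2 * n * i)) sums (alternating_sum n \<Delta> k - alternating_sum n \<Delta> (Suc k))"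
      using that by (intro sums_diff D(1)) auto
    then have "(\<lambda>i. (-1) ^ i * E (k + 2 * n * i)) sums (alternating_sum n \<Delta> k - alternating_sum n \<Delta> (Suc k))"
      by (simp add: \<Delta>_def E_def algebra_simps)
    then show ?thesis using E(1)[OF that] by (metis sums_unique2)
  qed
  \<comment> \<open>Splitting off the term i = 0 leaves minus the alternating sum that starts one
    step later.\<close>
  have fold: "v m = alternating_sum n v m + alternating_sum n v (m + 2 * n)" if "m \<ge> 1" for m
  proof -
    let ?f = "\<lambda>i. (-1) ^ i * v (m + 2 * n * i)"
    have "(\<lambda>i. ?f (Suc i)) sums (alternating_sum n v m - ?f 0)"
      using V(1)[OF that] by (subst sums_Suc_iff) simp
    then have "(\<lambda>i. - (?f (Suc i))) sums - (alternating_sum n v m - v m)"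
      by (intro sums_minus) simp
    moreover have "- (?f (Suc i)) = (-1) ^ i * v (m + 2 * n + 2 * n * i)" for i by (simp add: algebra_simps)
    ultimately have "(\<lambda>i. (-1) ^ i * v (m + 2 * n + 2 * n * i)) sums - (alternating_sum n v m - v m)" by simp
    moreover have "(\<lambda>i. (-1) ^ i * v (m + 2 * n + 2 * n * i)) sums alternating_sum n v (m + 2 * n)"
      using that by (intro V(1)) simp
    ultimately have "alternating_sum n v (m + 2 * n) = - (alternating_sum n v m - v m)" by (metis sums_unique2)
    then show ?thesis by simp
  qed
  have nk: "1 \<le> n + k" for k using n by simp
  show ?thesis
  proof (rule near_best_approximation_even[where d = "\<lambda>k. alternating_sum n v (n + k)", OF n \<theta> v \<rho> _ _ _ _ _ e])
    fix k
    show "alternating_sum n v (n + Suc k) \<le> alternating_sum n v (n + k)"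
      using step1[OF nk, of k] D(2)[OF nk, of k] by simp
    show "0 \<le> alternating_sum n v (n + k)" "alternating_sum n v (n + k) \<le> v (n + k)"
      using V(2,3)[OF nk, of k] by auto
    show "2 * alternating_sum n v (n + Suc k) \<le> alternating_sum n v (n + k) + alternating_sum n v (n + Suc (Suc k))"
      using step1[OF nk, of k] step1[OF nk, of "Suc k"] step2[OF nk, of k] E(2)[OF nk, of k] by simp
    show "v k = alternating_sum n v (n + (k - n)) + alternating_sum n v (n + (k + n))" if "n \<le> k"
      using fold[of k] that n by (simp add: mult_2 add_ac)
  qed
qed

section \<open>Even phase for \<open>n = 1\<close>\<close>

lemma trig_poly_below_1_const: "trig_poly_below (Suc 0) b \<Longrightarrow> b t = b 0"
  by (induction rule: trig_poly_below.induct) auto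

text \<open>For n = 1 only constants may be subtracted. Up to a sign the kernel is an even function
  decreasing on [0, pi], so the constant is its value at pi / 2, where the square wave changes
  sign.\<close>

lemma near_best_approximation_first_even:
  assumes \<theta>: "sin \<theta> = 0" and v: "dominated_decreasing C \<rho> v" and \<rho>: "0 < \<rho>" "\<rho> < 1"
    and dec: "\<And>k. k \<ge> 1 \<Longrightarrow> real (Suc k) * v (Suc k) \<le> real k * v k"
    and conv: "\<And>k. k \<ge> 1 \<Longrightarrow> 2 * (real (Suc k) * v (Suc k)) \<le> real k * v k + real (Suc (Suc k)) * v (Suc (Suc k))"
    and lim: "(\<lambda>k. real k * v k) \<longlonglongrightarrow> 0" and e: "e > 0"
  shows "\<exists>b. trig_poly_below (Suc 0) b \<and> (\<integral>t. \<bar>cosine_series v \<theta> t - b t\<bar> \<partial>period)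
      \<le> (\<integral>t. cosine_series v \<theta> t * square_wave (Suc 0) \<theta> t \<partial>period) + e"
proof -
  define w where "w k = real k * v k" for k
  \<comment> \<open>The cut is made on k v k, the coefficients of the differentiated kernel, whose
    convexity gives the sign; division by k returns to the kernel.\<close>
  define u where "u j k = max (w k - inverse (real (Suc j))) 0" for j k
  define aj where "aj j k = u j k / real k" for j k
  have vpos: "0 \<le> v (Suc k)" for k using v by (simp add: dominated_decreasing_def)
  have upos: "0 \<le> u j k" for j k by (simp add: u_def)
  have u_le: "u j (Suc k) \<le> w (Suc k)" for j k
    using vpos[of k] unfolding u_def w_def by simp
  show ?thesis
  proof (rule near_best_approximation[where aj = aj and a = v, OF _ _ _ \<rho> v _ _ e])
    show "dominated_decreasing C \<rho> (aj j)" for j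
      unfolding dominated_decreasing_def
    proof (intro allI conjI)
      fix k
      have "u j (Suc (Suc k)) \<le> u j (Suc k)" using dec[of "Suc k"] unfolding u_def w_def by simp
      then show "aj j (Suc (Suc k)) \<le> aj j (Suc k)" unfolding aj_def using upos by (intro frac_le) auto
      show "0 \<le> aj j (Suc k)" unfolding aj_def using upos by simp
      have "aj j (Suc k) \<le> w (Suc k) / real (Suc k)"
        unfolding aj_def using u_le by (intro divide_right_mono) auto
      also have "\<dots> = v (Suc k)" by (simp add: w_def del: of_nat_Suc)
      also have "\<dots> \<le> C * real (Suc k) powr - \<rho>" using v by (simp add: dominated_decreasing_def)
      finally show "aj j (Suc k) \<le> C * real (Suc k) powr - \<rho>" .
    qed
    show "(\<lambda>j. aj j (Suc k)) \<longlonglongrightarrow> v (Suc k)" for k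
    proof -
      have "0 \<le> w (Suc k)" using vpos by (simp add: w_def)
      then have "(\<lambda>j. u j (Suc k)) \<longlonglongrightarrow> w (Suc k)" unfolding u_def by (rule max_shift_tendsto)
      then have "(\<lambda>j. aj j (Suc k)) \<longlonglongrightarrow> w (Suc k) / real (Suc k)"
        unfolding aj_def by (intro tendsto_divide tendsto_const) auto
      then show ?thesis by (simp add: w_def del: of_nat_Suc)
    qed
    show "\<exists>b. trig_poly_below (Suc 0) b \<and> (AE t in period.
        (cosine_series (aj j) \<theta> t - b t) * square_wave (Suc 0) \<theta> t = \<bar>cosine_series (aj j) \<theta> t - b t\<bar>)" for j
    proof -
      obtain N where N: "\<And>k. N < k \<Longrightarrow> u j k = 0"
        unfolding u_def
        using eventually_below_finite_support[of w "inverse (real (Suc j))"] LIMSEQ_Suc[OF lim] by (auto simp: w_def)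
      have uc: "2 * u j (Suc k) \<le> u j k + u j (Suc (Suc k))" if "k \<ge> 1" for k
        unfolding u_def w_def by (rule max_shift_convex[OF conv[OF that]])
      have one: "Suc 0 \<ge> 1" by simp
      \<comment> \<open>The derivative is a sine series, that is a cosine series of phase pi / 2, to
        which the odd case with n = 1 applies.\<close>
      have half: "sin (2 * (pi / 2)) = 0" "cos (2 * (pi / 2)) = -1" by simp_all
      obtain b D where b: "trig_poly_below (Suc 0) b"
        and bD: "\<And>t. cosine_series (u j) (pi / 2) t - b t = cos (real (Suc 0) * t - pi / 2) * D t"
        and D: "\<And>t. cos t \<noteq> 1 \<Longrightarrow> 0 \<le> D t"
        by (rule odd_factorization[where c = "u j" and N = N and n = "Suc 0" and \<theta> = "pi / 2", OF one half])
          (rule N uc that; assumption)+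
      define U where "U t = (\<Sum>k<N. u j (Suc k) * sin (real (Suc k) * t))" for t
      have U: "cosine_series (u j) (pi / 2) t = U t" for t
      proof -
        have "cosine_series (u j) (pi / 2) t = (\<Sum>k<N. u j (Suc k) * cos (real (Suc k) * t - pi / 2))"
          by (rule cosine_series_finite) (rule N)
        then show ?thesis unfolding U_def by (simp add: cos_diff)
      qed
      \<comment> \<open>At t = 0 the sine sum and the factor cos (-pi / 2) both vanish, so the
        constant \<open>b\<close> is 0.\<close>
      have "b 0 = 0" using bD[of 0] unfolding U by (simp add: U_def)
      then have "b t = 0" for t using trig_poly_below_1_const[OF b] by simp
      then have UD: "U t = sin t * D t" for t using bD[of t] unfolding U by (simp add: cos_diff)
      have Upos: "0 \<le> U t" if "0 \<le> t" "t \<le> pi" for t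
      proof (cases "cos t = 1")
        case True
        then have "sin t = 0" using sin_cos_squared_add[of t] by simp
        then show ?thesis by (simp add: UD)
      next
        case False
        then show ?thesis unfolding UD using that by (intro mult_nonneg_nonneg D sin_ge_zero)
      qed
      define \<kappa> where "\<kappa> t = (\<Sum>k<N. aj j (Suc k) * cos (real (Suc k) * t))" for t
      have \<kappa>_deriv: "(\<kappa> has_real_derivative - U t) (at t)" for t
        unfolding \<kappa>_def[abs_def] U_def sum_negf[symmetric]
        by (rule DERIV_sum) (auto intro!: derivative_eq_intros simp: aj_def simp del: of_nat_Suc)
      have \<kappa>_dec: "\<kappa> y \<le> \<kappa> x" if "0 \<le> x" "x \<le> y" "y \<le> pi" for x y
      proof (rule DERIV_nonpos_imp_nonincreasing[OF that(2)])
        fix z assume "x \<le> z" "z \<le> y"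
        then have "0 \<le> U z" using that by (intro Upos) auto
        then show "\<exists>D. (\<kappa> has_real_derivative D) (at z) \<and> D \<le> 0" using \<kappa>_deriv by (intro exI[of _ "- U z"]) simp
      qed
      have \<kappa>_even: "\<kappa> \<bar>t\<bar> = \<kappa> t" for t
      proof -
        have "cos (real (Suc k) * \<bar>t\<bar>) = cos (real (Suc k) * t)" for k
          by (cases "0 \<le> t") (simp_all del: of_nat_Suc)
        then show ?thesis by (simp only: \<kappa>_def)
      qed
      have ser: "cosine_series (aj j) \<theta> t = cos \<theta> * \<kappa> t" for t
      proof -
        have "cosine_series (aj j) \<theta> t = (\<Sum>k<N. aj j (Suc k) * cos (real (Suc k) * t - \<theta>))"
          by (rule cosine_series_finite) (simp add: aj_def N)
        then show ?thesis unfolding \<kappa>_def cos_diff \<theta> by (simp add: sum_distrib_left mult_ac del: of_nat_Suc)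
      qed
      define b' where "b' = (\<lambda>t::real. cos \<theta> * \<kappa> (pi / 2))"
      have b': "trig_poly_below (Suc 0) b'"
        using trig_poly_below_term[of 0 "Suc 0" "cos \<theta> * \<kappa> (pi / 2)" 0] by (simp add: b'_def)
      have "AE t in period. (cosine_series (aj j) \<theta> t - b' t) * square_wave (Suc 0) \<theta> t = \<bar>cosine_series (aj j) \<theta> t - b' t\<bar>"
        using AE_period_nonzero
      proof eventually_elim
        case (elim t)
        \<comment> \<open>The value 1 or -1 of cos \<theta> is a sign common to the kernel and the
          square wave; it cancels in their product.\<close>
        have c2: "cos \<theta> = 1 \<or> cos \<theta> = -1" using sin_cos_squared_add[of \<theta>] \<theta> by (simp add: power2_eq_1_iff)
        have ct: "cos t = cos \<bar>t\<bar>" by simp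
        have sgn: "(\<kappa> t - \<kappa> (pi / 2)) * sgn (cos t) = \<bar>\<kappa> t - \<kappa> (pi / 2)\<bar>"
        proof (cases "\<bar>t\<bar>" "pi / 2" rule: linorder_cases)
          case less
          then have "0 < cos t" unfolding ct by (intro cos_gt_zero_pi) auto
          moreover have "\<kappa> (pi / 2) \<le> \<kappa> t" using \<kappa>_dec[of "\<bar>t\<bar>" "pi / 2"] less by (simp add: \<kappa>_even)
          ultimately show ?thesis by simp
        next
          case equal
          have "\<kappa> t = \<kappa> (pi / 2)" using \<kappa>_even[of t] unfolding equal by simp
          then show ?thesis by simp
        next
          case greater
          have "cos \<bar>t\<bar> < cos (pi / 2)" using greater elim by (intro cos_monotone_0_pi) auto
          then have "cos t < 0" by simp
          moreover have "\<kappa> t \<le> \<kappa> (pi / 2)" using \<kappa>_dec[of "pi / 2" "\<bar>t\<bar>"] greater elim by (simp add: \<kappa>_even)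
          ultimately show ?thesis by simp
        qed
        have sw: "square_wave (Suc 0) \<theta> t = cos \<theta> * sgn (cos t)"
          using c2 by (auto simp: square_wave_def cos_diff \<theta> sgn_minus)
        have "(cosine_series (aj j) \<theta> t - b' t) * square_wave (Suc 0) \<theta> t = (cos \<theta> * cos \<theta>) * ((\<kappa> t - \<kappa> (pi / 2)) * sgn (cos t))"
          unfolding ser b'_def sw by (simp add: algebra_simps)
        also have "\<dots> = \<bar>\<kappa> t - \<kappa> (pi / 2)\<bar>" unfolding sgn using c2 by auto
        also have "\<dots> = \<bar>cosine_series (aj j) \<theta> t - b' t\<bar>"
          unfolding ser b'_def right_diff_distrib[symmetric] abs_mult using c2 by auto
        finally show ?case .
      qed
      then show ?thesis using b' by blast
    qed
  qed simp_all
qed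

section \<open>Decreasing convex functions\<close>

text \<open>Nonnegativity is part of the notion so that the class is closed under products.\<close>

definition decreasing_convex :: "(real \<Rightarrow> real) \<Rightarrow> bool" where
  "decreasing_convex f \<longleftrightarrow> convex_on {0<..} f \<and> (\<forall>x>0. \<forall>y\<ge>x. f y \<le> f x) \<and> (\<forall>x>0. 0 \<le> f x)"

lemma decreasing_convexD:
  assumes "decreasing_convex f" "0 < x"
  shows "x \<le> y \<Longrightarrow> f y \<le> f x" "0 \<le> f x" "convex_on {0<..} f"
  using assms by (auto simp: decreasing_convex_def)

lemma convex_on_positiveD:
  fixes f :: "real \<Rightarrow> real"
  assumes "convex_on {0<..} f" "0 < x" "0 < y" "0 \<le> t" "t \<le> 1"
  shows "f ((1 - t) * x + t * y) \<le> (1 - t) * f x + t * f y"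
  using convex_onD[OF assms(1,4,5), of x y] assms(2,3) by simp

lemma convex_on_positiveI:
  fixes f :: "real \<Rightarrow> real"
  assumes "\<And>t x y. \<lbrakk>0 < t; t < 1; 0 < x; 0 < y\<rbrakk> \<Longrightarrow> f ((1 - t) * x + t * y) \<le> (1 - t) * f x + t * f y"
  shows "convex_on {0<..} f"
  by (rule convex_onI) (use assms in auto)

lemma convex_combination_positive:
  fixes x y t :: real
  assumes "0 < x" "0 < y" "0 < t" "t < 1"
  shows "0 < (1 - t) * x + t * y"
  using assms by (intro add_pos_pos mult_pos_pos) auto

text \<open>Expanding the product of the two convexity bounds leaves the correction -t (1 - t) (f x
  - f y) (g x - g y), which is nonpositive because both functions decrease.\<close>

lemma decreasing_convex_mult:
  assumes f: "decreasing_convex f" and g: "decreasing_convex g"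
  shows "decreasing_convex (\<lambda>x. f x * g x)"
  unfolding decreasing_convex_def
proof (intro conjI allI impI)
  show "f y * g y \<le> f x * g x" if "0 < x" "x \<le> y" for x y
    using that decreasing_convexD[OF f, of x] decreasing_convexD[OF g, of x] decreasing_convexD[OF f, of y] decreasing_convexD[OF g, of y]
    by (intro mult_mono) auto
  show "0 \<le> f x * g x" if "0 < x" for x
    using that decreasing_convexD[OF f] decreasing_convexD[OF g] by simp
  show "convex_on {0<..} (\<lambda>x. f x * g x)"
  proof (rule convex_on_positiveI)
    fix t x y :: real assume t: "0 < t" "t < 1" and xy: "0 < x" "0 < y"
    define z where "z = (1 - t) * x + t * y"
    have z: "0 < z" unfolding z_def using xy t by (rule convex_combination_positive)
    have fz: "f z \<le> (1 - t) * f x + t * f y" and gz: "g z \<le> (1 - t) * g x + t * g y"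
      unfolding z_def using convex_on_positiveD decreasing_convexD(3)[OF f xy(1)] decreasing_convexD(3)[OF g xy(1)] xy t by auto
    have "f z * g z \<le> ((1 - t) * f x + t * f y) * ((1 - t) * g x + t * g y)"
      using fz gz decreasing_convexD(2)[OF f z] decreasing_convexD(2)[OF g z] by (intro mult_mono) auto
    also have "\<dots> = (1 - t) * (f x * g x) + t * (f y * g y) - t * (1 - t) * ((f x - f y) * (g x - g y))"
      by (simp add: algebra_simps)
    also have "\<dots> \<le> (1 - t) * (f x * g x) + t * (f y * g y)"
    proof -
      have "0 \<le> (f x - f y) * (g x - g y)"
      proof (cases "x \<le> y")
        case True
        then show ?thesis using decreasing_convexD(1)[OF f xy(1)] decreasing_convexD(1)[OF g xy(1)] by (intro mult_nonneg_nonneg) auto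
      next
        case False
        then show ?thesis using decreasing_convexD(1)[OF f xy(2), of x] decreasing_convexD(1)[OF g xy(2), of x] by (intro mult_nonpos_nonpos) auto
      qed
      moreover have "0 \<le> t * (1 - t)" using t by simp
      ultimately have "0 \<le> t * (1 - t) * ((f x - f y) * (g x - g y))" by (rule mult_nonneg_nonneg[rotated])
      then show ?thesis by simp
    qed
    finally show "f ((1 - t) * x + t * y) * g ((1 - t) * x + t * y) \<le> (1 - t) * (f x * g x) + t * (f y * g y)"
      unfolding z_def .
  qed
qed

lemma decreasing_convex_add:
  assumes f: "decreasing_convex f" and g: "decreasing_convex g"
  shows "decreasing_convex (\<lambda>x. f x + g x)"
  using assms by (auto simp: decreasing_convex_def intro: convex_on_add add_mono add_nonneg_nonneg)

lemma decreasing_convex_const: "0 \<le> c \<Longrightarrow> decreasing_convex (\<lambda>_. c)"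
  by (auto simp: decreasing_convex_def intro: convex_on_positiveI simp: algebra_simps)

lemma decreasing_convex_powr:
  assumes "0 \<le> s"
  shows "decreasing_convex (\<lambda>x. x powr - s)"
  unfolding decreasing_convex_def
proof (intro conjI allI impI)
  show "y powr - s \<le> x powr - s" if "0 < x" "x \<le> y" for x y :: real
    using that assms by (intro powr_mono2') auto
  show "convex_on {0<..} (\<lambda>x::real. x powr - s)"
  proof (rule convex_on_realI[where f' = "\<lambda>x. - s * x powr (- s - 1)"])
    show "((\<lambda>x. x powr - s) has_real_derivative - s * x powr (- s - 1)) (at x)" if "x \<in> {0<..}" for x :: real
      using that by (auto intro!: derivative_eq_intros)
    show "- s * x powr (- s - 1) \<le> - s * y powr (- s - 1)" if "x \<in> {0<..}" "y \<in> {0<..}" "x \<le> y" for x y :: real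
      using that assms by (auto intro!: mult_left_mono powr_mono2')
  qed simp
qed simp

text \<open>By concavity, where \<alpha> \<le> 1 enters, the inner function lies above its chord;
  the decreasing \<open>f\<close> reverses this inequality and its convexity concludes.\<close>

lemma decreasing_convex_compose_powr:
  assumes f: "decreasing_convex f" and \<alpha>: "0 < \<alpha>" "\<alpha> \<le> 1" and \<delta>: "0 < \<delta>"
  shows "decreasing_convex (\<lambda>x. f (\<delta> * x powr \<alpha>))"
  unfolding decreasing_convex_def
proof (intro conjI allI impI)
  show "f (\<delta> * y powr \<alpha>) \<le> f (\<delta> * x powr \<alpha>)" if "0 < x" "x \<le> y" for x y
    using that \<alpha> \<delta> by (intro decreasing_convexD(1)[OF f] mult_left_mono powr_mono2) auto
  show "0 \<le> f (\<delta> * x powr \<alpha>)" if "0 < x" for x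
    using that \<delta> by (intro decreasing_convexD(2)[OF f]) auto
  show "convex_on {0<..} (\<lambda>x. f (\<delta> * x powr \<alpha>))"
  proof (rule convex_on_positiveI)
    fix t x y :: real assume t: "0 < t" "t < 1" and xy: "0 < x" "0 < y"
    define X Y where "X = \<delta> * x powr \<alpha>" and "Y = \<delta> * y powr \<alpha>"
    have XY: "0 < X" "0 < Y" using xy \<delta> by (auto simp: X_def Y_def)
    have "convex_on {0<..} (\<lambda>x::real. - (x powr \<alpha>))"
    proof (rule convex_on_realI[where f' = "\<lambda>x. - (\<alpha> * x powr (\<alpha> - 1))"])
      show "((\<lambda>x. - (x powr \<alpha>)) has_real_derivative - (\<alpha> * x powr (\<alpha> - 1))) (at x)" if "x \<in> {0<..}" for x :: real
        using that by (auto intro!: derivative_eq_intros)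
      show "- (\<alpha> * x powr (\<alpha> - 1)) \<le> - (\<alpha> * y powr (\<alpha> - 1))" if "x \<in> {0<..}" "y \<in> {0<..}" "x \<le> y" for x y :: real
        using that \<alpha> by (auto intro!: mult_left_mono powr_mono2')
    qed simp
    from convex_on_positiveD[OF this xy, of t] t
    have "(1 - t) * x powr \<alpha> + t * y powr \<alpha> \<le> ((1 - t) * x + t * y) powr \<alpha>" by simp
    then have "\<delta> * ((1 - t) * x powr \<alpha> + t * y powr \<alpha>) \<le> \<delta> * ((1 - t) * x + t * y) powr \<alpha>"
      using \<delta> by (intro mult_left_mono) auto
    then have le: "(1 - t) * X + t * Y \<le> \<delta> * ((1 - t) * x + t * y) powr \<alpha>"
      by (simp add: X_def Y_def algebra_simps)
    have "f (\<delta> * ((1 - t) * x + t * y) powr \<alpha>) \<le> f ((1 - t) * X + t * Y)"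
      by (rule decreasing_convexD(1)[OF f convex_combination_positive[OF XY t] le])
    also have "\<dots> \<le> (1 - t) * f X + t * f Y"
      using convex_on_positiveD[OF decreasing_convexD(3)[OF f XY(1)] XY, of t] t by simp
    finally show "f (\<delta> * ((1 - t) * x + t * y) powr \<alpha>) \<le> (1 - t) * f (\<delta> * x powr \<alpha>) + t * f (\<delta> * y powr \<alpha>)"
      by (simp add: X_def Y_def)
  qed
qed

lemma convex_on_midpoint:
  fixes f :: "real \<Rightarrow> real"
  assumes "convex_on {0<..} f" "0 < x"
  shows "2 * f (x + 1) \<le> f x + f (x + 2)"
proof -
  have "(1 - 1 / 2) * x + 1 / 2 * (x + 2) = x + 1" by (simp add: field_simps)
  then show ?thesis
    using convex_on_positiveD[OF assms(1) assms(2), of "x + 2" "1/2"] assms(2) by simp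
qed

text \<open>A rise between two points would by convexity force at least linear growth beyond them,
  against the limit along \<open>X\<close>. Nonnegativity then follows from the limit by
  monotonicity.\<close>

lemma decreasing_convex_of_limit:
  fixes f :: "real \<Rightarrow> real"
  assumes f: "convex_on {0<..} f" and X: "filterlim X at_top sequentially" and lim: "(\<lambda>k. f (X k)) \<longlonglongrightarrow> 0"
  shows "decreasing_convex f"
proof -
  have dec: "f y \<le> f x" if xy: "0 < x" "x \<le> y" for x y
  proof (rule ccontr)
    assume "\<not> f y \<le> f x"
    then have gt: "f x < f y" and lt: "x < y" using xy by (auto simp: less_le)
    define s where "s = (f y - f x) / (y - x)"
    have s: "0 < s" using gt lt by (simp add: s_def)
    have low: "f y + s * (z - y) \<le> f z" if "y < z" for z
    proof -
      have a: "(f x - f y) / (x - y) \<le> (f x - f z) / (x - z)" and b: "(f x - f z) / (x - z) \<le> (f y - f z) / (y - z)"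
        using convex_on_slope_le[OF f, of x z y] xy lt that by auto
      have "s = (f x - f y) / (x - y)" unfolding s_def by (metis minus_diff_eq minus_divide_divide)
      then have "s \<le> (f y - f z) / (y - z)" using a b by linarith
      also have "\<dots> = (f z - f y) / (z - y)" by (metis minus_diff_eq minus_divide_divide)
      finally show ?thesis using that by (simp add: field_simps)
    qed
    \<comment> \<open>Beyond this threshold the line of slope s through (y, f y) exceeds f y + 1 +
      |f y|, hence 1.\<close>
    have "eventually (\<lambda>k. X k > y + (1 + \<bar>f y\<bar>) / s) sequentially"
      using X by (simp add: filterlim_at_top_dense)
    moreover have "eventually (\<lambda>k. f (X k) < 1) sequentially"
      using lim by (rule order_tendstoD) simp
    ultimately have "eventually (\<lambda>k. False) sequentially"
    proof eventually_elim
      case (elim k)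
      have "0 \<le> (1 + \<bar>f y\<bar>) / s" using s by simp
      then have "y < X k" using elim(1) by linarith
      from low[OF this] have "f y + s * (X k - y) \<le> f (X k)" .
      moreover have "1 + \<bar>f y\<bar> < s * (X k - y)"
      proof -
        have "(1 + \<bar>f y\<bar>) / s < X k - y" using elim(1) by linarith
        then show ?thesis using s by (simp add: pos_divide_less_eq mult.commute)
      qed
      ultimately show ?case using elim(2) by linarith
    qed
    then show False by simp
  qed
  have "0 \<le> f x" if "0 < x" for x
  proof (rule LIMSEQ_le_const2[OF lim])
    have "eventually (\<lambda>k. X k > x) sequentially" using X by (simp add: filterlim_at_top_dense)
    then have "eventually (\<lambda>k. f (X k) \<le> f x) sequentially"
      by (rule eventually_mono) (rule dec[OF that less_imp_le])
    then show "\<exists>N. \<forall>k\<ge>N. f (X k) \<le> f x" unfolding eventually_sequentially .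
  qed
  then show ?thesis using f dec by (auto simp: decreasing_convex_def)
qed

text \<open>The tangent at each of the two points lies below the function at the other; adding both
  inequalities compares the slopes.\<close>

lemma convex_derivative_mono:
  fixes f f' :: "real \<Rightarrow> real"
  assumes f: "convex_on {0<..} f" and d: "\<And>x. 0 < x \<Longrightarrow> (f has_real_derivative f' x) (at x)"
    and xy: "0 < x" "x \<le> y"
  shows "f' x \<le> f' y"
proof -
  have tangent: "f' a * (b - a) \<le> f b - f a" if "0 < a" "0 < b" for a b
    using that d by (intro convex_on_imp_above_tangent[OF f]) (auto intro: has_field_derivative_at_within simp: interior_open)
  have "f' x * (y - x) \<le> f' y * (y - x)"
    using tangent[of x y] tangent[of y x] xy by (simp add: algebra_simps)
  then show ?thesis
    using xy by (cases "x = y") auto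
qed

section \<open>The theorem\<close>

text \<open>The second difference of \<open>c\<close>, as a function of a real variable, has as
  derivative minus the second difference of \<open>m\<close>, which is nonpositive by convexity of
  \<open>m\<close>.\<close>

lemma third_difference_decreasing:
  fixes c m :: "real \<Rightarrow> real"
  assumes c: "\<And>x. 0 < x \<Longrightarrow> (c has_real_derivative - m x) (at x)" and m: "convex_on {0<..} m" and x: "0 < x"
  shows "c (x + 1) - 2 * c (x + 2) + c (x + 3) \<le> c x - 2 * c (x + 1) + c (x + 2)"
proof -
  define q where "q z = c z - 2 * c (z + 1) + c (z + 2)" for z
  have "q (x + 1) \<le> q x"
  proof (rule DERIV_nonpos_imp_nonincreasing[where f = q and a = x and b = "x + 1"])
    fix z assume "x \<le> z" "z \<le> x + 1"
    then have z: "0 < z" using x by simp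
    have "((\<lambda>z. c (z + 1)) has_real_derivative - m (z + 1)) (at z)" "((\<lambda>z. c (z + 2)) has_real_derivative - m (z + 2)) (at z)"
      using c[of "z + 1"] c[of "z + 2"] z by (simp_all add: DERIV_shift)
    then have "(q has_real_derivative - m z - 2 * (- m (z + 1)) + - m (z + 2)) (at z)"
      unfolding q_def[abs_def] by (intro DERIV_add DERIV_diff DERIV_cmult c z)
    moreover have "- m z - 2 * (- m (z + 1)) + - m (z + 2) \<le> 0" using convex_on_midpoint[OF m z] by simp
    ultimately show "\<exists>D. (q has_real_derivative D) (at z) \<and> D \<le> 0" by blast
  qed simp
  then show ?thesis by (simp add: q_def add.commute add.left_commute)
qed

section \<open>The multiplier and the coefficients of the deviation kernel\<close>

context
  fixes h g lam :: "real \<Rightarrow> real" and \<alpha> \<delta> :: real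
  assumes lam_eq: "lam = (\<lambda>x. (1 - h x) / x)" and lam_convex: "convex_on {0<..} lam"
    and \<alpha>: "0 < \<alpha>" "\<alpha> \<le> 1" and \<delta>: "0 < \<delta>" and g: "g \<in> Lp_space 1"
    and fourier_g: "\<forall>k::int. fourier_coeff g k = of_real (h (\<bar>of_int k\<bar> powr \<alpha> * \<delta>))"
begin

lemma multiplier_integrable: "integrable period g"
  using g by (simp add: Lp_space_1_iff periodic_L1_def)

lemma multiplier_coef:
  "cos_coef g (Suc k) = 2 * pi * h (real (Suc k) powr \<alpha> * \<delta>)" "sin_coef g (Suc k) = 0"
proof -
  have "fourier_coeff g (int (Suc k)) = of_real (h (real (Suc k) powr \<alpha> * \<delta>))"
    using fourier_g[rule_format, of "int (Suc k)"] by simp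
  then show "cos_coef g (Suc k) = 2 * pi * h (real (Suc k) powr \<alpha> * \<delta>)" "sin_coef g (Suc k) = 0"
    using fourier_coeff_cos_sin[OF multiplier_integrable, of "Suc k"] by (simp_all add: field_simps)
qed

text \<open>Fourier coefficients are bounded by the norm of \<open>g\<close>; with the division by x
  in \<lambda> this yields the limit 0 along the nodes.\<close>

lemma multiplier_bound: "\<bar>h (real (Suc k) powr \<alpha> * \<delta>)\<bar> \<le> (\<integral>t. \<bar>g t\<bar> \<partial>period) / (2 * pi)"
proof -
  have "\<bar>cos_coef g (Suc k)\<bar> \<le> (\<integral>t. \<bar>g t * cos (real (Suc k) * t)\<bar> \<partial>period)"
    unfolding cos_coef_def by (rule integral_abs_bound)
  also have "\<dots> \<le> (\<integral>t. \<bar>g t\<bar> \<partial>period)"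
  proof (rule integral_mono)
    show "\<bar>g t * cos (real (Suc k) * t)\<bar> \<le> \<bar>g t\<bar>" for t
      using mult_left_mono[OF abs_cos_le_one[of "real (Suc k) * t"] abs_ge_zero[of "g t"]] by (simp add: abs_mult)
  qed (use integrable_cos_sin(3)[OF multiplier_integrable] multiplier_integrable in auto)
  finally show ?thesis
    unfolding multiplier_coef by (simp add: abs_mult field_simps)
qed

lemma nodes_at_top: "filterlim (\<lambda>k. \<delta> * real (Suc k) powr \<alpha>) at_top sequentially"
  using \<delta> \<alpha>
  by (intro filterlim_tendsto_pos_mult_at_top[OF tendsto_const] filterlim_compose[OF real_powr_at_top]
      filterlim_compose[OF filterlim_real_sequentially] filterlim_Suc)

lemma lam_nodes_LIMSEQ: "(\<lambda>k. lam (\<delta> * real (Suc k) powr \<alpha>)) \<longlonglongrightarrow> 0"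
proof (rule Lim_null_comparison)
  define B where "B = (\<integral>t. \<bar>g t\<bar> \<partial>period) / (2 * pi)"
  show "(\<lambda>k. (1 + B) / (\<delta> * real (Suc k) powr \<alpha>)) \<longlonglongrightarrow> 0"
    by (rule tendsto_divide_0[OF tendsto_const filterlim_at_top_imp_at_infinity[OF nodes_at_top]])
  show "eventually (\<lambda>k. norm (lam (\<delta> * real (Suc k) powr \<alpha>)) \<le> (1 + B) / (\<delta> * real (Suc k) powr \<alpha>)) sequentially"
  proof (intro always_eventually allI)
    fix k
    have "\<bar>1 - h (\<delta> * real (Suc k) powr \<alpha>)\<bar> \<le> 1 + B"
      using multiplier_bound[of k] unfolding B_def by (simp add: mult.commute abs_le_iff)
    then show "norm (lam (\<delta> * real (Suc k) powr \<alpha>)) \<le> (1 + B) / (\<delta> * real (Suc k) powr \<alpha>)"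
      using \<delta> by (simp add: lam_eq abs_mult divide_right_mono)
  qed
qed

lemma lam_decreasing_convex: "decreasing_convex lam"
  by (rule decreasing_convex_of_limit[OF lam_convex nodes_at_top lam_nodes_LIMSEQ])

text \<open>The coefficient 2 (1 - h (x powr \<alpha> \<delta>)) / x powr r of the deviation kernel,
  rewritten through \<open>lam\<close> as a product of decreasing convex factors. The 2 stems from
  \<open>psi\<close>.\<close>

definition kernel_coef :: "real \<Rightarrow> real \<Rightarrow> real" where
  "kernel_coef r x = 2 * \<delta> * (lam (\<delta> * x powr \<alpha>) * x powr - (r - \<alpha>))"

lemma kernel_coef_eq: "0 < x \<Longrightarrow> kernel_coef r x = 2 / x powr r * (1 - h (x powr \<alpha> * \<delta>))"
  unfolding kernel_coef_def unfolding lam_eq using \<delta> by (simp add: powr_diff powr_minus field_simps)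

lemma decreasing_convex_lam_powr: "decreasing_convex (\<lambda>x. lam (\<delta> * x powr \<alpha>))"
  by (rule decreasing_convex_compose_powr[OF lam_decreasing_convex \<alpha> \<delta>])

lemma decreasing_convex_kernel_coef: "\<alpha> \<le> r \<Longrightarrow> decreasing_convex (kernel_coef r)"
  unfolding kernel_coef_def[abs_def] using \<delta>
  by (intro decreasing_convex_mult decreasing_convex_const decreasing_convex_lam_powr decreasing_convex_powr) auto

lemma kernel_coef_discrete_convex:
  assumes "\<alpha> \<le> r" "k \<ge> 1"
  shows "2 * kernel_coef r (real (Suc k)) \<le> kernel_coef r (real k) + kernel_coef r (real (Suc (Suc k)))"
  using convex_on_midpoint[OF decreasing_convexD(3)[OF decreasing_convex_kernel_coef[OF assms(1)], of 1], of "real k"] assms(2)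
  by (simp add: add.commute)

context
  fixes r :: real
  assumes r: "\<alpha> \<le> r"
begin

text \<open>The exponent of domination must lie strictly between 0 and 1 while \<open>r\<close> is
  unbounded; min r (1 / 2) serves for all r \<ge> \<alpha>.\<close>

lemma powr_neg_le_min: "real (Suc k) powr - r \<le> real (Suc k) powr - min r (1 / 2)"
  by (intro powr_mono) auto

lemma dominated_decreasing_powr: "dominated_decreasing 2 (min r (1 / 2)) (\<lambda>k. 2 / real k powr r)"
  unfolding dominated_decreasing_def
proof (intro allI conjI)
  fix k
  have "real (Suc (Suc k)) powr - r \<le> real (Suc k) powr - r"
    using r \<alpha> by (intro powr_mono2') auto
  then show "2 / real (Suc (Suc k)) powr r \<le> 2 / real (Suc k) powr r"
    by (simp add: powr_minus field_simps del: of_nat_Suc)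
  show "2 / real (Suc k) powr r \<le> 2 * real (Suc k) powr - min r (1 / 2)"
    using powr_neg_le_min[of k] by (simp add: powr_minus_divide[of _ r] del: of_nat_Suc)
qed simp

lemma dominated_decreasing_kernel_coef:
  "dominated_decreasing (2 * (1 + (\<integral>t. \<bar>g t\<bar> \<partial>period) / (2 * pi))) (min r (1 / 2)) (\<lambda>k. kernel_coef r (real k))"
  unfolding dominated_decreasing_def
proof (intro allI conjI)
  fix k
  let ?B = "(\<integral>t. \<bar>g t\<bar> \<partial>period) / (2 * pi)"
  note dc = decreasing_convexD[OF decreasing_convex_kernel_coef[OF r], of "real (Suc k)"]
  show "kernel_coef r (real (Suc (Suc k))) \<le> kernel_coef r (real (Suc k))" by (rule dc) auto
  show "0 \<le> kernel_coef r (real (Suc k))" by (rule dc) auto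
  have "kernel_coef r (real (Suc k)) = 2 * (1 - h (real (Suc k) powr \<alpha> * \<delta>)) * real (Suc k) powr - r"
    by (simp add: kernel_coef_eq powr_minus_divide del: of_nat_Suc)
  also have "\<dots> \<le> 2 * (1 + ?B) * real (Suc k) powr - r"
    using multiplier_bound[of k] by (intro mult_right_mono mult_left_mono) (auto simp: abs_le_iff)
  also have "\<dots> \<le> 2 * (1 + ?B) * real (Suc k) powr - min r (1 / 2)"
    by (intro mult_left_mono powr_neg_le_min) auto
  finally show "kernel_coef r (real (Suc k)) \<le> 2 * (1 + ?B) * real (Suc k) powr - min r (1 / 2)" .
qed

text \<open>Both parities of \<beta> share this evaluation: the sign (-1)^k cos (k \<beta> pi) is
  kept until the parity is known, and the approximation \<open>near\<close> is what each case has to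
  supply.\<close>

lemma error_from_near:
  fixes \<beta> :: real and p :: ereal
  assumes n: "n \<ge> 1" and p: "p = 1 \<or> p = \<infinity>" and \<beta>: "sin (\<beta> * pi) = 0"
    and near: "\<And>e. e > 0 \<Longrightarrow> \<exists>b. trig_poly_below n b \<and>
      (\<integral>t. \<bar>cosine_series (\<lambda>k. kernel_coef r (real k)) (\<beta> * pi / 2) t - b t\<bar> \<partial>period)
      \<le> (\<integral>t. cosine_series (\<lambda>k. kernel_coef r (real k)) (\<beta> * pi / 2) t * square_wave n (\<beta> * pi / 2) t \<partial>period) + e"
  shows "\<exists>S. (\<lambda>k. (1 - h (real (2 * k + 1) powr \<alpha> * real n powr \<alpha> * \<delta>)) / real (2 * k + 1) powr (r + 1)
          * ((-1) ^ k * cos (real k * (\<beta> * pi)))) sums S \<and>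
      approx_error p (Wclass p r \<beta> n) (\<lambda>f. convolution f g) = ereal (4 / (pi * real n powr r) * S)"
proof -
  define \<theta> where "\<theta> = \<beta> * pi / 2"
  define v where "v k = kernel_coef r (real k)" for k
  let ?K = "cosine_series v \<theta>" and ?\<rho> = "min r (1 / 2)"
  define I where "I = (\<integral>t. ?K t * square_wave n \<theta> t \<partial>period)"
  have \<rho>: "0 < ?\<rho>" "?\<rho> < 1" using r \<alpha> by auto
  have \<theta>: "sin (2 * \<theta>) = 0" using \<beta> by (simp add: \<theta>_def)
  note dv = dominated_decreasing_kernel_coef[folded v_def]
  have psi: "psi r \<beta> = cosine_series (\<lambda>k. 2 / real k powr r) \<theta>"
    by (simp add: psi_def cosine_series_def \<theta>_def fun_eq_iff)
  have v_eq: "v (Suc k) = 2 / real (Suc k) powr r * (1 - h (real (Suc k) powr \<alpha> * \<delta>))" for k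
    unfolding v_def by (rule kernel_coef_eq) simp
  have err: "approx_error p (Wclass p r \<beta> n) (\<lambda>f. convolution f g) = ereal (1 / (2 * pi) * I)"
    unfolding Wclass_def I_def
  proof (rule approx_error_eq_dual[OF n integrable_cosine_series[OF dv \<rho>] p _ multiplier_integrable])
    show "integrable period (psi r \<beta>)"
      unfolding psi by (rule integrable_cosine_series[OF dominated_decreasing_powr \<rho>])
    show "AE x in period. convolution \<phi> (psi r \<beta>) x - convolution (convolution \<phi> (psi r \<beta>)) g x = convolution \<phi> ?K x"
      if "periodic_L1 \<phi>" for \<phi>
      unfolding psi
      by (rule deviation_eq_convolution[where H = "\<lambda>k. h (real k powr \<alpha> * \<delta>)",
            OF that multiplier_integrable multiplier_coef dominated_decreasing_powr dv \<rho> v_eq])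
    show "\<exists>b. trig_poly_below n b \<and> (\<integral>t. \<bar>?K t - b t\<bar> \<partial>period) \<le> (\<integral>t. ?K t * square_wave n \<theta> t \<partial>period) + e"
      if "e > 0" for e
      using near[OF that] unfolding \<theta>_def v_def[abs_def] .
  qed
  have N: "real n powr r > 0" using n by simp
  \<comment> \<open>8 is the product of the 2 in \<open>kernel_coef\<close> and the 4 from the
    integral against the square wave; n powr r removes the power of \<open>n\<close> in the
    coefficient at (2 j + 1) n.\<close>
  have "(\<lambda>j. real n powr r / 8 * (v ((2 * j + 1) * n) * (4 / real (2 * j + 1) * ((-1) ^ j * cos (2 * real j * \<theta>)))))
      sums (real n powr r / 8 * I)"
    unfolding I_def by (intro sums_mult integral_cosine_series_square_wave[OF n \<theta> dv \<rho>])
  moreover have "real n powr r / 8 * (v ((2 * j + 1) * n) * (4 / real (2 * j + 1) * ((-1) ^ j * cos (2 * real j * \<theta>))))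
      = (1 - h (real (2 * j + 1) powr \<alpha> * real n powr \<alpha> * \<delta>)) / real (2 * j + 1) powr (r + 1)
          * ((-1) ^ j * cos (real j * (\<beta> * pi)))" for j
  proof -
    define J where "J = real (2 * j + 1)"
    have J: "0 < J" by (simp add: J_def)
    have prod: "real ((2 * j + 1) * n) = J * real n" by (simp only: J_def of_nat_mult)
    have "0 < J * real n" using J n by simp
    then have A: "v ((2 * j + 1) * n) = 2 / (J powr r * real n powr r) * (1 - h (J powr \<alpha> * real n powr \<alpha> * \<delta>))"
      unfolding v_def prod using J by (simp add: kernel_coef_eq powr_mult)
    have B: "2 * real j * \<theta> = real j * (\<beta> * pi)" by (simp add: \<theta>_def)
    have C: "J powr (r + 1) = J powr r * J" using J by (simp add: powr_add)
    show ?thesis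
      unfolding A B J_def[symmetric] C using N J by (simp add: field_simps)
  qed
  ultimately have S: "(\<lambda>j. (1 - h (real (2 * j + 1) powr \<alpha> * real n powr \<alpha> * \<delta>)) / real (2 * j + 1) powr (r + 1)
          * ((-1) ^ j * cos (real j * (\<beta> * pi)))) sums (real n powr r / 8 * I)" by simp
  have eq: "1 / (2 * pi) * I = 4 / (pi * real n powr r) * (real n powr r / 8 * I)"
    using N by (simp add: field_simps)
  show ?thesis
    using S err[unfolded eq] by (intro exI conjI)
qed

end

text \<open>By the product and chain rules the derivative of \<open>kernel_coef r\<close> is -m,
  with \<open>m\<close> a sum of products of decreasing convex functions; convexity of
  \<open>m\<close> gives the third differences.\<close>

lemma kernel_coef_third_difference:
  assumes r: "\<alpha> \<le> r" and C1: "lam C1_differentiable_on {0<..}" and conv: "convex_on {0<..} (\<lambda>x. - deriv lam x)" and k: "k \<ge> 1"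
  defines "v \<equiv> \<lambda>k. kernel_coef r (real k)"
  shows "v (Suc k) - 2 * v (Suc (Suc k)) + v (Suc (Suc (Suc k))) \<le> v k - 2 * v (Suc k) + v (Suc (Suc k))"
proof -
  define \<mu> where "\<mu> x = - deriv lam x" for x
  have lam_deriv: "(lam has_real_derivative - \<mu> x) (at x)" if "0 < x" for x
  proof -
    obtain D' where "\<forall>x\<in>{0<..}. (lam has_vector_derivative D' x) (at x)"
      using C1 unfolding C1_differentiable_on_def by blast
    then have D: "(lam has_real_derivative D' x) (at x)"
      using that by (simp add: has_real_derivative_iff_has_vector_derivative)
    then show ?thesis using DERIV_imp_deriv[OF D] by (simp add: \<mu>_def)
  qed
  \<comment> \<open>-\<lambda>' is decreasing because \<lambda> is convex, and nonnegative because
    \<lambda> decreases; its convexity is the additional assumption.\<close>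
  have \<mu>: "decreasing_convex \<mu>"
    unfolding decreasing_convex_def
  proof (intro conjI allI impI)
    show "convex_on {0<..} \<mu>" using conv unfolding \<mu>_def .
    show "\<mu> y \<le> \<mu> x" if "0 < x" "x \<le> y" for x y
      using convex_derivative_mono[OF lam_convex lam_deriv that] by simp
    show "0 \<le> \<mu> x" if "0 < x" for x
    proof -
      have "- \<mu> x * (x + 1 - x) \<le> lam (x + 1) - lam x"
        using that lam_deriv[OF that]
        by (intro convex_on_imp_above_tangent[OF lam_convex]) (auto intro: has_field_derivative_at_within simp: interior_open)
      also have "\<dots> \<le> 0" using decreasing_convexD(1)[OF lam_decreasing_convex that, of "x + 1"] by simp
      finally show ?thesis by simp
    qed
  qed
  \<comment> \<open>The exponents -(1 - \<alpha>), -(r - \<alpha>) and -(r - \<alpha> + 1) are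
    nonpositive since \<alpha> \<le> 1 and \<alpha> \<le> r, so each power is decreasing and
    convex.\<close>
  define m where "m x = 2 * \<delta> * (\<mu> (\<delta> * x powr \<alpha>) * (\<delta> * \<alpha> * x powr - (1 - \<alpha>)) * x powr - (r - \<alpha>)
      + lam (\<delta> * x powr \<alpha>) * ((r - \<alpha>) * x powr - (r - \<alpha> + 1)))" for x
  have m: "decreasing_convex m"
    unfolding m_def[abs_def] using \<alpha> \<delta> r
    by (intro decreasing_convex_mult decreasing_convex_add decreasing_convex_const decreasing_convex_lam_powr
        decreasing_convex_powr decreasing_convex_compose_powr[OF \<mu> \<alpha> \<delta>]) auto
  have deriv: "(kernel_coef r has_real_derivative - m x) (at x)" if x: "0 < x" for x
  proof -
    have "((\<lambda>x. \<delta> * x powr \<alpha>) has_real_derivative \<delta> * (\<alpha> * x powr (\<alpha> - 1))) (at x)"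
      using x by (auto intro!: derivative_eq_intros)
    moreover have "(lam has_real_derivative - \<mu> (\<delta> * x powr \<alpha>)) (at (\<delta> * x powr \<alpha>))"
      using x \<delta> by (intro lam_deriv) auto
    ultimately have L: "((\<lambda>x. lam (\<delta> * x powr \<alpha>)) has_real_derivative - \<mu> (\<delta> * x powr \<alpha>) * (\<delta> * (\<alpha> * x powr (\<alpha> - 1)))) (at x)"
      by (intro DERIV_chain2[where f = lam])
    have P: "((\<lambda>x. x powr - (r - \<alpha>)) has_real_derivative - (r - \<alpha>) * x powr (- (r - \<alpha>) - 1)) (at x)"
      using x by (auto intro!: derivative_eq_intros)
    have "(kernel_coef r has_real_derivative 2 * \<delta> * (- \<mu> (\<delta> * x powr \<alpha>) * (\<delta> * (\<alpha> * x powr (\<alpha> - 1))) * x powr - (r - \<alpha>)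
        + - (r - \<alpha>) * x powr (- (r - \<alpha>) - 1) * lam (\<delta> * x powr \<alpha>))) (at x)"
      unfolding kernel_coef_def[abs_def] by (rule DERIV_cmult[OF DERIV_mult[OF L P]])
    also have "2 * \<delta> * (- \<mu> (\<delta> * x powr \<alpha>) * (\<delta> * (\<alpha> * x powr (\<alpha> - 1))) * x powr - (r - \<alpha>)
        + - (r - \<alpha>) * x powr (- (r - \<alpha>) - 1) * lam (\<delta> * x powr \<alpha>)) = - m x"
    proof -
      have e: "- (1 - \<alpha>) = \<alpha> - 1" "- (r - \<alpha> + 1) = - (r - \<alpha>) - 1" by auto
      show ?thesis unfolding m_def e by (simp add: algebra_simps)
    qed
    finally show ?thesis .
  qed
  show ?thesis
    using third_difference_decreasing[OF deriv decreasing_convexD(3)[OF m, of 1], of "real k"] k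
    by (simp add: v_def add.commute)
qed

text \<open>The factor k lowers the exponent r by one, so the product keeps its structure with r
  \<ge> \<alpha> + 1 in place of r \<ge> \<alpha>. At r = \<alpha> + 1 the power is constant and the
  decay comes from \<lambda> alone.\<close>

lemma kernel_coef_weighted:
  assumes r: "\<alpha> + 1 \<le> r"
  defines "w \<equiv> \<lambda>k. real k * kernel_coef r (real k)"
  shows "k \<ge> 1 \<Longrightarrow> w (Suc k) \<le> w k"
    and "k \<ge> 1 \<Longrightarrow> 2 * w (Suc k) \<le> w k + w (Suc (Suc k))"
    and "w \<longlonglongrightarrow> 0"
proof -
  define W where "W x = 2 * \<delta> * (lam (\<delta> * x powr \<alpha>) * x powr - (r - \<alpha> - 1))" for x
  have W: "decreasing_convex W"
    unfolding W_def[abs_def] using \<delta> r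
    by (intro decreasing_convex_mult decreasing_convex_const decreasing_convex_lam_powr decreasing_convex_powr) auto
  have wW: "w k = W (real k)" if "k \<ge> 1" for k
  proof -
    have "real k > 0" using that by simp
    then have "real k * real k powr - (r - \<alpha>) = real k powr (1 + - (r - \<alpha>))"
      by (intro powr_mult_base) simp
    also have "1 + - (r - \<alpha>) = - (r - \<alpha> - 1)" by simp
    finally have "real k * real k powr - (r - \<alpha>) = real k powr - (r - \<alpha> - 1)" .
    then show ?thesis unfolding w_def W_def kernel_coef_def by (simp add: mult_ac)
  qed
  show "w (Suc k) \<le> w k" if "k \<ge> 1"
    using decreasing_convexD(1)[OF W, of "real k" "real (Suc k)"] that by (simp add: wW)
  show "2 * w (Suc k) \<le> w k + w (Suc (Suc k))" if "k \<ge> 1"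
    using convex_on_midpoint[OF decreasing_convexD(3)[OF W, of 1], of "real k"] that by (simp add: wW add.commute)
  have "(\<lambda>k. w (Suc k)) \<longlonglongrightarrow> 0"
  proof (rule tendsto_sandwich[where f = "\<lambda>_. 0" and h = "\<lambda>k. 2 * \<delta> * lam (\<delta> * real (Suc k) powr \<alpha>)"])
    show "(\<lambda>k. 2 * \<delta> * lam (\<delta> * real (Suc k) powr \<alpha>)) \<longlonglongrightarrow> 0"
      by (rule tendsto_mult_right_zero[OF lam_nodes_LIMSEQ])
    show "eventually (\<lambda>k. 0 \<le> w (Suc k)) sequentially"
      using decreasing_convexD(2)[OF W, of "real (Suc _)"] by (intro always_eventually allI) (simp add: wW)
    show "eventually (\<lambda>k. w (Suc k) \<le> 2 * \<delta> * lam (\<delta> * real (Suc k) powr \<alpha>)) sequentially"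
    proof (intro always_eventually allI)
      fix k
      have "0 \<le> lam (\<delta> * real (Suc k) powr \<alpha>)" using \<delta> by (intro decreasing_convexD(2)[OF lam_decreasing_convex]) auto
      moreover have "real (Suc k) powr - (r - \<alpha> - 1) \<le> real (Suc k) powr 0" using r by (intro powr_mono) auto
      ultimately have "lam (\<delta> * real (Suc k) powr \<alpha>) * real (Suc k) powr - (r - \<alpha> - 1) \<le> lam (\<delta> * real (Suc k) powr \<alpha>) * 1"
        by (intro mult_left_mono) auto
      then show "w (Suc k) \<le> 2 * \<delta> * lam (\<delta> * real (Suc k) powr \<alpha>)"
        using \<delta> unfolding wW[of "Suc k", simplified] W_def by (simp add: mult_left_mono)
    qed
  qed simp
  then show "w \<longlonglongrightarrow> 0" by (rule LIMSEQ_imp_Suc)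
qed

end

theorem mainTheorem2:
  fixes h g lam :: "real \<Rightarrow> real" and G :: "(real \<Rightarrow> real) \<Rightarrow> real \<Rightarrow> real"
    and \<alpha> \<delta> \<beta> :: real and p :: ereal
  defines "lam \<equiv> \<lambda>x. (1 - h x) / x"
    and "G \<equiv> \<lambda>f. convolution f g"
  assumes "convex_on {0<..} lam"
    and "0 < \<alpha>" and "\<alpha> \<le> 1" and "0 < \<delta>"
    and "g \<in> Lp_space 1"
    and "\<forall>k::int. fourier_coeff g k = of_real (h (\<bar>of_int k\<bar> powr \<alpha> * \<delta>))"
    and "p = 1 \<or> p = \<infinity>"
  shows
    "((\<exists>m::int. odd m \<and> \<beta> = of_int m) \<longrightarrow>
        (\<forall>(n::nat) r. 1 \<le> n \<and> \<alpha> \<le> r \<longrightarrow>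
           (\<exists>S. (\<lambda>k::nat. (1 - h (real (2 * k + 1) powr \<alpha> * real n powr \<alpha> * \<delta>))
                            / real (2 * k + 1) powr (r + 1)) sums S \<and>
                approx_error p (Wclass p r \<beta> n) G = ereal (4 / (pi * real n powr r) * S))))
     \<and>
     ((\<exists>m::int. even m \<and> \<beta> = of_int m) \<longrightarrow>
        (\<forall>(n::nat) r. n = 1 \<and> \<alpha> + 1 \<le> r \<longrightarrow>
           (\<exists>S. (\<lambda>k::nat. (1 - h (real (2 * k + 1) powr \<alpha> * real n powr \<alpha> * \<delta>))
                            / real (2 * k + 1) powr (r + 1) * (-1) ^ k) sums S \<and>
                approx_error p (Wclass p r \<beta> n) G = ereal (4 / (pi * real n powr r) * S)))
        \<and>
        (lam C1_differentiable_on {0<..} \<and> convex_on {0<..} (\<lambda>x. - deriv lam x) \<longrightarrow>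
          (\<forall>(n::nat) r. 1 \<le> n \<and> \<alpha> \<le> r \<longrightarrow>
            (\<exists>S. (\<lambda>k::nat. (1 - h (real (2 * k + 1) powr \<alpha> * real n powr \<alpha> * \<delta>))
                             / real (2 * k + 1) powr (r + 1) * (-1) ^ k) sums S \<and>
                 approx_error p (Wclass p r \<beta> n) G = ereal (4 / (pi * real n powr r) * S)))))"
proof -
  have lam_eq: "lam = (\<lambda>x. (1 - h x) / x)" by (simp add: lam_def)
  note hyps = lam_eq assms(3-8)
  have \<alpha>: "0 < \<alpha>" by (rule assms(4))
  have cos_int: "cos (of_int m * pi) = (if even m then 1 else -1)" for m :: int
    using cos_npi_int[of m] by (simp add: mult.commute)
  have sin_int: "sin (of_int m * pi) = 0" for m :: int
    using sin_npi_int[of m] by (simp add: mult.commute)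
  show ?thesis
  proof (intro conjI impI allI)
    fix n :: nat and r :: real
    assume "\<exists>m::int. odd m \<and> \<beta> = of_int m" and nr: "1 \<le> n \<and> \<alpha> \<le> r"
    then obtain m :: int where m: "odd m" "\<beta> = of_int m" by auto
    have n: "n \<ge> 1" and r: "\<alpha> \<le> r" using nr by auto
    have \<theta>: "sin (2 * (\<beta> * pi / 2)) = 0" "cos (2 * (\<beta> * pi / 2)) = -1"
      using m sin_int[of m] cos_int[of m] by simp_all
    have \<rho>: "0 < min r (1 / 2)" "min r (1 / 2) < 1" using r \<alpha> by auto
    \<comment> \<open>For odd \<beta> the alternating sign in the square wave integrals cancels
      against cos (k \<beta> pi).\<close>
    have sign: "(-1) ^ k * cos (real k * (\<beta> * pi)) = 1" for k
    proof -
      have "real k * (\<beta> * pi) = of_int (int k * m) * pi" by (simp add: m(2))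
      then have "cos (real k * (\<beta> * pi)) = (if even (int k * m) then 1 else -1)" by (simp only: cos_int)
      then show ?thesis using m(1) by simp
    qed
    have "\<exists>S. (\<lambda>k. (1 - h (real (2 * k + 1) powr \<alpha> * real n powr \<alpha> * \<delta>)) / real (2 * k + 1) powr (r + 1)
          * ((-1) ^ k * cos (real k * (\<beta> * pi)))) sums S \<and>
      approx_error p (Wclass p r \<beta> n) (\<lambda>f. convolution f g) = ereal (4 / (pi * real n powr r) * S)"
      by (rule error_from_near[OF hyps r n assms(9) _
            near_best_approximation_odd[OF n \<theta> dominated_decreasing_kernel_coef[OF hyps r] \<rho> kernel_coef_discrete_convex[OF hyps r]]])
        (use \<theta> in simp_all)
    then show "\<exists>S. (\<lambda>k::nat. (1 - h (real (2 * k + 1) powr \<alpha> * real n powr \<alpha> * \<delta>))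
          / real (2 * k + 1) powr (r + 1)) sums S \<and>
        approx_error p (Wclass p r \<beta> n) G = ereal (4 / (pi * real n powr r) * S)"
      unfolding sign G_def by simp
  next
    fix n :: nat and r :: real
    assume "\<exists>m::int. even m \<and> \<beta> = of_int m" and nr: "n = 1 \<and> \<alpha> + 1 \<le> r"
    then obtain m :: int where m: "even m" "\<beta> = of_int m" by auto
    have n: "n = Suc 0" and r1: "\<alpha> + 1 \<le> r" and r: "\<alpha> \<le> r" using nr by auto
    \<comment> \<open>For n = 1 the phase \<beta> pi / 2 itself is a multiple of pi, which makes the
      kernel even.\<close>
    obtain l where l: "m = 2 * l" using m(1) by blast
    have \<theta>: "sin (\<beta> * pi / 2) = 0" using sin_int[of l] by (simp add: m(2) l)
    have \<theta>2: "sin (\<beta> * pi) = 0" using m sin_int[of m] by simp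
    have \<rho>: "0 < min r (1 / 2)" "min r (1 / 2) < 1" using r \<alpha> by auto
    have sign: "(-1) ^ k * cos (real k * (\<beta> * pi)) = (-1) ^ k" for k
    proof -
      have "real k * (\<beta> * pi) = of_int (int k * m) * pi" by (simp add: m(2))
      then have "cos (real k * (\<beta> * pi)) = (if even (int k * m) then 1 else -1)" by (simp only: cos_int)
      then show ?thesis using m(1) by simp
    qed
    have "\<exists>S. (\<lambda>k. (1 - h (real (2 * k + 1) powr \<alpha> * real n powr \<alpha> * \<delta>)) / real (2 * k + 1) powr (r + 1)
          * ((-1) ^ k * cos (real k * (\<beta> * pi)))) sums S \<and>
      approx_error p (Wclass p r \<beta> n) (\<lambda>f. convolution f g) = ereal (4 / (pi * real n powr r) * S)"
    proof (rule error_from_near[OF hyps r _ assms(9) \<theta>2])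
      show "n \<ge> 1" by (simp add: n)
      show "\<exists>b. trig_poly_below n b \<and>
        (\<integral>t. \<bar>cosine_series (\<lambda>k. kernel_coef lam \<alpha> \<delta> r (real k)) (\<beta> * pi / 2) t - b t\<bar> \<partial>period)
        \<le> (\<integral>t. cosine_series (\<lambda>k. kernel_coef lam \<alpha> \<delta> r (real k)) (\<beta> * pi / 2) t * square_wave n (\<beta> * pi / 2) t \<partial>period) + e"
        if "e > 0" for e
        unfolding n
        by (rule near_best_approximation_first_even[OF \<theta> dominated_decreasing_kernel_coef[OF hyps r] \<rho>
              kernel_coef_weighted(1,2,3)[OF hyps r1] that])
    qed
    then show "\<exists>S. (\<lambda>k::nat. (1 - h (real (2 * k + 1) powr \<alpha> * real n powr \<alpha> * \<delta>))
          / real (2 * k + 1) powr (r + 1) * (-1) ^ k) sums S \<and>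
        approx_error p (Wclass p r \<beta> n) G = ereal (4 / (pi * real n powr r) * S)"
      unfolding sign G_def .
  next
    fix n :: nat and r :: real
    assume "\<exists>m::int. even m \<and> \<beta> = of_int m" and nr: "1 \<le> n \<and> \<alpha> \<le> r"
      and C1: "lam C1_differentiable_on {0<..} \<and> convex_on {0<..} (\<lambda>x. - deriv lam x)"
    then obtain m :: int where m: "even m" "\<beta> = of_int m" by auto
    have n: "n \<ge> 1" and r: "\<alpha> \<le> r" using nr by auto
    have \<theta>: "sin (2 * (\<beta> * pi / 2)) = 0" "cos (2 * (\<beta> * pi / 2)) = 1"
      using m sin_int[of m] cos_int[of m] by simp_all
    have \<rho>: "0 < min r (1 / 2)" "min r (1 / 2) < 1" using r \<alpha> by auto
    have sign: "(-1) ^ k * cos (real k * (\<beta> * pi)) = (-1) ^ k" for k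
    proof -
      have "real k * (\<beta> * pi) = of_int (int k * m) * pi" by (simp add: m(2))
      then have "cos (real k * (\<beta> * pi)) = (if even (int k * m) then 1 else -1)" by (simp only: cos_int)
      then show ?thesis using m(1) by simp
    qed
    have "\<exists>S. (\<lambda>k. (1 - h (real (2 * k + 1) powr \<alpha> * real n powr \<alpha> * \<delta>)) / real (2 * k + 1) powr (r + 1)
          * ((-1) ^ k * cos (real k * (\<beta> * pi)))) sums S \<and>
      approx_error p (Wclass p r \<beta> n) (\<lambda>f. convolution f g) = ereal (4 / (pi * real n powr r) * S)"
      by (rule error_from_near[OF hyps r n assms(9) _
            near_best_approximation_third_difference[OF n \<theta> dominated_decreasing_kernel_coef[OF hyps r] \<rho>
              kernel_coef_discrete_convex[OF hyps r] kernel_coef_third_difference[OF hyps r conjunct1[OF C1] conjunct2[OF C1]]]])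
        (use \<theta> in simp_all)
    then show "\<exists>S. (\<lambda>k::nat. (1 - h (real (2 * k + 1) powr \<alpha> * real n powr \<alpha> * \<delta>))
          / real (2 * k + 1) powr (r + 1) * (-1) ^ k) sums S \<and>
        approx_error p (Wclass p r \<beta> n) G = ereal (4 / (pi * real n powr r) * S)"
      unfolding sign G_def .
  qed
qed

end
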